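(* Let $\mathcal G$ be a (not necessarily Hausdorff) étale groupoid with locally compact Hausdorff unit space $X=\mathcal G^{(0)}$, equipped with a Fell line bundle $\mathcal L$. Let $A=C_0(X)$ and let $B$ be either $C^*(\mathcal G,\mathcal L)$ or $C^*_{\mathrm{red}}(\mathcal G,\mathcal L)$. Given $x\in X$, define $$\psi_x(f)=f(x),\qquad f\in B.$$ Then $\psi_x$ is an $N_{\mathcal G}$-canonical state relative to $x$, where $N_{\mathcal G}$ is the union of the sets $\mathscr C_0(U,\mathcal L)$ over all open bisections $U$ of $\mathcal G$ (a generating $*$-semigroup of normalizers).
   Context: An étale groupoid is a topological groupoid $\mathcal G$ (not necessarily Hausdorff) whose unit space $X$ is locally compact Hausdorff and whose range map $r:\mathcal G\to X$ (hence also the source map $s$) is a local homeomorphism. An open bisection is an open $U\subseteq\mathcal G$ on which $r$ and $s$ are injective. A Fell line bundle over $\mathcal G$ is a topological space $\mathcal L=\bigsqcup_{\gamma}\mathcal L_\gamma$ of one-dimensional complex Banach spaces, restricting to a continuous Banach bundle on every open bisection, with a continuous, bilinear, associative, submultiplicative multiplication $\mathcal L_{\gamma_1}\times\mathcal L_{\gamma_2}\to\mathcal L_{\gamma_1\gamma_2}$ (for composable pairs) and a continuous conjugate-linear, involutive, antimultiplicative adjoint $\mathcal L_\gamma\to\mathcal L_{\gamma^{-1}}$ with $\|\xi^*\xi\|=\|\xi\|^2$ and $\xi^*\xi\ge0$; for $x\in X$, $\mathcal L_x\cong\mathbb C$ canonically. For an open bisection $U$, $\mathscr C_c(U,\mathcal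 L)$ (resp. $\mathscr C_0(U,\mathcal L)$) is the set of sections of $\mathcal L$ over $\mathcal G$ obtained by extending by zero the continuous sections over $U$ that are compactly supported (resp. vanish at infinity); $\mathscr C_c(\mathcal G,\mathcal L)$ is the linear span of the $\mathscr C_c(U,\mathcal L)$, a $*$-algebra with $(f*g)(\gamma)=\sum_{\gamma_1\gamma_2=\gamma}f(\gamma_1)g(\gamma_2)$, $f^*(\gamma)=f(\gamma^{-1})^*$. $C^*(\mathcal G,\mathcal L)$ is its completion in the largest C*-norm; $C^*_{\mathrm{red}}(\mathcal G,\mathcal L)$ its completion in $\|f\|_{\mathrm{red}}=\sup_{x\in X}\|\pi_x(f)\|$, where $\pi_x$ acts on the square-summable sections of $\mathcal L$ over $s^{-1}(x)$ by $(\pi_x(f)\xi)(\gamma)=\sum_{\gamma_1\gamma_2=\gamma}f(\gamma_1)\xi(\gamma_2)$. Both norms restrict to the uniform norm on each $\mathscr C_c(U,\mathcal L)$, so each $\mathscr C_0(U,\mathcal L)$, in particular $C_0(X)$, embeds in both completions. Evaluation $f\mapsto f(\gamma)\in\mathcal L_\gamma$ on $\mathscr C_c(\mathcal G,\mathcal L)$ extends continuously to $C^*_{\mathrm{red}}(\mathcal G,\mathcal L)$, and to $C^*(\mathcal G,\mathcal L)$ through the canonical surjection $C^*(\mathcal G,\mathcal L)\to C^*_{\mathrm{red}}(\mathcal G,\mathcal L)$; for a unit $x$, $f(x)\in\mathcal L_x=\mathbb C$. A normalizer of $A$ in $B$ is $n\in B$ with $nAn^*\subseteq A$, $n^*An\subseteq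 A$. A $*$-semigroup $N$ of normalizers is generating if $\{na:n\in N,a\in A\}$ has dense linear span in $B$. For a normalizer $n$ let $\mathrm{dom}(n)=\{x\in X:(n^*n)(x)\ne0\}$ (note $n^*n\in A$) and let $T_n$ be the set of $x\in\mathrm{dom}(n)$ for which there is $v\in A$ with $v(x)=1$ and $nv\in A$. Given a generating $*$-semigroup $N$ of normalizers, a state $\psi$ on $B$ is $N$-canonical relative to $x\in X$ if $\psi$ restricts on $A$ to evaluation at $x$, and $\psi(n)=0$ for every $n\in N$ with $x\notin T_n$. *)

theory Defs
  imports "HOL-Analysis.Analysis" "HOL-Algebra.FiniteProduct"
begin

section \<open>Etale groupoids\<close>

text \<open>The arrows of a groupoid are the elements of a type; \<open>gmult\<close> is meaningful on composable
  pairs only. Units are arrows, so \<open>rng\<close> and \<open>src\<close> are maps from arrows to arrows. The topology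
  on the arrows is that of the type class, which is not assumed to be Hausdorff.\<close>

record 'g groupoid =
  rng :: "'g \<Rightarrow> 'g"
  src :: "'g \<Rightarrow> 'g"
  gmult :: "'g \<Rightarrow> 'g \<Rightarrow> 'g"
  ginv :: "'g \<Rightarrow> 'g"

definition units :: "('g, 'z) groupoid_scheme \<Rightarrow> 'g set" where
  "units G = range (rng G)"

definition is_groupoid :: "('g, 'z) groupoid_scheme \<Rightarrow> bool" where
  "is_groupoid G \<longleftrightarrow>
     (\<forall>x \<in> units G. rng G x = x \<and> src G x = x) \<and>
     (\<forall>g. src G g \<in> units G) \<and>
     (\<forall>g h. src G g = rng G h \<longrightarrow>
        rng G (gmult G g h) = rng G g \<and> src G (gmult G g h) = src G h) \<and>
     (\<forall>g h k. src G g = rng G h \<longrightarrow> src G h = rng G k \<longrightarrow>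
        gmult G (gmult G g h) k = gmult G g (gmult G h k)) \<and>
     (\<forall>g. gmult G (rng G g) g = g \<and> gmult G g (src G g) = g) \<and>
     (\<forall>g. rng G (ginv G g) = src G g \<and> src G (ginv G g) = rng G g \<and>
        gmult G g (ginv G g) = rng G g \<and> gmult G (ginv G g) g = src G g)"

definition topological_groupoid :: "('g::topological_space, 'z) groupoid_scheme \<Rightarrow> bool" where
  "topological_groupoid G \<longleftrightarrow>
     is_groupoid G \<and>
     continuous_on {(g, h). src G g = rng G h} (\<lambda>(g, h). gmult G g h) \<and>
     continuous_on UNIV (ginv G)"

definition local_homeomorphism ::
    "('a::topological_space \<Rightarrow> 'b::topological_space) \<Rightarrow> 'b set \<Rightarrow> bool" where
  "local_homeomorphism f Y \<longleftrightarrow>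
     range f \<subseteq> Y \<and>
     (\<forall>a. \<exists>U. open U \<and> a \<in> U \<and> openin (top_of_set Y) (f ` U) \<and>
        (\<exists>k. homeomorphism U (f ` U) f k))"

definition etale_groupoid :: "('g::topological_space, 'z) groupoid_scheme \<Rightarrow> bool" where
  "etale_groupoid G \<longleftrightarrow>
     topological_groupoid G \<and>
     Hausdorff_space (top_of_set (units G)) \<and>
     locally_compact_space (top_of_set (units G)) \<and>
     local_homeomorphism (rng G) (units G)"

definition open_bisection :: "('g::topological_space, 'z) groupoid_scheme \<Rightarrow> 'g set \<Rightarrow> bool" where
  "open_bisection G U \<longleftrightarrow> open U \<and> inj_on (rng G) U \<and> inj_on (src G) U"


section \<open>Fell line bundles\<close>

text \<open>The total space is the type \<open>'l\<close> with its type-class topology. The linear operations \<open>fadd\<close>,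
  \<open>fscale\<close> are those of the fibres, so \<open>fadd\<close> is meaningful only on pairs in a common fibre;
  \<open>fzero L g\<close> is the zero vector of the fibre over \<open>g\<close>.\<close>

record ('g, 'l) fell_bundle = "'g groupoid" +
  proj :: "'l \<Rightarrow> 'g"
  fadd :: "'l \<Rightarrow> 'l \<Rightarrow> 'l"
  fzero :: "'g \<Rightarrow> 'l"
  fscale :: "complex \<Rightarrow> 'l \<Rightarrow> 'l"
  fnorm :: "'l \<Rightarrow> real"
  fmult :: "'l \<Rightarrow> 'l \<Rightarrow> 'l"
  fadj :: "'l \<Rightarrow> 'l"

definition fibre :: "('g, 'l) fell_bundle \<Rightarrow> 'g \<Rightarrow> 'l set" where
  "fibre L g = {\<xi>. proj L \<xi> = g}"

definition fibre_group :: "('g, 'l) fell_bundle \<Rightarrow> 'g \<Rightarrow> 'l monoid" where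
  "fibre_group L g = \<lparr>carrier = fibre L g, mult = fadd L, one = fzero L g\<rparr>"

definition fdiff :: "('g, 'l) fell_bundle \<Rightarrow> 'l \<Rightarrow> 'l \<Rightarrow> 'l" where
  "fdiff L \<xi> \<eta> = fadd L \<xi> (fscale L (- 1) \<eta>)"

text \<open>A one-dimensional normed complex vector space; completeness is
  automatic in finite dimension.\<close>

definition line_fibre :: "('g, 'l) fell_bundle \<Rightarrow> 'g \<Rightarrow> bool" where
  "line_fibre L g \<longleftrightarrow>
     comm_group (fibre_group L g) \<and>
     (\<forall>c. \<forall>\<xi> \<in> fibre L g. fscale L c \<xi> \<in> fibre L g) \<and>
     (\<forall>c. \<forall>\<xi> \<in> fibre L g. \<forall>\<eta> \<in> fibre L g.
        fscale L c (fadd L \<xi> \<eta>) = fadd L (fscale L c \<xi>) (fscale L c \<eta>)) \<and>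
     (\<forall>c d. \<forall>\<xi> \<in> fibre L g. fscale L (c + d) \<xi> = fadd L (fscale L c \<xi>) (fscale L d \<xi>)) \<and>
     (\<forall>c d. \<forall>\<xi> \<in> fibre L g. fscale L (c * d) \<xi> = fscale L c (fscale L d \<xi>)) \<and>
     (\<forall>\<xi> \<in> fibre L g. fscale L 1 \<xi> = \<xi>) \<and>
     (\<forall>\<xi> \<in> fibre L g. 0 \<le> fnorm L \<xi> \<and> (fnorm L \<xi> = 0 \<longleftrightarrow> \<xi> = fzero L g)) \<and>
     (\<forall>\<xi> \<in> fibre L g. \<forall>\<eta> \<in> fibre L g. fnorm L (fadd L \<xi> \<eta>) \<le> fnorm L \<xi> + fnorm L \<eta>) \<and>
     (\<forall>c. \<forall>\<xi> \<in> fibre L g. fnorm L (fscale L c \<xi>) = cmod c * fnorm L \<xi>) \<and>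
     (\<exists>e \<in> fibre L g. e \<noteq> fzero L g \<and> (\<forall>\<xi> \<in> fibre L g. \<exists>c. \<xi> = fscale L c e))"

text \<open>The topological axioms of a continuous Banach bundle in the sense of Fell and Doran, for the
  restriction of the bundle to an open set \<open>U\<close>. The last one says that \<open>\<xi>\<^sub>i \<rightarrow> 0\<^sub>g\<close> whenever
  \<open>\<parallel>\<xi>\<^sub>i\<parallel> \<rightarrow> 0\<close> and \<open>proj \<xi>\<^sub>i \<rightarrow> g\<close>, with filters in place of nets.\<close>

definition continuous_banach_bundle_on ::
    "('g::topological_space, 'l::topological_space) fell_bundle \<Rightarrow> 'g set \<Rightarrow> bool" where
  "continuous_banach_bundle_on L U \<longleftrightarrow>
     continuous_on (proj L -` U) (proj L) \<and>
     (\<forall>W. openin (top_of_set (proj L -` U)) W \<longrightarrow> openin (top_of_set U) (proj L ` W)) \<and>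
     continuous_on {(\<xi>, \<eta>). proj L \<xi> \<in> U \<and> proj L \<eta> = proj L \<xi>} (\<lambda>(\<xi>, \<eta>). fadd L \<xi> \<eta>) \<and>
     (\<forall>c. continuous_on (proj L -` U) (fscale L c)) \<and>
     continuous_on (proj L -` U) (fnorm L) \<and>
     (\<forall>g \<in> U. \<forall>F. (fnorm L \<longlongrightarrow> 0) F \<longrightarrow> (proj L \<longlongrightarrow> g) F \<longrightarrow> ((\<lambda>\<xi>. \<xi>) \<longlongrightarrow> fzero L g) F)"

text \<open>For a unit \<open>x\<close> the fibre over \<open>x\<close> is a one-dimensional C*-algebra, hence has a unit;
  \<open>fscalar L\<close> is the resulting canonical identification of the fibre with the complex numbers.\<close>

definition funit :: "('g, 'l) fell_bundle \<Rightarrow> 'g \<Rightarrow> 'l" where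
  "funit L x = (THE e. e \<in> fibre L x \<and> (\<forall>\<xi> \<in> fibre L x. fmult L e \<xi> = \<xi> \<and> fmult L \<xi> e = \<xi>))"

definition fscalar :: "('g, 'l) fell_bundle \<Rightarrow> 'l \<Rightarrow> complex" where
  "fscalar L \<xi> = (THE c. \<xi> = fscale L c (funit L (proj L \<xi>)))"

definition composable :: "('g, 'l) fell_bundle \<Rightarrow> 'l \<Rightarrow> 'l \<Rightarrow> bool" where
  "composable L \<xi> \<eta> \<longleftrightarrow> src L (proj L \<xi>) = rng L (proj L \<eta>)"

definition fell_multiplication ::
    "('g::topological_space, 'l::topological_space) fell_bundle \<Rightarrow> bool" where
  "fell_multiplication L \<longleftrightarrow>
     continuous_on {(\<xi>, \<eta>). composable L \<xi> \<eta>} (\<lambda>(\<xi>, \<eta>). fmult L \<xi> \<eta>) \<and>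
     (\<forall>\<xi> \<eta>. composable L \<xi> \<eta> \<longrightarrow> proj L (fmult L \<xi> \<eta>) = gmult L (proj L \<xi>) (proj L \<eta>)) \<and>
     (\<forall>\<xi> \<xi>' \<eta>. composable L \<xi> \<eta> \<longrightarrow> proj L \<xi>' = proj L \<xi> \<longrightarrow>
        fmult L (fadd L \<xi> \<xi>') \<eta> = fadd L (fmult L \<xi> \<eta>) (fmult L \<xi>' \<eta>)) \<and>
     (\<forall>\<xi> \<eta> \<eta>'. composable L \<xi> \<eta> \<longrightarrow> proj L \<eta>' = proj L \<eta> \<longrightarrow>
        fmult L \<xi> (fadd L \<eta> \<eta>') = fadd L (fmult L \<xi> \<eta>) (fmult L \<xi> \<eta>')) \<and>
     (\<forall>c \<xi> \<eta>. composable L \<xi> \<eta> \<longrightarrow>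
        fmult L (fscale L c \<xi>) \<eta> = fscale L c (fmult L \<xi> \<eta>) \<and>
        fmult L \<xi> (fscale L c \<eta>) = fscale L c (fmult L \<xi> \<eta>)) \<and>
     (\<forall>\<xi> \<eta> \<zeta>. composable L \<xi> \<eta> \<longrightarrow> composable L \<eta> \<zeta> \<longrightarrow>
        fmult L (fmult L \<xi> \<eta>) \<zeta> = fmult L \<xi> (fmult L \<eta> \<zeta>)) \<and>
     (\<forall>\<xi> \<eta>. composable L \<xi> \<eta> \<longrightarrow> fnorm L (fmult L \<xi> \<eta>) \<le> fnorm L \<xi> * fnorm L \<eta>)"

definition fell_adjoint ::
    "('g::topological_space, 'l::topological_space) fell_bundle \<Rightarrow> bool" where
  "fell_adjoint L \<longleftrightarrow>
     continuous_on UNIV (fadj L) \<and>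
     (\<forall>\<xi>. proj L (fadj L \<xi>) = ginv L (proj L \<xi>)) \<and>
     (\<forall>\<xi> \<eta>. proj L \<xi> = proj L \<eta> \<longrightarrow> fadj L (fadd L \<xi> \<eta>) = fadd L (fadj L \<xi>) (fadj L \<eta>)) \<and>
     (\<forall>c \<xi>. fadj L (fscale L c \<xi>) = fscale L (cnj c) (fadj L \<xi>)) \<and>
     (\<forall>\<xi>. fadj L (fadj L \<xi>) = \<xi>) \<and>
     (\<forall>\<xi> \<eta>. composable L \<xi> \<eta> \<longrightarrow> fadj L (fmult L \<xi> \<eta>) = fmult L (fadj L \<eta>) (fadj L \<xi>)) \<and>
     (\<forall>\<xi>. fnorm L (fmult L (fadj L \<xi>) \<xi>) = (fnorm L \<xi>)\<^sup>2) \<and>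
     (\<forall>\<xi>. fscalar L (fmult L (fadj L \<xi>) \<xi>) \<in> \<real>\<^sub>\<ge>\<^sub>0)"

definition fell_line_bundle ::
    "('g::topological_space, 'l::topological_space) fell_bundle \<Rightarrow> bool" where
  "fell_line_bundle L \<longleftrightarrow>
     etale_groupoid L \<and>
     continuous_on UNIV (proj L) \<and>
     (\<forall>g. line_fibre L g) \<and>
     (\<forall>U. open_bisection L U \<longrightarrow> continuous_banach_bundle_on L U) \<and>
     fell_multiplication L \<and>
     fell_adjoint L"


section \<open>Star-algebras and completions\<close>

record 'a star_alg = "'a partial_object" +
  aplus :: "'a \<Rightarrow> 'a \<Rightarrow> 'a"
  azero :: 'a
  ascale :: "complex \<Rightarrow> 'a \<Rightarrow> 'a"
  atimes :: "'a \<Rightarrow> 'a \<Rightarrow> 'a"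
  astar :: "'a \<Rightarrow> 'a"

record 'a normed_star_alg = "'a star_alg" +
  anorm :: "'a \<Rightarrow> real"

definition aminus :: "('a, 'z) star_alg_scheme \<Rightarrow> 'a \<Rightarrow> 'a \<Rightarrow> 'a" where
  "aminus S a b = aplus S a (ascale S (- 1) b)"

inductive_set lin_span :: "('a, 'z) star_alg_scheme \<Rightarrow> 'a set \<Rightarrow> 'a set"
  for S :: "('a, 'z) star_alg_scheme" and M :: "'a set" where
  zero: "azero S \<in> lin_span S M"
| base: "a \<in> M \<Longrightarrow> a \<in> lin_span S M"
| plus: "a \<in> lin_span S M \<Longrightarrow> b \<in> lin_span S M \<Longrightarrow> aplus S a b \<in> lin_span S M"
| scale: "a \<in> lin_span S M \<Longrightarrow> ascale S c a \<in> lin_span S M"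

definition cstar_norm :: "('a, 'z) star_alg_scheme \<Rightarrow> ('a \<Rightarrow> real) \<Rightarrow> bool" where
  "cstar_norm S \<nu> \<longleftrightarrow>
     (\<forall>a \<in> carrier S. 0 \<le> \<nu> a \<and> (\<nu> a = 0 \<longleftrightarrow> a = azero S)) \<and>
     (\<forall>a \<in> carrier S. \<forall>b \<in> carrier S. \<nu> (aplus S a b) \<le> \<nu> a + \<nu> b) \<and>
     (\<forall>c. \<forall>a \<in> carrier S. \<nu> (ascale S c a) = cmod c * \<nu> a) \<and>
     (\<forall>a \<in> carrier S. \<forall>b \<in> carrier S. \<nu> (atimes S a b) \<le> \<nu> a * \<nu> b) \<and>
     (\<forall>a \<in> carrier S. \<nu> (atimes S (astar S a) a) = (\<nu> a)\<^sup>2)"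

definition largest_cstar_norm :: "('a, 'z) star_alg_scheme \<Rightarrow> 'a \<Rightarrow> real" where
  "largest_cstar_norm S a = Sup {\<nu> a |\<nu>. cstar_norm S \<nu>}"

definition cauchy_seqs :: "('a, 'z) star_alg_scheme \<Rightarrow> ('a \<Rightarrow> real) \<Rightarrow> (nat \<Rightarrow> 'a) set" where
  "cauchy_seqs S \<nu> =
     {F. (\<forall>n. F n \<in> carrier S) \<and>
         (\<forall>\<epsilon>>0. \<exists>N. \<forall>m\<ge>N. \<forall>n\<ge>N. \<nu> (aminus S (F m) (F n)) < \<epsilon>)}"

definition cauchy_rel ::
    "('a, 'z) star_alg_scheme \<Rightarrow> ('a \<Rightarrow> real) \<Rightarrow> ((nat \<Rightarrow> 'a) \<times> (nat \<Rightarrow> 'a)) set" where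
  "cauchy_rel S \<nu> =
     {(F, H). F \<in> cauchy_seqs S \<nu> \<and> H \<in> cauchy_seqs S \<nu> \<and>
              (\<lambda>n. \<nu> (aminus S (F n) (H n))) \<longlonglongrightarrow> 0}"

definition completion ::
    "('a, 'z) star_alg_scheme \<Rightarrow> ('a \<Rightarrow> real) \<Rightarrow> (nat \<Rightarrow> 'a) set normed_star_alg" where
  "completion S \<nu> =
     \<lparr>carrier = cauchy_seqs S \<nu> // cauchy_rel S \<nu>,
      aplus = (\<lambda>a b. \<Union>F\<in>a. \<Union>H\<in>b. cauchy_rel S \<nu> `` {\<lambda>n. aplus S (F n) (H n)}),
      azero = cauchy_rel S \<nu> `` {\<lambda>n. azero S},
      ascale = (\<lambda>c a. \<Union>F\<in>a. cauchy_rel S \<nu> `` {\<lambda>n. ascale S c (F n)}),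
      atimes = (\<lambda>a b. \<Union>F\<in>a. \<Union>H\<in>b. cauchy_rel S \<nu> `` {\<lambda>n. atimes S (F n) (H n)}),
      astar = (\<lambda>a. \<Union>F\<in>a. cauchy_rel S \<nu> `` {\<lambda>n. astar S (F n)}),
      anorm = (\<lambda>a. the_elem ((\<lambda>F. lim (\<lambda>n. \<nu> (F n))) ` a))\<rparr>"

text \<open>The extension of the identity of \<open>S\<close> to a map from the completion in a norm to the completion
  in a smaller norm \<open>\<nu>\<close>.\<close>

definition completion_map ::
    "('a, 'z) star_alg_scheme \<Rightarrow> ('a \<Rightarrow> real) \<Rightarrow> (nat \<Rightarrow> 'a) set \<Rightarrow> (nat \<Rightarrow> 'a) set" where
  "completion_map S \<nu> a = (\<Union>F\<in>a. cauchy_rel S \<nu> `` {F})"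


section \<open>The convolution algebra and its C*-completions\<close>

definition bundle_sections :: "('g, 'l) fell_bundle \<Rightarrow> ('g \<Rightarrow> 'l) set" where
  "bundle_sections L = {f. \<forall>g. f g \<in> fibre L g}"

definition Cc_on ::
    "('g::topological_space, 'l::topological_space) fell_bundle \<Rightarrow> 'g set \<Rightarrow> ('g \<Rightarrow> 'l) set" where
  "Cc_on L U =
     {f \<in> bundle_sections L. (\<forall>g. g \<notin> U \<longrightarrow> f g = fzero L g) \<and> continuous_on U f \<and>
        compact (U \<inter> closure {g \<in> U. f g \<noteq> fzero L g})}"

definition C0_on ::
    "('g::topological_space, 'l::topological_space) fell_bundle \<Rightarrow> 'g set \<Rightarrow> ('g \<Rightarrow> 'l) set" where
  "C0_on L U =
     {f \<in> bundle_sections L. (\<forall>g. g \<notin> U \<longrightarrow> f g = fzero L g) \<and> continuous_on U f \<and>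
        (\<forall>\<epsilon>>0. compact {g \<in> U. \<epsilon> \<le> fnorm L (f g)})}"

text \<open>The sum in the fibre over \<open>g\<close> is taken over the non-zero terms, which are finite in number
  when \<open>f\<close> is in the algebra \<open>conv_alg L\<close> below and \<open>f'\<close> is any section.\<close>

definition convolution ::
    "('g, 'l) fell_bundle \<Rightarrow> ('g \<Rightarrow> 'l) \<Rightarrow> ('g \<Rightarrow> 'l) \<Rightarrow> 'g \<Rightarrow> 'l" where
  "convolution L f f' g =
     finprod (fibre_group L g) (\<lambda>(h, k). fmult L (f h) (f' k))
       {(h, k). src L h = rng L k \<and> gmult L h k = g \<and> fmult L (f h) (f' k) \<noteq> fzero L g}"

definition section_alg :: "('g, 'l) fell_bundle \<Rightarrow> ('g \<Rightarrow> 'l) star_alg" where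
  "section_alg L =
     \<lparr>carrier = bundle_sections L,
      aplus = (\<lambda>f f' g. fadd L (f g) (f' g)),
      azero = fzero L,
      ascale = (\<lambda>c f g. fscale L c (f g)),
      atimes = convolution L,
      astar = (\<lambda>f g. fadj L (f (ginv L g)))\<rparr>"

definition conv_alg ::
    "('g::topological_space, 'l::topological_space) fell_bundle \<Rightarrow> ('g \<Rightarrow> 'l) star_alg" where
  "conv_alg L =
     (section_alg L)\<lparr>carrier := lin_span (section_alg L) (\<Union>U\<in>{U. open_bisection L U}. Cc_on L U)\<rparr>"

text \<open>Sections over the source fibre of \<open>x\<close> are extended by zero to all arrows, so that the
  representation \<open>\<pi>\<^sub>x f\<close> is left convolution by \<open>f\<close>.\<close>

definition l2_sections :: "('g, 'l) fell_bundle \<Rightarrow> 'g \<Rightarrow> ('g \<Rightarrow> 'l) set" where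
  "l2_sections L x =
     {\<xi> \<in> bundle_sections L. (\<forall>g. src L g \<noteq> x \<longrightarrow> \<xi> g = fzero L g) \<and>
        (\<lambda>g. (fnorm L (\<xi> g))\<^sup>2) summable_on {g. src L g = x}}"

definition l2_norm :: "('g, 'l) fell_bundle \<Rightarrow> 'g \<Rightarrow> ('g \<Rightarrow> 'l) \<Rightarrow> real" where
  "l2_norm L x \<xi> = sqrt (\<Sum>\<^sub>\<infinity>g\<in>{g. src L g = x}. (fnorm L (\<xi> g))\<^sup>2)"

definition rep_norm :: "('g, 'l) fell_bundle \<Rightarrow> 'g \<Rightarrow> ('g \<Rightarrow> 'l) \<Rightarrow> real" where
  "rep_norm L x f = Sup {l2_norm L x (convolution L f \<xi>) |\<xi>. \<xi> \<in> l2_sections L x \<and> l2_norm L x \<xi> \<le> 1}"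

definition full_norm ::
    "('g::topological_space, 'l::topological_space) fell_bundle \<Rightarrow> ('g \<Rightarrow> 'l) \<Rightarrow> real" where
  "full_norm L = largest_cstar_norm (conv_alg L)"

definition red_norm :: "('g, 'l) fell_bundle \<Rightarrow> ('g \<Rightarrow> 'l) \<Rightarrow> real" where
  "red_norm L f = (SUP x\<in>units L. rep_norm L x f)"

definition full_cstar :: "('g::topological_space, 'l::topological_space) fell_bundle \<Rightarrow>
    (nat \<Rightarrow> 'g \<Rightarrow> 'l) set normed_star_alg" where
  "full_cstar L = completion (conv_alg L) (full_norm L)"

definition red_cstar :: "('g::topological_space, 'l::topological_space) fell_bundle \<Rightarrow>
    (nat \<Rightarrow> 'g \<Rightarrow> 'l) set normed_star_alg" where
  "red_cstar L = completion (conv_alg L) (red_norm L)"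

definition full_to_red :: "('g::topological_space, 'l::topological_space) fell_bundle \<Rightarrow>
    (nat \<Rightarrow> 'g \<Rightarrow> 'l) set \<Rightarrow> (nat \<Rightarrow> 'g \<Rightarrow> 'l) set" where
  "full_to_red L = completion_map (conv_alg L) (red_norm L)"

text \<open>The image in the completion in the norm \<open>\<nu>\<close> of a section \<open>f\<close> in \<open>C0_on L U\<close>: the class of any
  sequence in \<open>Cc_on L U\<close> that converges uniformly to \<open>f\<close>.\<close>

definition C0_embed :: "('g::topological_space, 'l::topological_space) fell_bundle \<Rightarrow>
    (('g \<Rightarrow> 'l) \<Rightarrow> real) \<Rightarrow> 'g set \<Rightarrow> ('g \<Rightarrow> 'l) \<Rightarrow> (nat \<Rightarrow> 'g \<Rightarrow> 'l) set" where
  "C0_embed L \<nu> U f =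
     (\<Union>F\<in>{F. (\<forall>n. F n \<in> Cc_on L U) \<and>
              uniform_limit UNIV (\<lambda>n g. fnorm L (fdiff L (F n g) (f g))) (\<lambda>g. 0) sequentially}.
        cauchy_rel (conv_alg L) \<nu> `` {F})"

definition bisection_elements :: "('g::topological_space, 'l::topological_space) fell_bundle \<Rightarrow>
    (('g \<Rightarrow> 'l) \<Rightarrow> real) \<Rightarrow> (nat \<Rightarrow> 'g \<Rightarrow> 'l) set set" where
  "bisection_elements L \<nu> = (\<Union>U\<in>{U. open_bisection L U}. C0_embed L \<nu> U ` C0_on L U)"

definition C0_functions :: "'g::topological_space set \<Rightarrow> ('g \<Rightarrow> complex) set" where
  "C0_functions X = {h. continuous_on X h \<and> (\<forall>\<epsilon>>0. compact {x \<in> X. \<epsilon> \<le> cmod (h x)})}"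

definition scalar_section :: "('g, 'l) fell_bundle \<Rightarrow> ('g \<Rightarrow> complex) \<Rightarrow> 'g \<Rightarrow> 'l" where
  "scalar_section L h g = (if g \<in> units L then fscale L (h g) (funit L g) else fzero L g)"

definition unit_embed :: "('g::topological_space, 'l::topological_space) fell_bundle \<Rightarrow>
    (('g \<Rightarrow> 'l) \<Rightarrow> real) \<Rightarrow> ('g \<Rightarrow> complex) \<Rightarrow> (nat \<Rightarrow> 'g \<Rightarrow> 'l) set" where
  "unit_embed L \<nu> h = C0_embed L \<nu> (units L) (scalar_section L h)"

definition red_eval ::
    "('g, 'l) fell_bundle \<Rightarrow> 'g \<Rightarrow> (nat \<Rightarrow> 'g \<Rightarrow> 'l) set \<Rightarrow> 'l" where
  "red_eval L g b =
     (THE \<xi>. \<xi> \<in> fibre L g \<and> (\<forall>F\<in>b. (\<lambda>n. fnorm L (fdiff L (F n g) \<xi>)) \<longlonglongrightarrow> 0))"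

definition psi_red ::
    "('g, 'l) fell_bundle \<Rightarrow> 'g \<Rightarrow> (nat \<Rightarrow> 'g \<Rightarrow> 'l) set \<Rightarrow> complex" where
  "psi_red L x b = fscalar L (red_eval L x b)"

definition psi_full :: "('g::topological_space, 'l::topological_space) fell_bundle \<Rightarrow>
    'g \<Rightarrow> (nat \<Rightarrow> 'g \<Rightarrow> 'l) set \<Rightarrow> complex" where
  "psi_full L x b = psi_red L x (full_to_red L b)"


section \<open>Normalizers and canonical states\<close>

text \<open>Here \<open>j\<close> embeds \<open>C0_functions X\<close> in the C*-algebra \<open>B\<close> and \<open>A\<close> is its image. Values of an element
  of \<open>A\<close> at \<open>x\<close> are the values of the function on \<open>X\<close> that it comes from.\<close>

definition is_normalizer :: "'b normed_star_alg \<Rightarrow> 'b set \<Rightarrow> 'b \<Rightarrow> bool" where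
  "is_normalizer B A n \<longleftrightarrow>
     n \<in> carrier B \<and>
     (\<forall>a\<in>A. atimes B (atimes B n a) (astar B n) \<in> A) \<and>
     (\<forall>a\<in>A. atimes B (atimes B (astar B n) a) n \<in> A)"

definition star_semigroup :: "'b normed_star_alg \<Rightarrow> 'b set \<Rightarrow> bool" where
  "star_semigroup B N \<longleftrightarrow>
     N \<subseteq> carrier B \<and> (\<forall>m\<in>N. \<forall>n\<in>N. atimes B m n \<in> N) \<and> (\<forall>n\<in>N. astar B n \<in> N)"

definition dense_in :: "'b normed_star_alg \<Rightarrow> 'b set \<Rightarrow> bool" where
  "dense_in B D \<longleftrightarrow> D \<subseteq> carrier B \<and> (\<forall>b\<in>carrier B. \<forall>\<epsilon>>0. \<exists>d\<in>D. anorm B (aminus B b d) < \<epsilon>)"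

definition generating_normalizer_semigroup ::
    "'b normed_star_alg \<Rightarrow> 'b set \<Rightarrow> 'b set \<Rightarrow> bool" where
  "generating_normalizer_semigroup B A N \<longleftrightarrow>
     star_semigroup B N \<and>
     (\<forall>n\<in>N. is_normalizer B A n) \<and>
     dense_in B (lin_span B {atimes B n a |n a. n \<in> N \<and> a \<in> A})"

definition normalizer_dom :: "'b normed_star_alg \<Rightarrow> 'x::topological_space set \<Rightarrow>
    (('x \<Rightarrow> complex) \<Rightarrow> 'b) \<Rightarrow> 'b \<Rightarrow> 'x set" where
  "normalizer_dom B X j n =
     {x \<in> X. \<exists>h \<in> C0_functions X. j h = atimes B (astar B n) n \<and> h x \<noteq> 0}"

definition trivial_points :: "'b normed_star_alg \<Rightarrow> 'x::topological_space set \<Rightarrow>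
    (('x \<Rightarrow> complex) \<Rightarrow> 'b) \<Rightarrow> 'b \<Rightarrow> 'x set" where
  "trivial_points B X j n =
     {x \<in> normalizer_dom B X j n.
        \<exists>v \<in> C0_functions X. v x = 1 \<and> atimes B n (j v) \<in> j ` C0_functions X}"

definition is_state :: "'b normed_star_alg \<Rightarrow> ('b \<Rightarrow> complex) \<Rightarrow> bool" where
  "is_state B \<psi> \<longleftrightarrow>
     (\<forall>a\<in>carrier B. \<forall>b\<in>carrier B. \<psi> (aplus B a b) = \<psi> a + \<psi> b) \<and>
     (\<forall>c. \<forall>b\<in>carrier B. \<psi> (ascale B c b) = c * \<psi> b) \<and>
     (\<forall>b\<in>carrier B. \<psi> (atimes B (astar B b) b) \<in> \<real>\<^sub>\<ge>\<^sub>0) \<and>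
     bdd_above {cmod (\<psi> b) |b. b \<in> carrier B \<and> anorm B b \<le> 1} \<and>
     Sup {cmod (\<psi> b) |b. b \<in> carrier B \<and> anorm B b \<le> 1} = 1"

definition canonical_state :: "'b normed_star_alg \<Rightarrow> 'x::topological_space set \<Rightarrow>
    (('x \<Rightarrow> complex) \<Rightarrow> 'b) \<Rightarrow> 'b set \<Rightarrow> 'x \<Rightarrow> ('b \<Rightarrow> complex) \<Rightarrow> bool" where
  "canonical_state B X j N x \<psi> \<longleftrightarrow>
     is_state B \<psi> \<and>
     (\<forall>h \<in> C0_functions X. \<psi> (j h) = h x) \<and>
     (\<forall>n\<in>N. x \<notin> trivial_points B X j n \<longrightarrow> \<psi> n = 0)"

end

theory Submission
  imports Defs
begin

text \<open>
  The conclusion rests on three facts about the \<open>C*\<close>-norms \<open>\<nu>\<close> on the convolution algebra: on a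
  section \<open>f\<close> that is supported in one open bisection \<open>\<nu> f\<close> is at most the uniform norm of \<open>f\<close>; the
  reduced norm is such a norm, and it dominates all values \<open>\<parallel>f g\<parallel>\<close>; hence the supremum of all these
  norms, the full norm, is finite and has the same two properties.

  The reduced norm is understood through matrices. Choose a unit vector \<open>e g\<close> in every fibre. For
  arrows \<open>g\<close> and \<open>k\<close> with a common source, \<open>f (g k\<^sup>-\<^sup>1) e k\<close> is a multiple \<open>K f g k\<close> of \<open>e g\<close>, and
  \<open>f \<mapsto> K f\<close> turns convolution into the matrix product and the adjoint into the conjugate transpose
  (\<open>K_conv\<close>, \<open>K_star\<close>). The representation at \<open>x\<close> is the matrix \<open>K f\<close> restricted to the source
  fibre of \<open>x\<close>. Rows and columns are finite, so the \<open>C*\<close>-identity is the Cauchy-Schwarz inequality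
  for finite sums (\<open>op_bdd_star_conv\<close>). If \<open>f\<close> lives on a bisection, every row and column has at most
  one non-zero entry, which bounds the matrix by the uniform norm of \<open>f\<close>.

  For an arbitrary \<open>C*\<close>-norm the same bound comes from unitaries (\<open>cstar_le_aux\<close>). It suffices
  to treat \<open>k = f* f\<close>, a function on the unit space with \<open>0 \<le> k \<le> 1\<close>. If \<open>u = k + i \<surd>(1 - k\<^sup>2)\<close> then
  \<open>\<bar>u\<bar> = 1\<close>, so \<open>u k\<close> and its conjugate counterpart have the norm of \<open>k\<close>, and \<open>k\<^sup>2\<close> is their mean;
  thus \<open>\<nu>(k)\<^sup>2 = \<nu>(k\<^sup>2) \<le> \<nu>(k)\<close>.

  Both completions can now be treated together. Since \<open>\<nu>\<close> is the uniform norm on each bisection, an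
  element of \<open>N\<close> is the class of a Cauchy sequence of compactly supported continuous sections on one
  bisection, and \<open>A\<close> is the case in which that bisection is the unit space (\<open>N_iff\<close>, \<open>cls_j\<close>, \<open>j_cls\<close>).
  That \<open>N\<close> is a \<open>*\<close>-semigroup of normalizers then follows from the support of a convolution: products
  and inverses of bisections are bisections, and \<open>U X U\<^sup>-\<^sup>1\<close> consists of units. It generates, because
  a section \<open>f\<close> on a bisection is close to \<open>f a\<close> for a suitable function \<open>a\<close> of \<open>f* f\<close>.

  The state \<open>\<psi>\<close> sends the class of \<open>F\<close> to the limit of \<open>F n x\<close>. It is contractive because \<open>\<nu>\<close>
  dominates values, and positive because \<open>(f* f)(x)\<close> is a sum of squares of matrix entries. If
  \<open>\<psi> n \<noteq> 0\<close> for a normalizer \<open>n\<close> on the bisection \<open>U\<close>, then \<open>x\<close> is a unit in \<open>U\<close> and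
  \<open>(n* n)(x) = \<bar>\<psi> n\<bar>\<^sup>2\<close>. Let \<open>v\<close> be a bump function at \<open>x\<close> supported in the units of \<open>U\<close>. Where \<open>n v\<close> is
  non-zero at an arrow \<open>g\<close>, both \<open>g\<close> and its source lie in \<open>U\<close> and have the same source, so \<open>g\<close> is a
  unit. Therefore \<open>n v\<close> belongs to \<open>A\<close> and \<open>x\<close> is a trivial point of \<open>n\<close>.
\<close>

section \<open>Finite sums of complex numbers\<close>

text \<open>The matrix of a section on a bisection has at most one non-zero entry in each row and column;
  this is the form in which that fact enters norm estimates.\<close>

lemma norm_sum_single:
  fixes \<phi> :: "'a \<Rightarrow> complex"
  assumes "finite A" "\<And>a b. a \<in> A \<Longrightarrow> b \<in> A \<Longrightarrow> \<phi> a \<noteq> 0 \<Longrightarrow> \<phi> b \<noteq> 0 \<Longrightarrow> a = b"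
  shows "(cmod (\<Sum>a\<in>A. \<phi> a))\<^sup>2 = (\<Sum>a\<in>A. (cmod (\<phi> a))\<^sup>2)"
proof (cases "\<exists>a\<in>A. \<phi> a \<noteq> 0")
  case True
  then obtain a where a: "a \<in> A" "\<phi> a \<noteq> 0" by blast
  then have 0: "\<phi> b = 0" if "b \<in> A - {a}" for b
    using assms(2) that by blast
  have "(\<Sum>b\<in>A. \<phi> b) = \<phi> a" "(\<Sum>a\<in>A. (cmod (\<phi> a))\<^sup>2) = (cmod (\<phi> a))\<^sup>2"
    using a(1) assms(1) 0 by (simp_all add: sum.remove)
  then show ?thesis by simp
qed auto

lemma L2_set_sq: "(L2_set f A)\<^sup>2 = (\<Sum>a\<in>A. (f a)\<^sup>2)"
  by (simp add: L2_set_def sum_nonneg)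

section \<open>Etale groupoids and open bisections\<close>

locale etale =
  fixes G :: "('g::topological_space, 'z) groupoid_scheme"
  assumes etale: "etale_groupoid G"
begin

abbreviation "r \<equiv> rng G"
abbreviation "s \<equiv> src G"
abbreviation "gi \<equiv> ginv G"
abbreviation "X \<equiv> units G"
abbreviation gm (infixl "\<cdot>" 70) where "g \<cdot> h \<equiv> gmult G g h"

lemma is_groupoid: "is_groupoid G"
  using etale by (simp add: etale_groupoid_def topological_groupoid_def)

lemmas groupoid_axioms = is_groupoid[unfolded is_groupoid_def]

lemma r_unit [simp]: "x \<in> X \<Longrightarrow> r x = x" and s_unit [simp]: "x \<in> X \<Longrightarrow> s x = x"
  and s_in [simp]: "s g \<in> X"
  using groupoid_axioms by simp_all

lemma r_mult [simp]: "s g = r h \<Longrightarrow> r (g \<cdot> h) = r g"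
  and s_mult [simp]: "s g = r h \<Longrightarrow> s (g \<cdot> h) = s h"
  using conjunct1[OF conjunct2[OF conjunct2[OF groupoid_axioms]]] by simp_all

lemma assoc: "s g = r h \<Longrightarrow> s h = r k \<Longrightarrow> (g \<cdot> h) \<cdot> k = g \<cdot> (h \<cdot> k)"
  using conjunct1[OF conjunct2[OF conjunct2[OF conjunct2[OF groupoid_axioms]]]] by iprover

lemma unit_l [simp]: "r g \<cdot> g = g" and unit_r [simp]: "g \<cdot> s g = g"
  and r_inv [simp]: "r (gi g) = s g" and s_inv [simp]: "s (gi g) = r g"
  and inv_r [simp]: "g \<cdot> gi g = r g" and inv_l [simp]: "gi g \<cdot> g = s g"
  using conjunct2[OF conjunct2[OF conjunct2[OF conjunct2[OF groupoid_axioms]]]] by simp_all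

lemma r_in [simp]: "r g \<in> X"
  unfolding units_def by (rule rangeI)

lemma r_r [simp]: "r (r g) = r g" and s_r [simp]: "s (r g) = r g"
  and r_s [simp]: "r (s g) = s g" and s_s [simp]: "s (s g) = s g"
  by simp_all

lemma cancel_l [simp]: "r h = r g \<Longrightarrow> g \<cdot> (gi g \<cdot> h) = h"
  by (metis assoc inv_r r_inv s_inv unit_l)

lemma cancel_l' [simp]: "s g = r h \<Longrightarrow> gi g \<cdot> (g \<cdot> h) = h"
  by (metis assoc inv_l s_inv unit_l)

lemma cancel_r [simp]: "s h = s g \<Longrightarrow> (h \<cdot> gi g) \<cdot> g = h"
  by (metis assoc inv_l r_inv s_inv unit_r)

lemma cancel_r' [simp]: "s h = r g \<Longrightarrow> (h \<cdot> g) \<cdot> gi g = h"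
  by (metis assoc inv_r r_inv unit_r)

lemma inv_inv [simp]: "gi (gi g) = g"
  by (metis cancel_l inv_l inv_r r_inv s_inv unit_r)

lemma inv_unit [simp]: "x \<in> X \<Longrightarrow> gi x = x"
  by (metis inv_r r_inv r_unit s_unit unit_l)

lemma inv_mult: "s g = r h \<Longrightarrow> gi (g \<cdot> h) = gi h \<cdot> gi g"
  by (metis cancel_r' cancel_l' assoc r_inv r_mult s_inv s_mult inv_l)

lemma mult_eq_iff:
  assumes "s h = r l"
  shows "h \<cdot> l = g \<longleftrightarrow> r h = r g \<and> l = gi h \<cdot> g"
  using assms cancel_l cancel_l' r_mult by metis

lemma unit_mult [simp]: "x \<in> X \<Longrightarrow> r g = x \<Longrightarrow> x \<cdot> g = g"
  and mult_unit [simp]: "x \<in> X \<Longrightarrow> s g = x \<Longrightarrow> g \<cdot> x = g"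
  by auto

lemma cont_inv: "continuous_on UNIV gi"
  and cont_mult: "continuous_on {(g, h). s g = r h} (\<lambda>(g, h). g \<cdot> h)"
  and loc_homeo: "local_homeomorphism r X"
  and Hausdorff_X: "Hausdorff_space (top_of_set X)"
  and loc_compact_X: "locally_compact_space (top_of_set X)"
  using etale by (auto simp add: etale_groupoid_def topological_groupoid_def)

lemma cont_r: "continuous_on UNIV r"
proof -
  define S where "S = {U. open U \<and> continuous_on U r}"
  have "\<Union>S = UNIV"
    using loc_homeo unfolding S_def local_homeomorphism_def homeomorphism_def by fast
  moreover have "continuous_on (\<Union>S) r"
    by (rule continuous_on_open_Union) (auto simp: S_def)
  ultimately show ?thesis by simp
qed

lemma cont_s: "continuous_on UNIV s"
proof -
  have "s = r \<circ> gi" by auto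
  then show ?thesis
    using continuous_on_compose[OF cont_inv, of r] cont_r by (metis continuous_on_subset subset_UNIV)
qed

text \<open>Near a unit \<open>x\<close> the range map is injective on an open set \<open>U\<close>. An arrow \<open>g\<close> of \<open>U\<close> with
  \<open>r g\<close> in \<open>U\<close> has the same range as \<open>r g\<close>, so it equals the unit \<open>r g\<close>. Because of this lemma,
  topological statements about the unit space can be read in the space of arrows.\<close>

lemma open_units: "open X"
proof (subst open_subopen, intro ballI)
  fix x assume x: "x \<in> X"
  obtain U k where U: "open U" "x \<in> U" "homeomorphism U (r ` U) r k"
    using loc_homeo unfolding local_homeomorphism_def by blast
  let ?V = "U \<inter> r -` U"
  have "open (r -` U)"
    using cont_r U(1) by (simp add: continuous_on_open_vimage)
  moreover have "?V \<subseteq> X"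
  proof
    fix g assume g: "g \<in> ?V"
    have "inj_on r U"
      using U(3) by (metis homeomorphism_def inj_on_inverseI)
    then have "g = r g"
      using g by (metis Int_iff inj_onD r_r vimageE)
    then show "g \<in> X" by (metis r_in)
  qed
  ultimately show "\<exists>T. open T \<and> x \<in> T \<and> T \<subseteq> X"
    using U x by (intro exI[of _ ?V]) auto
qed

lemma open_r_image:
  assumes "open W"
  shows "open (r ` W)"
proof (subst open_subopen, intro ballI)
  fix y assume "y \<in> r ` W"
  then obtain g where g: "g \<in> W" "y = r g" by blast
  obtain U k where U: "open U" "g \<in> U" "openin (top_of_set X) (r ` U)" "homeomorphism U (r ` U) r k"
    using loc_homeo unfolding local_homeomorphism_def by blast
  have o: "open (r ` U)"
    using U(3) open_units by (metis openin_open_eq)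
  have "openin (top_of_set (r ` U)) (r ` (U \<inter> W))"
    using U(4) by (rule homeomorphism_imp_open_map) (use assms in auto)
  then have "open (r ` (U \<inter> W))"
    using o by (metis openin_open_eq)
  then show "\<exists>T. open T \<and> y \<in> T \<and> T \<subseteq> r ` W"
    using g U by (intro exI[of _ "r ` (U \<inter> W)"]) auto
qed

lemma open_inv_image: "open W \<Longrightarrow> open (gi ` W)"
proof -
  assume W: "open W"
  have "gi ` W = gi -` W" by (auto simp: image_iff) (metis inv_inv)
  then show ?thesis
    using cont_inv W by (simp add: continuous_on_open_vimage)
qed

lemma open_s_image: "open W \<Longrightarrow> open (s ` W)"
proof -
  assume "open W"
  then have "open (r ` gi ` W)" by (intro open_r_image open_inv_image)
  then show ?thesis by (simp add: image_image)
qed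

lemma open_vimage_r: "open W \<Longrightarrow> open (r -` W)" and open_vimage_s: "open W \<Longrightarrow> open (s -` W)"
  using cont_r cont_s by (simp_all add: continuous_on_open_vimage)

lemma bisectionD:
  assumes "open_bisection G U"
  shows "open U" "inj_on r U" "inj_on s U"
  using assms by (auto simp: open_bisection_def)

lemma r_bisection_eq: "open_bisection G U \<Longrightarrow> g \<in> U \<Longrightarrow> h \<in> U \<Longrightarrow> r g = r h \<Longrightarrow> g = h"
  and s_bisection_eq: "open_bisection G U \<Longrightarrow> g \<in> U \<Longrightarrow> h \<in> U \<Longrightarrow> s g = s h \<Longrightarrow> g = h"
  by (auto simp: open_bisection_def inj_on_def)

lemma bisection_units: "open_bisection G X"
  by (auto simp: open_bisection_def open_units inj_on_def)

lemma bisection_open_subset: "open_bisection G U \<Longrightarrow> open V \<Longrightarrow> V \<subseteq> U \<Longrightarrow> open_bisection G V"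
  by (auto simp: open_bisection_def intro: inj_on_subset)

lemma bisection_inv: "open_bisection G U \<Longrightarrow> open_bisection G (gi ` U)"
  by (auto simp: open_bisection_def open_inv_image inj_on_def)

text \<open>A product \<open>g h\<close> with \<open>g\<close> in the bisection \<open>U\<close> determines \<open>g\<close> through its range, and \<open>lift_r U\<close>
  recovers it. Both factors are then continuous functions of the product, so the product of two
  bisections is open and convolution on bisections preserves continuity.\<close>

definition lift_r :: "'g set \<Rightarrow> 'g \<Rightarrow> 'g" where
  "lift_r U x = the_inv_into U r x"

lemma lift_r:
  assumes "open_bisection G U" "x \<in> r ` U"
  shows "lift_r U x \<in> U" "r (lift_r U x) = x"
  using assms unfolding lift_r_def
  by (auto simp: bisectionD f_the_inv_into_f the_inv_into_f_f)

lemma lift_r_eq: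
  assumes "open_bisection G U" "g \<in> U"
  shows "lift_r U (r g) = g"
  using assms unfolding lift_r_def by (simp add: bisectionD the_inv_into_f_f)

lemma cont_lift_r:
  assumes "open_bisection G U"
  shows "continuous_on (r ` U) (lift_r U)"
proof (rule continuous_on_inverse_open_map)
  show "continuous_on U r" using cont_r continuous_on_subset by blast
  fix W assume "openin (top_of_set U) W"
  then have "open W" using bisectionD(1)[OF assms] by (metis openin_open_eq)
  then show "openin (top_of_set (r ` U)) (r ` W)"
    using \<open>openin (top_of_set U) W\<close> 
    by (metis image_mono open_r_image open_subset openin_imp_subset)
qed (use lift_r_eq[OF assms] in auto)

definition set_mult :: "'g set \<Rightarrow> 'g set \<Rightarrow> 'g set" where
  "set_mult U V = {g \<cdot> h |g h. g \<in> U \<and> h \<in> V \<and> s g = r h}"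

lemma set_mult_eq:
  assumes "open_bisection G U"
  shows "set_mult U V = {k. r k \<in> r ` U \<and> gi (lift_r U (r k)) \<cdot> k \<in> V}"
proof -
  have "gi (lift_r U (r (g \<cdot> h))) \<cdot> (g \<cdot> h) = h" if "g \<in> U" "s g = r h" for g h
    using that assms lift_r_eq by simp
  moreover have "k \<in> set_mult U V" if "r k \<in> r ` U" "gi (lift_r U (r k)) \<cdot> k \<in> V" for k
  proof -
    have l: "lift_r U (r k) \<in> U" "r (lift_r U (r k)) = r k"
      using lift_r[OF assms that(1)] by blast+
    then have "k = lift_r U (r k) \<cdot> (gi (lift_r U (r k)) \<cdot> k)"
      "s (lift_r U (r k)) = r (gi (lift_r U (r k)) \<cdot> k)"
      by simp_all
    then show ?thesis
      using l(1) that(2) unfolding set_mult_def by blast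
  qed
  ultimately show ?thesis by (auto simp: set_mult_def)
qed

lemma cont_mult': 
  assumes "continuous_on S f" "continuous_on S f'" "\<And>a. a \<in> S \<Longrightarrow> s (f a) = r (f' a)"
  shows "continuous_on S (\<lambda>a. f a \<cdot> f' a)"
proof -
  have "continuous_on S ((\<lambda>(g, h). g \<cdot> h) \<circ> (\<lambda>a. (f a, f' a)))"
    by (intro continuous_on_compose continuous_on_Pair assms continuous_on_subset[OF cont_mult])
      (use assms in auto)
  then show ?thesis by (simp add: o_def)
qed

lemma cont_inv': "continuous_on S f \<Longrightarrow> continuous_on S (\<lambda>a. gi (f a))"
  by (rule continuous_on_compose2[OF cont_inv]) auto

lemma cont_factors:
  assumes "open_bisection G U"
  shows "continuous_on (r -` r ` U) (\<lambda>k. lift_r U (r k))"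
    "continuous_on (r -` r ` U) (\<lambda>k. gi (lift_r U (r k)) \<cdot> k)"
proof -
  show 1: "continuous_on (r -` r ` U) (\<lambda>k. lift_r U (r k))"
    by (rule continuous_on_compose2[OF cont_lift_r[OF assms]])
      (auto intro: continuous_on_subset[OF cont_r])
  show "continuous_on (r -` r ` U) (\<lambda>k. gi (lift_r U (r k)) \<cdot> k)"
    by (intro cont_mult' cont_inv' 1 continuous_on_id) (use lift_r[OF assms] in auto)
qed

lemma bisection_mult:
  assumes U: "open_bisection G U" and V: "open_bisection G V"
  shows "open_bisection G (set_mult U V)"
proof -
  have "open (r -` r ` U)"
    using U by (intro open_vimage_r open_r_image bisectionD)
  moreover have "openin (top_of_set (r -` r ` U)) (r -` r ` U \<inter> (\<lambda>k. gi (lift_r U (r k)) \<cdot> k) -` V)"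
    by (intro continuous_openin_preimage_gen cont_factors U bisectionD(1)[OF V])
  ultimately have "open (r -` r ` U \<inter> (\<lambda>k. gi (lift_r U (r k)) \<cdot> k) -` V)"
    using openin_open_trans by blast
  moreover have "set_mult U V = r -` r ` U \<inter> (\<lambda>k. gi (lift_r U (r k)) \<cdot> k) -` V"
    unfolding set_mult_eq[OF U] by auto
  ultimately have "open (set_mult U V)" by simp
  moreover have "inj_on r (set_mult U V)"
    unfolding inj_on_def set_mult_def using r_bisection_eq[OF U] r_bisection_eq[OF V]
    by (auto) (metis)
  moreover have "inj_on s (set_mult U V)"
    unfolding inj_on_def set_mult_def using s_bisection_eq[OF U] s_bisection_eq[OF V]
    by (auto) (metis)
  ultimately show ?thesis by (simp add: open_bisection_def)
qed

lemma open_units_minus_compact: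
  assumes "compact K" "K \<subseteq> X"
  shows "open (X - K)"
proof -
  have "compactin (top_of_set X) K"
    using assms by (simp add: compactin_subtopology)
  then have "closedin (top_of_set X) K"
    using Hausdorff_X compactin_imp_closedin by blast
  then have "openin (top_of_set X) (X - K)"
    by (metis openin_diff openin_topspace topspace_euclidean_subtopology)
  then show ?thesis using open_units openin_open_trans by blast
qed

text \<open>The space of arrows need not be Hausdorff, so a compact set need not be closed. Inside a
  bisection it is relatively closed, because its image in the Hausdorff unit space is closed.\<close>

lemma open_bisection_minus_compact:
  assumes U: "open_bisection G U" and K: "compact K" "K \<subseteq> U"
  shows "open (U - K)"
proof -
  have "compact (r ` K)"
    using K cont_r by (meson compact_continuous_image continuous_on_subset subset_UNIV)
  then have "open (X - r ` K)"
    by (intro open_units_minus_compact) auto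
  moreover have "U - K = U \<inter> r -` (X - r ` K)"
    using K r_bisection_eq[OF U] by (auto simp: subset_iff) metis
  ultimately show ?thesis
    using open_vimage_r bisectionD(1)[OF U] by (metis open_Int)
qed

text \<open>Composability is an equation between points of the unit space, which is Hausdorff; this is
  what makes the product of two compact sets of arrows compact.\<close>

lemma closed_composable: "closed {(g, h). s g = r h}"
proof -
  have "\<exists>T. open T \<and> p \<in> T \<and> T \<subseteq> - {(g, h). s g = r h}" if "p \<in> - {(g, h). s g = r h}" for p
  proof -
    obtain g h where p: "p = (g, h)" "s g \<noteq> r h" using \<open>p \<in> _\<close> by (cases p) auto
    then obtain A B where "openin (top_of_set X) A" "openin (top_of_set X) B" "s g \<in> A" "r h \<in> B" "A \<inter> B = {}"
      using Hausdorff_X unfolding Hausdorff_space_def disjnt_def by (metis r_in s_in topspace_euclidean_subtopology)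
    then have "open (s -` A \<times> r -` B)" "p \<in> s -` A \<times> r -` B" "s -` A \<times> r -` B \<subseteq> - {(g, h). s g = r h}"
      using open_units openin_open_trans p
      by (fastforce intro!: open_Times open_vimage_r open_vimage_s)+
    then show ?thesis by blast
  qed
  then have "open (- {(g, h). s g = r h})"
    by (subst open_subopen) blast
  then show ?thesis by (simp add: closed_def)
qed

lemma compact_set_mult:
  assumes "compact K" "compact K'"
  shows "compact (set_mult K K')"
proof -
  have "set_mult K K' = (\<lambda>(g, h). g \<cdot> h) ` (K \<times> K' \<inter> {(g, h). s g = r h})"
    by (auto simp: set_mult_def image_iff)
  moreover have "compact (K \<times> K' \<inter> {(g, h). s g = r h})"
    by (intro compact_Int_closed compact_Times assms closed_composable)
  ultimately show ?thesis
    using compact_continuous_image continuous_on_subset[OF cont_mult] by (metis inf_le2)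
qed

text \<open>A locally compact Hausdorff space is completely regular and has compact neighbourhoods; the
  function is one minus a function that separates \<open>x\<close> from the complement of the interior of such a
  neighbourhood.\<close>

lemma units_bump:
  assumes "open V" "x \<in> V" "V \<subseteq> X"
  obtains v :: "'g \<Rightarrow> real" and K where "continuous_on X v" "compact K" "K \<subseteq> V" "v x = 1"
    "\<And>y. y \<in> X - K \<Longrightarrow> v y = 0" "\<And>y. y \<in> X \<Longrightarrow> 0 \<le> v y \<and> v y \<le> 1"
proof -
  let ?T = "top_of_set X"
  have oV: "openin ?T V" using assms by (simp add: open_openin_trans open_subset)
  have "neighbourhood_base_of (compactin ?T) ?T"
    using locally_compact_space_neighbourhood_base[of ?T] Hausdorff_X loc_compact_X by blast
  then obtain W K where WK: "openin ?T W" "compactin ?T K" "x \<in> W" "W \<subseteq> K" "K \<subseteq> V"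
    using oV assms(2) unfolding neighbourhood_base_of by metis
  have "completely_regular_space ?T"
    using locally_compact_regular_imp_completely_regular_space[of ?T] Hausdorff_X loc_compact_X
      locally_compact_Hausdorff_or_regular by blast
  then obtain f where f: "continuous_map ?T (top_of_set {0..1::real}) f" "f x = 0" "f ` (X - W) \<subseteq> {1}"
  proof -
    have "closedin ?T (X - W)"
      using WK(1) by (metis closedin_diff closedin_topspace openin_closedin_eq topspace_euclidean_subtopology)
    moreover have "x \<in> topspace ?T - (X - W)" using WK assms by auto
    ultimately show ?thesis
      using \<open>completely_regular_space ?T\<close> that unfolding completely_regular_space_def by blast
  qed
  have "continuous_on X f" "\<And>y. y \<in> X \<Longrightarrow> 0 \<le> f y \<and> f y \<le> 1"
    using f(1) by (auto simp: continuous_map_in_subtopology Pi_iff image_subset_iff)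
  then show ?thesis
    by (intro that[of "\<lambda>y. 1 - f y" K])
      (use f WK in \<open>auto intro!: continuous_intros simp: compactin_subtopology image_subset_iff\<close>)
qed

end

section \<open>Fibres of a Fell line bundle\<close>

locale fell = etale L
  for L :: "('g::topological_space, 'l::topological_space) fell_bundle" +
  assumes fell: "fell_line_bundle L"
begin

abbreviation gmul (infixl "\<cdot>" 70) where "g \<cdot> h \<equiv> gmult L g h"
abbreviation "p \<equiv> proj L"
abbreviation "add \<equiv> fadd L"
abbreviation "sc \<equiv> fscale L"
abbreviation "nm \<equiv> fnorm L"
abbreviation "Z \<equiv> fzero L"
abbreviation "adj \<equiv> fadj L"
abbreviation "un \<equiv> funit L"
abbreviation mul (infixl "\<star>" 70) where "\<xi> \<star> \<eta> \<equiv> fmult L \<xi> \<eta>"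

lemma line: "line_fibre L g"
  using fell by (simp add: fell_line_bundle_def)

lemma fibre_iff [simp]: "\<xi> \<in> fibre L g \<longleftrightarrow> p \<xi> = g"
  by (simp add: fibre_def)

lemma comm_group_fibre: "comm_group (fibre_group L g)"
  using line[of g] by (simp add: line_fibre_def)

lemma fibre_group_simps [simp]: "carrier (fibre_group L g) = fibre L g"
   "mult (fibre_group L g) = add" "one (fibre_group L g) = Z g"
  by (simp_all add: fibre_group_def)

lemma p_add [simp]: "p \<xi> = p \<eta> \<Longrightarrow> p (add \<xi> \<eta>) = p \<eta>"
proof -
  assume *: "p \<xi> = p \<eta>"
  interpret comm_group "fibre_group L (p \<eta>)" by (rule comm_group_fibre)
  show ?thesis using m_closed[of \<xi> \<eta>] * by simp
qed

lemma p_zero [simp]: "p (Z g) = g"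
proof -
  interpret comm_group "fibre_group L g" by (rule comm_group_fibre)
  show ?thesis using one_closed by simp
qed

lemma add_zero [simp]: "p \<xi> = g \<Longrightarrow> add \<xi> (Z g) = \<xi>"
proof -
  assume *: "p \<xi> = g"
  interpret comm_group "fibre_group L g" by (rule comm_group_fibre)
  show ?thesis using r_one[of \<xi>] * by simp
qed

lemma p_sc [simp]: "p (sc c \<xi>) = p \<xi>"
  using line[of "p \<xi>"] unfolding line_fibre_def by (metis fibre_iff)

lemma sc_plus: "sc (c + d) \<xi> = add (sc c \<xi>) (sc d \<xi>)"
  using line[of "p \<xi>"] unfolding line_fibre_def by (metis fibre_iff)

lemma sc_sc [simp]: "sc c (sc d \<xi>) = sc (c * d) \<xi>"
  using line[of "p \<xi>"] unfolding line_fibre_def by (metis fibre_iff)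

lemma sc_1 [simp]: "sc 1 \<xi> = \<xi>"
  using line[of "p \<xi>"] unfolding line_fibre_def by (metis fibre_iff)

lemma nm_nonneg [simp]: "0 \<le> nm \<xi>"
  using line[of "p \<xi>"] unfolding line_fibre_def by (metis fibre_iff)

lemma nm_eq_0_iff: "nm \<xi> = 0 \<longleftrightarrow> \<xi> = Z (p \<xi>)"
  using line[of "p \<xi>"] unfolding line_fibre_def by (metis fibre_iff)

lemma nm_sc [simp]: "nm (sc c \<xi>) = cmod c * nm \<xi>"
  using line[of "p \<xi>"] unfolding line_fibre_def by (metis fibre_iff)

lemma fibre_generator: "\<exists>e. p e = g \<and> e \<noteq> Z g \<and> (\<forall>\<xi>. p \<xi> = g \<longrightarrow> (\<exists>c. \<xi> = sc c e))"
  using line[of g] unfolding line_fibre_def by (metis fibre_iff)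

lemma nm_Z [simp]: "nm (Z g) = 0"
  by (simp add: nm_eq_0_iff)

lemma sc_0 [simp]: "sc 0 \<xi> = Z (p \<xi>)"
  using nm_eq_0_iff[of "sc 0 \<xi>"] by simp

lemma sc_Z [simp]: "sc c (Z g) = Z g"
  by (metis mult_zero_right nm_Z nm_eq_0_iff nm_sc p_sc p_zero)

lemma sc_eq_Z_iff: "sc c \<xi> = Z (p \<xi>) \<longleftrightarrow> c = 0 \<or> \<xi> = Z (p \<xi>)"
  by (metis mult_eq_0_iff nm_eq_0_iff nm_sc norm_eq_zero p_sc)

lemma fmult_axioms: "fell_multiplication L" and fadj_axioms: "fell_adjoint L"
  using fell by (auto simp: fell_line_bundle_def)

lemma p_mul [simp]: "s (p \<xi>) = r (p \<eta>) \<Longrightarrow> p (\<xi> \<star> \<eta>) = p \<xi> \<cdot> p \<eta>"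
  and mul_add_l: "s (p \<xi>) = r (p \<eta>) \<Longrightarrow> p \<xi>' = p \<xi> \<Longrightarrow> add \<xi> \<xi>' \<star> \<eta> = add (\<xi> \<star> \<eta>) (\<xi>' \<star> \<eta>)"
  and mul_add_r: "s (p \<xi>) = r (p \<eta>) \<Longrightarrow> p \<eta>' = p \<eta> \<Longrightarrow> \<xi> \<star> add \<eta> \<eta>' = add (\<xi> \<star> \<eta>) (\<xi> \<star> \<eta>')"
  and mul_sc_l [simp]: "s (p \<xi>) = r (p \<eta>) \<Longrightarrow> sc c \<xi> \<star> \<eta> = sc c (\<xi> \<star> \<eta>)"
  and mul_sc_r [simp]: "s (p \<xi>) = r (p \<eta>) \<Longrightarrow> \<xi> \<star> sc c \<eta> = sc c (\<xi> \<star> \<eta>)"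
  and mul_assoc: "s (p \<xi>) = r (p \<eta>) \<Longrightarrow> s (p \<eta>) = r (p \<zeta>) \<Longrightarrow> \<xi> \<star> \<eta> \<star> \<zeta> = \<xi> \<star> (\<eta> \<star> \<zeta>)"
  using fmult_axioms unfolding fell_multiplication_def composable_def by blast+

lemma p_adj [simp]: "p (adj \<xi>) = gi (p \<xi>)"
  and adj_add: "p \<xi> = p \<eta> \<Longrightarrow> adj (add \<xi> \<eta>) = add (adj \<xi>) (adj \<eta>)"
  and adj_sc [simp]: "adj (sc c \<xi>) = sc (cnj c) (adj \<xi>)"
  and adj_adj [simp]: "adj (adj \<xi>) = \<xi>"
  and adj_mul: "s (p \<xi>) = r (p \<eta>) \<Longrightarrow> adj (\<xi> \<star> \<eta>) = adj \<eta> \<star> adj \<xi>"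
  and nm_adj_mul: "nm (adj \<xi> \<star> \<xi>) = (nm \<xi>)\<^sup>2"
  and adj_mul_pos: "fscalar L (adj \<xi> \<star> \<xi>) \<in> \<real>\<^sub>\<ge>\<^sub>0"
  using fadj_axioms unfolding fell_adjoint_def composable_def by blast+

lemma mul_Z [simp]: "s (p \<xi>) = r g \<Longrightarrow> \<xi> \<star> Z g = Z (p \<xi> \<cdot> g)"
  using mul_sc_r[of \<xi> "Z g" 0] by simp

lemma Z_mul [simp]: "s g = r (p \<xi>) \<Longrightarrow> Z g \<star> \<xi> = Z (g \<cdot> p \<xi>)"
  using mul_sc_l[of "Z g" \<xi> 0] by simp

lemma adj_Z [simp]: "adj (Z g) = Z (gi g)"
  using adj_sc[of 0 "Z g"] by simp

text \<open>A generator \<open>e\<close> of the one-dimensional algebra over a unit satisfies \<open>e e = l e\<close>. If \<open>l\<close> were zero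
  then \<open>e* e\<close>, a multiple of \<open>e e\<close>, would vanish, contrary to \<open>\<parallel>e* e\<parallel> = \<parallel>e\<parallel>\<^sup>2\<close>. So \<open>e / l\<close> is an identity.\<close>

lemma unit_vector_exists:
  assumes x: "x \<in> X"
  shows "\<exists>u. p u = x \<and> u \<noteq> Z x \<and> (\<forall>\<xi>. p \<xi> = x \<longrightarrow> u \<star> \<xi> = \<xi> \<and> \<xi> \<star> u = \<xi>)"
proof -
  obtain e where e: "p e = x" "e \<noteq> Z x" "\<And>\<xi>. p \<xi> = x \<Longrightarrow> \<exists>c. \<xi> = sc c e"
    using fibre_generator by blast
  obtain d where d: "adj e = sc d e" using e(3)[of "adj e"] e(1) x by auto
  obtain l where l: "e \<star> e = sc l e" using e(3)[of "e \<star> e"] e(1) x by auto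
  have "nm (adj e \<star> e) \<noteq> 0" using e nm_eq_0_iff[of e] by (simp add: nm_adj_mul)
  then have "l \<noteq> 0" using e(1) x l by (auto simp: d)
  moreover have "sc (1/l) e \<star> \<xi> = \<xi> \<and> \<xi> \<star> sc (1/l) e = \<xi>" if \<xi>: "p \<xi> = x" for \<xi>
  proof -
    obtain c where "\<xi> = sc c e" using e(3)[OF \<xi>] by blast
    then show ?thesis using e(1) x l \<open>l \<noteq> 0\<close> by simp
  qed
  ultimately show ?thesis
    using e sc_eq_Z_iff[of "1/l" e] by (intro exI[of _ "sc (1/l) e"]) simp
qed

lemma one_props:
  assumes "x \<in> X"
  shows "p (un x) = x" "un x \<noteq> Z x" "p \<xi> = x \<Longrightarrow> un x \<star> \<xi> = \<xi>" "p \<xi> = x \<Longrightarrow> \<xi> \<star> un x = \<xi>"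
proof -
  obtain u where u: "p u = x" "u \<noteq> Z x" "\<And>\<xi>. p \<xi> = x \<Longrightarrow> u \<star> \<xi> = \<xi> \<and> \<xi> \<star> u = \<xi>"
    using unit_vector_exists[OF assms] by blast
  have "un x = u"
    unfolding funit_def
  proof (rule the_equality)
    fix v assume v: "v \<in> fibre L x \<and> (\<forall>\<xi>\<in>fibre L x. v \<star> \<xi> = \<xi> \<and> \<xi> \<star> v = \<xi>)"
    then have "v \<star> u = u" using u(1) by simp
    moreover have "v \<star> u = v" using u(3)[of v] v by simp
    ultimately show "v = u" by metis
  qed (use u in simp)
  then show "p (un x) = x" "un x \<noteq> Z x" "p \<xi> = x \<Longrightarrow> un x \<star> \<xi> = \<xi>" "p \<xi> = x \<Longrightarrow> \<xi> \<star> un x = \<xi>"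
    using u by auto
qed

lemma p_one [simp]: "x \<in> X \<Longrightarrow> p (un x) = x"
  using one_props by blast

lemma one_unique:
  assumes "x \<in> X" "p u = x" "\<And>\<xi>. p \<xi> = x \<Longrightarrow> u \<star> \<xi> = \<xi>"
  shows "u = un x"
  using assms one_props by metis

lemma adj_one [simp]: "x \<in> X \<Longrightarrow> adj (un x) = un x"
proof (rule one_unique)
  fix \<xi> assume "x \<in> X" "p \<xi> = x"
  then have "adj (adj \<xi> \<star> un x) = adj (adj \<xi>)" using one_props by simp
  then show "adj (un x) \<star> \<xi> = \<xi>"
    using \<open>x \<in> X\<close> \<open>p \<xi> = x\<close> by (simp add: adj_mul)
qed simp_all

lemma nm_one [simp]:
  assumes "x \<in> X"
  shows "nm (un x) = 1"
proof -
  have "nm (un x) = (nm (un x))\<^sup>2"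
    using nm_adj_mul[of "un x"] one_props(3)[of x "un x"] assms by simp
  moreover have "nm (un x) \<noteq> 0" using one_props[OF assms] nm_eq_0_iff by simp
  ultimately show ?thesis by (simp add: power2_eq_square)
qed

text \<open>A unit vector in each fibre. On the fibre over a unit it is the identity of that algebra, so
  that coefficients there agree with \<open>fscalar\<close>. The other vectors are chosen arbitrarily and serve
  algebraic purposes only.\<close>

definition e :: "'g \<Rightarrow> 'l" where
  "e g = (if g \<in> X then un g else SOME \<xi>. p \<xi> = g \<and> nm \<xi> = 1)"

lemma e_unit [simp]: "x \<in> X \<Longrightarrow> e x = un x"
  by (simp add: e_def)

lemma unit_vector: "\<exists>\<xi>. p \<xi> = g \<and> nm \<xi> = 1"
proof -
  obtain e where e: "p e = g" "e \<noteq> Z g"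
    using fibre_generator by blast
  then have "nm e \<noteq> 0" using nm_eq_0_iff by auto
  then show ?thesis
    using e by (intro exI[of _ "sc (1 / of_real (nm e)) e"]) (simp add: norm_divide)
qed

lemma p_e [simp]: "p (e g) = g" and nm_e [simp]: "nm (e g) = 1"
  using someI_ex[OF unit_vector[of g]] unfolding e_def by auto

definition coef :: "'l \<Rightarrow> complex" where
  "coef \<xi> = (THE c. \<xi> = sc c (e (p \<xi>)))"

lemma sc_inj: 
  assumes "sc c \<xi> = sc d \<xi>" "\<xi> \<noteq> Z (p \<xi>)"
  shows "c = d"
proof -
  have "sc (c - d) \<xi> = add (sc c \<xi>) (sc (- d) \<xi>)"
    by (metis diff_conv_add_uminus sc_plus)
  also have "\<dots> = sc 0 \<xi>"
    by (metis add.right_inverse assms(1) sc_plus)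
  finally have "c - d = 0" using sc_eq_Z_iff assms(2) by (metis sc_0)
  then show ?thesis by simp
qed

lemma e_nonzero: "e g \<noteq> Z g"
  by (metis nm_Z nm_e zero_neq_one)

lemma coef_sc_e [simp]: "coef (sc c (e g)) = c"
  unfolding coef_def using sc_inj[of _ "e g"] e_nonzero by (intro the_equality) auto

lemma sc_coef [simp]: "sc (coef \<xi>) (e (p \<xi>)) = \<xi>"
proof -
  obtain e0 where e0: "p e0 = p \<xi>" "e0 \<noteq> Z (p \<xi>)" "\<And>\<eta>. p \<eta> = p \<xi> \<Longrightarrow> \<exists>c. \<eta> = sc c e0"
    using fibre_generator by blast
  obtain c d where c: "e (p \<xi>) = sc c e0" "\<xi> = sc d e0"
    using e0(3) by (metis p_e)
  then have "c \<noteq> 0" using e_nonzero by (metis sc_0 e0(1))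
  then have "\<xi> = sc (d / c) (e (p \<xi>))"
    unfolding c(1) using c(2) by simp
  then show ?thesis by (metis coef_sc_e)
qed

lemma coef_sc [simp]: "coef (sc c \<xi>) = c * coef \<xi>"
  by (metis coef_sc_e sc_coef sc_sc)

lemma coef_e [simp]: "coef (e g) = 1"
  by (metis coef_sc_e sc_1)

lemma coef_one [simp]: "x \<in> X \<Longrightarrow> coef (un x) = 1"
  by (metis coef_e e_unit)

lemma coef_add [simp]: "p \<xi> = p \<eta> \<Longrightarrow> coef (add \<xi> \<eta>) = coef \<xi> + coef \<eta>"
  by (metis coef_sc_e sc_coef sc_plus)

lemma cmod_coef [simp]: "cmod (coef \<xi>) = nm \<xi>"
  by (metis mult.right_neutral nm_e nm_sc sc_coef)

lemma coef_Z [simp]: "coef (Z g) = 0"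
  by (metis cmod_coef nm_Z norm_eq_zero)

lemma coef_eq_0_iff: "coef \<xi> = 0 \<longleftrightarrow> \<xi> = Z (p \<xi>)"
  by (metis cmod_coef nm_eq_0_iff norm_eq_zero)

lemma eq_iff_coef: "p \<xi> = p \<eta> \<Longrightarrow> \<xi> = \<eta> \<longleftrightarrow> coef \<xi> = coef \<eta>"
  by (metis sc_coef)

lemma fscalar_coef: "p \<xi> \<in> X \<Longrightarrow> fscalar L \<xi> = coef \<xi>"
  by (simp add: fscalar_def coef_def)

lemma fdiff_props [simp]: "p \<xi> = p \<eta> \<Longrightarrow> p (fdiff L \<xi> \<eta>) = p \<eta>"
  "p \<xi> = p \<eta> \<Longrightarrow> coef (fdiff L \<xi> \<eta>) = coef \<xi> - coef \<eta>"
  by (simp_all add: fdiff_def)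

lemma nm_fdiff: "p \<xi> = p \<eta> \<Longrightarrow> nm (fdiff L \<xi> \<eta>) = cmod (coef \<xi> - coef \<eta>)"
  by (metis cmod_coef fdiff_props(2))

text \<open>The product is a non-negative multiple of the identity, by the positivity axiom, and its norm is
  known.\<close>

lemma adj_mul_self: "adj \<xi> \<star> \<xi> = sc (of_real ((nm \<xi>)\<^sup>2)) (un (s (p \<xi>)))"
proof -
  have p: "p (adj \<xi> \<star> \<xi>) = s (p \<xi>)" by simp
  have "coef (adj \<xi> \<star> \<xi>) \<in> \<real>\<^sub>\<ge>\<^sub>0"
    using adj_mul_pos[of \<xi>] p by (simp add: fscalar_coef)
  moreover have "cmod (coef (adj \<xi> \<star> \<xi>)) = (nm \<xi>)\<^sup>2" by (simp add: nm_adj_mul)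
  ultimately have "coef (adj \<xi> \<star> \<xi>) = of_real ((nm \<xi>)\<^sup>2)"
    by (auto simp: nonneg_Reals_def simp del: cmod_coef)
  then show ?thesis using sc_coef[of "adj \<xi> \<star> \<xi>"] p by simp
qed

text \<open>In a one-dimensional fibre multiplication by the identity of the source fibre is multiplication
  by a number \<open>c\<close>. Multiplying by \<open>\<xi>*\<close> from the left moves the question to the source fibre, where
  \<open>c = 1\<close>.\<close>

lemma mul_one [simp]:
  assumes "x = s (p \<xi>)"
  shows "\<xi> \<star> un x = \<xi>"
proof (cases "\<xi> = Z (p \<xi>)")
  case True
  then show ?thesis using assms Z_mul[of "p \<xi>" "un x"] by simp
next
  case False
  have pe: "p (\<xi> \<star> un x) = p \<xi>" using assms by simp
  have "\<xi> \<star> un x = sc (coef (\<xi> \<star> un x) / coef \<xi>) \<xi>"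
    using False by (subst eq_iff_coef) (auto simp: pe coef_eq_0_iff)
  then obtain c where c: "\<xi> \<star> un x = sc c \<xi>" by blast
  have "sc c (adj \<xi> \<star> \<xi>) = adj \<xi> \<star> (\<xi> \<star> un x)" using c by simp
  also have "\<dots> = adj \<xi> \<star> \<xi> \<star> un x" using assms by (simp add: mul_assoc)
  also have "\<dots> = sc 1 (adj \<xi> \<star> \<xi>)" using assms by (simp add: one_props(4))
  finally have "c = 1"
    by (rule sc_inj) (use False nm_adj_mul[of \<xi>] in \<open>auto simp flip: nm_eq_0_iff\<close>)
  then show ?thesis using c by simp
qed

lemma one_mul [simp]: 
  assumes "x = r (p \<xi>)"
  shows "un x \<star> \<xi> = \<xi>"
proof -
  have "adj (adj \<xi> \<star> un x) = adj (adj \<xi>)" using assms by simp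
  then show ?thesis using assms adj_mul[of "adj \<xi>" "un x"] by simp
qed

text \<open>Submultiplicativity is an equality on line bundles, because \<open>\<xi>* \<xi>\<close> is the scalar \<open>\<parallel>\<xi>\<parallel>\<^sup>2\<close> and
  \<open>\<parallel>\<xi> \<eta>\<parallel>\<^sup>2 = \<parallel>\<eta>* (\<xi>* \<xi>) \<eta>\<parallel>\<close>.\<close>

lemma nm_mul [simp]:
  assumes "s (p \<xi>) = r (p \<eta>)"
  shows "nm (\<xi> \<star> \<eta>) = nm \<xi> * nm \<eta>"
proof -
  have "adj (\<xi> \<star> \<eta>) \<star> (\<xi> \<star> \<eta>) = adj \<eta> \<star> (adj \<xi> \<star> \<xi> \<star> \<eta>)"
    using assms by (simp add: adj_mul mul_assoc)
  also have "\<dots> = sc (of_real ((nm \<xi>)\<^sup>2)) (adj \<eta> \<star> \<eta>)"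
    using assms by (simp add: adj_mul_self[of \<xi>])
  finally have "(nm (\<xi> \<star> \<eta>))\<^sup>2 = (nm \<xi> * nm \<eta>)\<^sup>2"
    by (metis nm_adj_mul nm_sc norm_of_real abs_power2 power2_abs power_mult_distrib abs_of_nonneg nm_nonneg)
  then show ?thesis by (simp add: power2_eq_iff_nonneg)
qed

lemma coef_mul_unit: "p \<xi> = x \<Longrightarrow> p \<eta> = x \<Longrightarrow> x \<in> X \<Longrightarrow> coef (\<xi> \<star> \<eta>) = coef \<xi> * coef \<eta>"
proof -
  assume *: "p \<xi> = x" "p \<eta> = x" "x \<in> X"
  have "sc (coef \<xi>) (un x) \<star> sc (coef \<eta>) (un x) = sc (coef \<xi> * coef \<eta>) (un x)"
    using * by (simp add: mult.commute)
  then show ?thesis using * by (metis coef_sc_e e_unit sc_coef)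
qed

lemma coef_adj_unit: "p \<xi> \<in> X \<Longrightarrow> coef (adj \<xi>) = cnj (coef \<xi>)"
proof -
  assume *: "p \<xi> \<in> X"
  have "adj (sc (coef \<xi>) (un (p \<xi>))) = sc (cnj (coef \<xi>)) (un (p \<xi>))"
    using * by simp
  then show ?thesis using * by (metis coef_sc_e e_unit sc_coef)
qed

lemma mul_unit_r: "s (p \<xi>) = p \<eta> \<Longrightarrow> p \<eta> \<in> X \<Longrightarrow> \<xi> \<star> \<eta> = sc (coef \<eta>) \<xi>"
  by (metis e_unit mul_one mul_sc_r p_one r_unit sc_coef)

lemma mul_unit_l: "r (p \<xi>) = p \<eta> \<Longrightarrow> p \<eta> \<in> X \<Longrightarrow> \<eta> \<star> \<xi> = sc (coef \<eta>) \<xi>"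
  by (metis e_unit one_mul mul_sc_l p_one s_unit sc_coef)


section \<open>Convolution of sections\<close>

definition sec :: "('g \<Rightarrow> 'l) \<Rightarrow> bool" where
  "sec f \<longleftrightarrow> (\<forall>g. p (f g) = g)"

lemma bundle_sections_eq: "bundle_sections L = {f. sec f}"
  by (simp add: bundle_sections_def sec_def)

lemma p_sec [simp]: "sec f \<Longrightarrow> p (f g) = g"
  by (simp add: sec_def)

abbreviation "conv \<equiv> convolution L"

lemma finprod_coef:
  assumes "finite A" "\<And>a. a \<in> A \<Longrightarrow> p (\<phi> a) = g"
  shows "p (finprod (fibre_group L g) \<phi> A) = g \<and> coef (finprod (fibre_group L g) \<phi> A) = (\<Sum>a\<in>A. coef (\<phi> a))"
  using assms
proof (induction A)
  case empty
  interpret comm_group "fibre_group L g" by (rule comm_group_fibre)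
  show ?case using finprod_empty[of \<phi>] by simp
next
  case (insert a A)
  interpret comm_group "fibre_group L g" by (rule comm_group_fibre)
  have "finprod (fibre_group L g) \<phi> (insert a A) = add (\<phi> a) (finprod (fibre_group L g) \<phi> A)"
    using finprod_insert[of A a \<phi>] insert by (auto simp: Pi_iff)
  then show ?case using insert by simp
qed

lemma sec_conv:
  assumes "sec f" "sec f'"
  shows "sec (conv f f')"
  unfolding sec_def
proof
  fix g
  interpret comm_group "fibre_group L g" by (rule comm_group_fibre)
  let ?A = "{(h, k). s h = r k \<and> h \<cdot> k = g \<and> f h \<star> f' k \<noteq> Z g}"
  have "(\<lambda>(h, k). f h \<star> f' k) \<in> ?A \<rightarrow> carrier (fibre_group L g)"
  proof (rule funcsetI)
    fix z assume "z \<in> ?A"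
    then obtain h k where "z = (h, k)" "s h = r k" "h \<cdot> k = g" by blast
    then show "(\<lambda>(h, k). f h \<star> f' k) z \<in> carrier (fibre_group L g)"
      using assms by simp
  qed
  then show "p (conv f f' g) = g"
    unfolding convolution_def using finprod_closed by simp
qed

lemma p_conv [simp]: "sec f \<Longrightarrow> sec f' \<Longrightarrow> p (conv f f' g) = g"
  using sec_conv p_sec by blast

text \<open>A pair of composable arrows with product \<open>g\<close> is determined by its first member, so the defining
  sum over pairs becomes a sum over arrows with the range of \<open>g\<close>. The index set \<open>S\<close> may be any finite
  set containing the support, which lets sums for different sections be compared.\<close>

lemma conv_coef:
  assumes f: "sec f" "sec f'" and S: "finite S" "\<And>h. h \<in> S \<Longrightarrow> r h = r g" 
    "\<And>h. r h = r g \<Longrightarrow> f h \<noteq> Z h \<Longrightarrow> h \<in> S"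
  shows "coef (conv f f' g) = (\<Sum>h\<in>S. coef (f h \<star> f' (gi h \<cdot> g)))"
proof -
  let ?A = "{(h, k). s h = r k \<and> h \<cdot> k = g \<and> f h \<star> f' k \<noteq> Z g}"
  let ?S = "{h \<in> S. f h \<star> f' (gi h \<cdot> g) \<noteq> Z g}"
  have A: "?A = (\<lambda>h. (h, gi h \<cdot> g)) ` ?S"
  proof (rule equalityI; rule subsetI)
    fix z assume "z \<in> ?A"
    then obtain h k where z: "z = (h, k)" "s h = r k" "h \<cdot> k = g" "f h \<star> f' k \<noteq> Z g" by blast
    have k: "k = gi h \<cdot> g" "r h = r g" using z by (simp_all add: mult_eq_iff)
    have "f h \<noteq> Z h" using z f by auto
    then show "z \<in> (\<lambda>h. (h, gi h \<cdot> g)) ` ?S" using z k S(3) by auto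
  next
    fix z assume "z \<in> (\<lambda>h. (h, gi h \<cdot> g)) ` ?S"
    then obtain h where "z = (h, gi h \<cdot> g)" "h \<in> S" "f h \<star> f' (gi h \<cdot> g) \<noteq> Z g" by blast
    then show "z \<in> ?A" using S(2)[of h] by simp
  qed
  have "p ((\<lambda>(h, k). f h \<star> f' k) z) = g" if "z \<in> (\<lambda>h. (h, gi h \<cdot> g)) ` ?S" for z
  proof -
    from that obtain h where "z = (h, gi h \<cdot> g)" "h \<in> S" by blast
    then show ?thesis using S(2)[of h] f by simp
  qed
  then have "coef (conv f f' g) = (\<Sum>z\<in>(\<lambda>h. (h, gi h \<cdot> g)) ` ?S. coef ((\<lambda>(h, k). f h \<star> f' k) z))"
    unfolding convolution_def A using S(1) by (intro finprod_coef[THEN conjunct2]) simp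
  also have "\<dots> = (\<Sum>h\<in>?S. coef (f h \<star> f' (gi h \<cdot> g)))"
    by (subst sum.reindex) (auto simp: inj_on_def)
  also have "\<dots> = (\<Sum>h\<in>S. coef (f h \<star> f' (gi h \<cdot> g)))"
    using S(1) by (intro sum.mono_neutral_left) auto
  finally show ?thesis .
qed

definition supp_in :: "'g set \<Rightarrow> ('g \<Rightarrow> 'l) \<Rightarrow> bool" where
  "supp_in U f \<longleftrightarrow> sec f \<and> (\<forall>g. g \<notin> U \<longrightarrow> f g = Z g)"

lemma conv_bisection:
  assumes U: "open_bisection L U" and f: "supp_in U f" "sec f'"
  shows "conv f f' g = (if r g \<in> r ` U then f (lift_r U (r g)) \<star> f' (gi (lift_r U (r g)) \<cdot> g) else Z g)"
proof (cases "r g \<in> r ` U")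
  case True
  note l = lift_r[OF U True]
  have "coef (conv f f' g) = (\<Sum>h\<in>{lift_r U (r g)}. coef (f h \<star> f' (gi h \<cdot> g)))"
    using f l r_bisection_eq[OF U] unfolding supp_in_def
    by (intro conv_coef) (auto, metis)
  then show ?thesis
    using True f l by (subst eq_iff_coef) (auto simp: supp_in_def)
next
  case False
  have "coef (conv f f' g) = (\<Sum>h\<in>{}. coef (f h \<star> f' (gi h \<cdot> g)))"
    using f False unfolding supp_in_def
    by (intro conv_coef) (auto, metis image_eqI)
  then show ?thesis
    using False f by (subst eq_iff_coef) (auto simp: supp_in_def)
qed

lemma conv_bisection_apply:
  assumes U: "open_bisection L U" and f: "supp_in U f" "sec f'" and h: "h \<in> U" "s h = r k"
  shows "conv f f' (h \<cdot> k) = f h \<star> f' k"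
  using conv_bisection[OF U f, of "h \<cdot> k"] h lift_r_eq[OF U, of h] by simp

text \<open>This holds throughout the convolution algebra and is what makes all sums below finite.\<close>

definition fib_fin :: "('g \<Rightarrow> 'l) \<Rightarrow> bool" where
  "fib_fin f \<longleftrightarrow> sec f \<and> (\<forall>x. finite {h. r h = x \<and> f h \<noteq> Z h}) \<and> (\<forall>x. finite {h. s h = x \<and> f h \<noteq> Z h})"

lemma fib_fin_sec: "fib_fin f \<Longrightarrow> sec f"
  by (simp add: fib_fin_def)

abbreviation "plus_sec f f' \<equiv> (\<lambda>g. add (f g) (f' g))"
abbreviation "sc_sec c f \<equiv> (\<lambda>g. sc c (f g))"
definition "star_sec f = (\<lambda>g. adj (f (gi g)))"

lemma sec_ops [simp]: 
  "sec f \<Longrightarrow> sec f' \<Longrightarrow> sec (plus_sec f f')" "sec f \<Longrightarrow> sec (sc_sec c f)" "sec f \<Longrightarrow> sec (star_sec f)" "sec Z"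
  by (auto simp: sec_def star_sec_def)

lemma star_star [simp]: "star_sec (star_sec f) = f"
  by (simp add: star_sec_def)

lemma fib_fin_plus: assumes "fib_fin f" "fib_fin f'" shows "fib_fin (plus_sec f f')"
proof -
  have A: "{h. r h = x \<and> plus_sec f f' h \<noteq> Z h} \<subseteq> {h. r h = x \<and> f h \<noteq> Z h} \<union> {h. r h = x \<and> f' h \<noteq> Z h}"
    "{h. s h = x \<and> plus_sec f f' h \<noteq> Z h} \<subseteq> {h. s h = x \<and> f h \<noteq> Z h} \<union> {h. s h = x \<and> f' h \<noteq> Z h}" for x
    by auto
  have "finite {h. r h = x \<and> plus_sec f f' h \<noteq> Z h}" "finite {h. s h = x \<and> plus_sec f f' h \<noteq> Z h}" for x
    by (rule finite_subset[OF A(1)] finite_subset[OF A(2)]; use assms in \<open>simp add: fib_fin_def\<close>)+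
  then show ?thesis
    using assms sec_ops(1)[of f f'] by (simp add: fib_fin_def)
qed

lemma fib_fin_sc: assumes "fib_fin f" shows "fib_fin (sc_sec c f)"
proof -
  have A: "{h. r h = x \<and> sc_sec c f h \<noteq> Z h} \<subseteq> {h. r h = x \<and> f h \<noteq> Z h}"
    "{h. s h = x \<and> sc_sec c f h \<noteq> Z h} \<subseteq> {h. s h = x \<and> f h \<noteq> Z h}" for x
    by auto
  have "finite {h. r h = x \<and> sc_sec c f h \<noteq> Z h}" "finite {h. s h = x \<and> sc_sec c f h \<noteq> Z h}" for x
    by (rule finite_subset[OF A(1)] finite_subset[OF A(2)]; use assms in \<open>simp add: fib_fin_def\<close>)+
  then show ?thesis
    using assms sec_ops(2)[of f c] by (simp add: fib_fin_def)
qed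

lemma fib_fin_Z: "fib_fin Z"
  by (simp add: fib_fin_def)

lemma fib_fin_bisection:
  assumes "open_bisection L U" "supp_in U f"
  shows "fib_fin f"
proof -
  have "{h. r h = x \<and> f h \<noteq> Z h} \<subseteq> {h \<in> U. r h = x}" "{h. s h = x \<and> f h \<noteq> Z h} \<subseteq> {h \<in> U. s h = x}" for x
    using assms by (auto simp: supp_in_def)
  moreover have "\<exists>h. {h \<in> U. r h = x} \<subseteq> {h}" "\<exists>h. {h \<in> U. s h = x} \<subseteq> {h}" for x
    using r_bisection_eq[OF assms(1)] s_bisection_eq[OF assms(1)] by blast+
  ultimately have "finite {h. r h = x \<and> f h \<noteq> Z h}" "finite {h. s h = x \<and> f h \<noteq> Z h}" for x
    by (meson finite.emptyI finite_insert finite_subset)+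
  then show ?thesis using assms by (auto simp: fib_fin_def supp_in_def)
qed

lemma fib_fin_row_finite: "fib_fin f \<Longrightarrow> finite {h. r h = r g \<and> f h \<noteq> Z h}"
  by (simp add: fib_fin_def)

lemma conv_comb_l:
  assumes "fib_fin f1" "fib_fin f2" "sec f'"
  shows "conv (\<lambda>g. add (sc a (f1 g)) (sc b (f2 g))) f' = (\<lambda>g. add (sc a (conv f1 f' g)) (sc b (conv f2 f' g)))"
    (is "conv ?f f' = _")
proof
  fix g
  let ?S = "{h. r h = r g \<and> f1 h \<noteq> Z h} \<union> {h. r h = r g \<and> f2 h \<noteq> Z h}"
  note s = fib_fin_sec[OF assms(1)] fib_fin_sec[OF assms(2)] assms(3)
  have fin: "finite ?S" using assms by (simp add: fib_fin_row_finite)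
  have sf: "sec ?f" using s by (simp add: sec_def)
  have "coef (conv ?f f' g) = (\<Sum>h\<in>?S. coef (?f h \<star> f' (gi h \<cdot> g)))"
    by (rule conv_coef[OF sf s(3) fin]) (use s in auto)
  also have "\<dots> = (\<Sum>h\<in>?S. a * coef (f1 h \<star> f' (gi h \<cdot> g)) + b * coef (f2 h \<star> f' (gi h \<cdot> g)))"
    using s by (intro sum.cong refl) (auto simp: mul_add_l)
  also have "\<dots> = a * coef (conv f1 f' g) + b * coef (conv f2 f' g)"
    unfolding sum.distrib sum_distrib_left[symmetric] using s fin
    by (subst (1 2) conv_coef[of _ _ ?S]) auto
  finally show "conv ?f f' g = add (sc a (conv f1 f' g)) (sc b (conv f2 f' g))"
    using s sf by (subst eq_iff_coef) auto
qed

lemma conv_comb_r: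
  assumes "fib_fin f" "sec f1" "sec f2"
  shows "conv f (\<lambda>g. add (sc a (f1 g)) (sc b (f2 g))) = (\<lambda>g. add (sc a (conv f f1 g)) (sc b (conv f f2 g)))"
    (is "conv f ?f = _")
proof
  fix g
  let ?S = "{h. r h = r g \<and> f h \<noteq> Z h}"
  note s = fib_fin_sec[OF assms(1)] assms(2,3)
  have fin: "finite ?S" using assms by (simp add: fib_fin_row_finite)
  have sf: "sec ?f" using s by (simp add: sec_def)
  have "coef (conv f ?f g) = (\<Sum>h\<in>?S. coef (f h \<star> ?f (gi h \<cdot> g)))"
    by (rule conv_coef[OF s(1) sf fin]) auto
  also have "\<dots> = (\<Sum>h\<in>?S. a * coef (f h \<star> f1 (gi h \<cdot> g)) + b * coef (f h \<star> f2 (gi h \<cdot> g)))"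
    using s by (intro sum.cong refl) (auto simp: mul_add_r)
  also have "\<dots> = a * coef (conv f f1 g) + b * coef (conv f f2 g)"
    unfolding sum.distrib sum_distrib_left[symmetric] using s fin
    by (subst (1 2) conv_coef[of _ _ ?S]) auto
  finally show "conv f ?f g = add (sc a (conv f f1 g)) (sc b (conv f f2 g))"
    using s sf by (subst eq_iff_coef) auto
qed

lemma conv_plus_l:
  "fib_fin f1 \<Longrightarrow> fib_fin f2 \<Longrightarrow> sec f' \<Longrightarrow> conv (plus_sec f1 f2) f' = plus_sec (conv f1 f') (conv f2 f')"
  using conv_comb_l[of f1 f2 f' 1 1] by simp

lemma conv_sc_l: "fib_fin f \<Longrightarrow> sec f' \<Longrightarrow> conv (sc_sec c f) f' = sc_sec c (conv f f')"
  using conv_comb_l[of f f f' c 0] by (simp add: fib_fin_sec)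

lemma conv_plus_r:
  "fib_fin f \<Longrightarrow> sec f1 \<Longrightarrow> sec f2 \<Longrightarrow> conv f (plus_sec f1 f2) = plus_sec (conv f f1) (conv f f2)"
  using conv_comb_r[of f f1 f2 1 1] by simp

lemma conv_sc_r: "fib_fin f \<Longrightarrow> sec f' \<Longrightarrow> conv f (sc_sec c f') = sc_sec c (conv f f')"
  using conv_comb_r[of f f' f' c 0] by (simp add: fib_fin_sec)

section \<open>Convolution as matrix multiplication\<close>

text \<open>The entry in row \<open>g\<close> and column \<open>k\<close> of the operator of left convolution by \<open>f\<close> in the basis \<open>e\<close>;
  it is meaningful when \<open>g\<close> and \<open>k\<close> have the same source. See \<open>K_eq\<close>.\<close>

definition K :: "('g \<Rightarrow> 'l) \<Rightarrow> 'g \<Rightarrow> 'g \<Rightarrow> complex" where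
  "K f g k = coef (f (g \<cdot> gi k) \<star> e k)"

lemma K_eq: "sec f \<Longrightarrow> s g = s k \<Longrightarrow> f (g \<cdot> gi k) \<star> e k = sc (K f g k) (e g)"
  using sc_coef[of "f (g \<cdot> gi k) \<star> e k"] by (simp add: K_def)

lemma cmod_K [simp]: "sec f \<Longrightarrow> s g = s k \<Longrightarrow> cmod (K f g k) = nm (f (g \<cdot> gi k))"
  unfolding K_def by simp

lemma K_eq_0_iff: "sec f \<Longrightarrow> s g = s k \<Longrightarrow> K f g k = 0 \<longleftrightarrow> f (g \<cdot> gi k) = Z (g \<cdot> gi k)"
  using cmod_K[of f g k] nm_eq_0_iff[of "f (g \<cdot> gi k)"] by (metis norm_eq_zero p_sec)

lemma K_unit: "sec f \<Longrightarrow> x \<in> X \<Longrightarrow> s g = x \<Longrightarrow> K f g x = coef (f g)"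
  unfolding K_def by simp

lemma K_plus: "sec f \<Longrightarrow> sec f' \<Longrightarrow> s g = s k \<Longrightarrow> K (plus_sec f f') g k = K f g k + K f' g k"
  by (simp add: K_def mul_add_l)

lemma K_sc: "sec f \<Longrightarrow> s g = s k \<Longrightarrow> K (sc_sec c f) g k = c * K f g k"
  by (simp add: K_def)

lemma adj_e_mul_e: "adj (e g) \<star> e g = un (s g)"
  using adj_mul_self[of "e g"] by simp

text \<open>Both sides are read off from \<open>e(g)* f(g k\<^sup>-\<^sup>1) e(k)\<close>, an element of the fibre over a unit, and its
  adjoint.\<close>

lemma K_star:
  assumes "sec f" "s g = s k"
  shows "K (star_sec f) k g = cnj (K f g k)"
proof -
  have "adj (e g) \<star> (f (g \<cdot> gi k) \<star> e k) = sc (K f g k) (un (s g))"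
    using assms by (simp add: K_eq adj_e_mul_e)
  then have "adj (adj (e g) \<star> (f (g \<cdot> gi k) \<star> e k)) = sc (cnj (K f g k)) (un (s g))"
    by simp
  moreover have "adj (adj (e g) \<star> (f (g \<cdot> gi k) \<star> e k)) = adj (e k) \<star> (star_sec f (k \<cdot> gi g) \<star> e g)"
    using assms by (simp add: adj_mul mul_assoc star_sec_def inv_mult)
  moreover have "\<dots> = sc (K (star_sec f) k g) (un (s g))"
    using assms by (simp add: K_eq adj_e_mul_e)
  ultimately have "sc (cnj (K f g k)) (un (s g)) = sc (K (star_sec f) k g) (un (s g))"
    by simp
  then show ?thesis using one_props(2)[of "s g"] by (metis p_one s_in sc_inj)
qed

lemma coef_mul_e: "s (p \<xi>) = r k \<Longrightarrow> coef (\<xi> \<star> e k) = coef \<xi> * coef (e (p \<xi>) \<star> e k)"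
  by (metis coef_sc mul_sc_l p_e sc_coef)

text \<open>Convolution sums over factorizations \<open>g k\<^sup>-\<^sup>1 = h l\<close>. Setting \<open>m = l k\<close> gives \<open>h = g m\<^sup>-\<^sup>1\<close> and
  \<open>l = m k\<^sup>-\<^sup>1\<close>, and \<open>f(h) (f'(l) e(k))\<close> is the product of two matrix entries times \<open>e(g)\<close>. Only
  finiteness of the row of \<open>f\<close> is assumed, so that \<open>f'\<close> may be a square-summable section.\<close>

lemma K_conv:
  assumes f: "sec f" "sec f'" and gk: "s g = s k"
    and S: "finite S" "\<And>m. m \<in> S \<Longrightarrow> s m = s g" "\<And>m. s m = s g \<Longrightarrow> K f g m \<noteq> 0 \<Longrightarrow> m \<in> S"
  shows "K (conv f f') g k = (\<Sum>m\<in>S. K f g m * K f' m k)"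
proof -
  let ?g = "g \<cdot> gi k" let ?S = "(\<lambda>m. g \<cdot> gi m) ` S"
  have inj: "inj_on (\<lambda>m. g \<cdot> gi m) S"
    using S(2) by (intro inj_onI) (metis cancel_l' inv_inv r_inv)
  have "coef (conv f f' ?g) = (\<Sum>h\<in>?S. coef (f h \<star> f' (gi h \<cdot> ?g)))"
  proof (rule conv_coef)
    fix h assume h: "r h = r ?g" "f h \<noteq> Z h"
    let ?m = "gi h \<cdot> g"
    have rh: "r h = r g" using h(1) gk by simp
    have m: "s ?m = s g" "g \<cdot> gi ?m = h"
      using rh by (simp_all add: inv_mult)
    have "K f g ?m \<noteq> 0" 
      unfolding K_eq_0_iff[OF f(1) m(1)[symmetric]] m(2) by (rule h(2))
    then have "?m \<in> S" using m S(3) by blast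
    then show "h \<in> ?S" using m(2) by (metis image_eqI)
  qed (use f gk S(1,2) in \<open>auto\<close>)
  also have "\<dots> = (\<Sum>m\<in>S. coef (f (g \<cdot> gi m) \<star> f' (m \<cdot> gi k)))"
    unfolding sum.reindex[OF inj] o_def
  proof (intro sum.cong refl)
    fix m assume "m \<in> S"
    then have "s m = s g" using S by blast
    then have "gi (g \<cdot> gi m) \<cdot> (g \<cdot> gi k) = m \<cdot> gi k"
      using gk by (simp add: inv_mult assoc)
    then show "coef (f (g \<cdot> gi m) \<star> f' (gi (g \<cdot> gi m) \<cdot> ?g)) = coef (f (g \<cdot> gi m) \<star> f' (m \<cdot> gi k))" by simp
  qed
  finally have 1: "coef (conv f f' ?g) = (\<Sum>m\<in>S. coef (f (g \<cdot> gi m) \<star> f' (m \<cdot> gi k)))" .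
  have "K (conv f f') g k = coef (conv f f' ?g) * coef (e ?g \<star> e k)"
    unfolding K_def using f gk by (subst coef_mul_e) auto
  also have "\<dots> = (\<Sum>m\<in>S. coef (f (g \<cdot> gi m) \<star> f' (m \<cdot> gi k)) * coef (e ?g \<star> e k))"
    by (simp add: 1 sum_distrib_right)
  also have "\<dots> = (\<Sum>m\<in>S. K f g m * K f' m k)"
  proof (intro sum.cong refl)
    fix m assume "m \<in> S"
    then have m: "s m = s g" using S by blast
    have pm: "p (f (g \<cdot> gi m) \<star> f' (m \<cdot> gi k)) = ?g"
      using m f gk by (simp add: assoc)
    have "coef (f (g \<cdot> gi m) \<star> f' (m \<cdot> gi k)) * coef (e ?g \<star> e k) = coef (f (g \<cdot> gi m) \<star> f' (m \<cdot> gi k) \<star> e k)"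
      using pm gk by (subst coef_mul_e) auto
    also have "f (g \<cdot> gi m) \<star> f' (m \<cdot> gi k) \<star> e k = f (g \<cdot> gi m) \<star> sc (K f' m k) (e m)"
      using m f gk by (simp add: mul_assoc K_eq)
    also have "coef \<dots> = K f g m * K f' m k"
      using m f gk by (simp add: K_eq mult.commute)
    finally show "coef (f (g \<cdot> gi m) \<star> f' (m \<cdot> gi k)) * coef (e ?g \<star> e k) = K f g m * K f' m k" .
  qed
  finally show ?thesis .
qed

lemma fib_fin_rows:
  assumes "fib_fin f"
  shows "finite {m. s m = s g \<and> K f g m \<noteq> 0}"
proof -
  have "{m. s m = s g \<and> K f g m \<noteq> 0} \<subseteq> (\<lambda>h. gi h \<cdot> g) ` {h. r h = r g \<and> f h \<noteq> Z h}"
  proof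
    fix m assume m: "m \<in> {m. s m = s g \<and> K f g m \<noteq> 0}"
    then have "f (g \<cdot> gi m) \<noteq> Z (g \<cdot> gi m)" using K_eq_0_iff[OF fib_fin_sec[OF assms]] by auto
    moreover have "m = gi (g \<cdot> gi m) \<cdot> g" "r (g \<cdot> gi m) = r g" using m by (simp_all add: inv_mult)
    ultimately show "m \<in> (\<lambda>h. gi h \<cdot> g) ` {h. r h = r g \<and> f h \<noteq> Z h}" by blast
  qed
  then show ?thesis using assms finite_surj unfolding fib_fin_def by blast
qed

lemma fib_fin_cols:
  assumes "fib_fin f"
  shows "finite {g. s g = s k \<and> K f g k \<noteq> 0}"
proof -
  have "{g. s g = s k \<and> K f g k \<noteq> 0} \<subseteq> (\<lambda>h. h \<cdot> k) ` {h. s h = r k \<and> f h \<noteq> Z h}"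
  proof
    fix g assume g: "g \<in> {g. s g = s k \<and> K f g k \<noteq> 0}"
    then have "f (g \<cdot> gi k) \<noteq> Z (g \<cdot> gi k)" using K_eq_0_iff[OF fib_fin_sec[OF assms]] by auto
    moreover have "g = (g \<cdot> gi k) \<cdot> k" "s (g \<cdot> gi k) = r k" using g by (simp_all)
    ultimately show "g \<in> (\<lambda>h. h \<cdot> k) ` {h. s h = r k \<and> f h \<noteq> Z h}" by blast
  qed
  then show ?thesis using assms finite_surj unfolding fib_fin_def by blast
qed


section \<open>Operator bounds\<close>

text \<open>The matrix of \<open>f\<close> on the source fibre of \<open>x\<close> has operator norm at most \<open>C\<close>, tested on vectors
  with finite support \<open>T\<close> and on finitely many rows \<open>F\<close>, so that no infinite sum occurs.\<close>

definition op_bdd :: "('g \<Rightarrow> 'l) \<Rightarrow> 'g \<Rightarrow> real \<Rightarrow> bool" where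
  "op_bdd f x C \<longleftrightarrow> (\<forall>\<xi> F T. finite F \<longrightarrow> finite T \<longrightarrow> F \<subseteq> s -` {x} \<longrightarrow> T \<subseteq> s -` {x} \<longrightarrow>
     L2_set (\<lambda>g. cmod (\<Sum>m\<in>T. K f g m * \<xi> m)) F \<le> C * L2_set (\<lambda>m. cmod (\<xi> m)) T)"

lemma op_bddI:
  assumes "\<And>\<xi> F T. finite F \<Longrightarrow> finite T \<Longrightarrow> F \<subseteq> s -` {x} \<Longrightarrow> T \<subseteq> s -` {x} \<Longrightarrow>
     L2_set (\<lambda>g. cmod (\<Sum>m\<in>T. K f g m * \<xi> m)) F \<le> C * L2_set (\<lambda>m. cmod (\<xi> m)) T"
  shows "op_bdd f x C"
  using assms unfolding op_bdd_def by blast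

lemma op_bddD:
  assumes "op_bdd f x C" "finite F" "finite T" "F \<subseteq> s -` {x}" "T \<subseteq> s -` {x}"
  shows "L2_set (\<lambda>g. cmod (\<Sum>m\<in>T. K f g m * \<xi> m)) F \<le> C * L2_set (\<lambda>m. cmod (\<xi> m)) T"
  using assms unfolding op_bdd_def by blast

lemma op_bdd_point:
  assumes "op_bdd f x C" "sec f" "x \<in> X" "s g = x"
  shows "nm (f g) \<le> C"
  using op_bddD[OF assms(1), of "{g}" "{x}" "\<lambda>_. 1"] assms by (simp add: K_unit)

lemma op_bdd_nonneg: "op_bdd f x C \<Longrightarrow> sec f \<Longrightarrow> x \<in> X \<Longrightarrow> 0 \<le> C"
  using op_bdd_point[of f x C x] by (meson nm_nonneg order_trans s_unit)

lemma op_bdd_plus: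
  assumes "op_bdd f x C" "op_bdd f' x C'" "sec f" "sec f'"
  shows "op_bdd (plus_sec f f') x (C + C')"
proof (rule op_bddI)
  fix \<xi> F T assume *: "finite F" "finite T" "F \<subseteq> s -` {x}" "T \<subseteq> s -` {x}"
  have "(\<Sum>m\<in>T. K (plus_sec f f') g m * \<xi> m) = (\<Sum>m\<in>T. K f g m * \<xi> m) + (\<Sum>m\<in>T. K f' g m * \<xi> m)"
    if "g \<in> F" for g
    unfolding sum.distrib[symmetric] 
  proof (intro sum.cong refl)
    fix m assume "m \<in> T"
    then have "s g = s m" using that * by auto
    then show "K (plus_sec f f') g m * \<xi> m = K f g m * \<xi> m + K f' g m * \<xi> m"
      using assms by (simp add: K_plus algebra_simps)
  qed
  then have "L2_set (\<lambda>g. cmod (\<Sum>m\<in>T. K (plus_sec f f') g m * \<xi> m)) F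
     \<le> L2_set (\<lambda>g. cmod (\<Sum>m\<in>T. K f g m * \<xi> m) + cmod (\<Sum>m\<in>T. K f' g m * \<xi> m)) F"
    by (intro L2_set_mono) (auto simp: norm_triangle_ineq)
  also have "\<dots> \<le> L2_set (\<lambda>g. cmod (\<Sum>m\<in>T. K f g m * \<xi> m)) F + L2_set (\<lambda>g. cmod (\<Sum>m\<in>T. K f' g m * \<xi> m)) F"
    by (rule L2_set_triangle_ineq)
  also have "\<dots> \<le> C * L2_set (\<lambda>m. cmod (\<xi> m)) T + C' * L2_set (\<lambda>m. cmod (\<xi> m)) T"
    by (intro add_mono op_bddD[OF assms(1)] op_bddD[OF assms(2)] *)
  finally show "L2_set (\<lambda>g. cmod (\<Sum>m\<in>T. K (plus_sec f f') g m * \<xi> m)) F \<le> (C + C') * L2_set (\<lambda>m. cmod (\<xi> m)) T"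
    by (simp add: algebra_simps)
qed

lemma op_bdd_sc:
  assumes "op_bdd f x C" "sec f"
  shows "op_bdd (sc_sec c f) x (cmod c * C)"
proof (rule op_bddI)
  fix \<xi> F T assume *: "finite F" "finite T" "F \<subseteq> s -` {x}" "T \<subseteq> s -` {x}"
  have "(\<Sum>m\<in>T. K (sc_sec c f) g m * \<xi> m) = c * (\<Sum>m\<in>T. K f g m * \<xi> m)"
    if "g \<in> F" for g
    unfolding sum_distrib_left
  proof (intro sum.cong refl)
    fix m assume "m \<in> T"
    then have "s g = s m" using that * by auto
    then show "K (sc_sec c f) g m * \<xi> m = c * (K f g m * \<xi> m)"
      using assms by (simp add: K_sc algebra_simps)
  qed
  then have "L2_set (\<lambda>g. cmod (\<Sum>m\<in>T. K (sc_sec c f) g m * \<xi> m)) F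
     = L2_set (\<lambda>g. cmod c * cmod (\<Sum>m\<in>T. K f g m * \<xi> m)) F"
    by (intro L2_set_cong) (auto simp: norm_mult)
  also have "\<dots> = cmod c * L2_set (\<lambda>g. cmod (\<Sum>m\<in>T. K f g m * \<xi> m)) F"
    by (simp add: L2_set_right_distrib)
  also have "\<dots> \<le> cmod c * (C * L2_set (\<lambda>m. cmod (\<xi> m)) T)"
    by (intro mult_left_mono op_bddD[OF assms(1)] *) auto
  finally show "L2_set (\<lambda>g. cmod (\<Sum>m\<in>T. K (sc_sec c f) g m * \<xi> m)) F \<le> (cmod c * C) * L2_set (\<lambda>m. cmod (\<xi> m)) T"
    by (simp add: algebra_simps)
qed

lemma op_bdd_conv:
  assumes "op_bdd f x C" "op_bdd f' x C'" "fib_fin f" "sec f'" "0 \<le> C"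
  shows "op_bdd (conv f f') x (C * C')"
proof (rule op_bddI)
  fix \<xi> F T assume *: "finite F" "finite T" "F \<subseteq> s -` {x}" "T \<subseteq> s -` {x}"
  define S where "S = (\<Union>g\<in>F. {m. s m = s g \<and> K f g m \<noteq> 0})"
  have S: "finite S" "S \<subseteq> s -` {x}"
    using * fib_fin_rows[OF assms(3)] by (auto simp: S_def)
  define \<eta> where "\<eta> m = (\<Sum>k\<in>T. K f' m k * \<xi> k)" for m
  have "(\<Sum>k\<in>T. K (conv f f') g k * \<xi> k) = (\<Sum>m\<in>S. K f g m * \<eta> m)" if g: "g \<in> F" for g
  proof -
    have "K (conv f f') g k = (\<Sum>m\<in>S. K f g m * K f' m k)" if "k \<in> T" for k
    proof (rule K_conv)
      show "s g = s k" using g \<open>k \<in> T\<close> * by auto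
      show "s m = s g" if "m \<in> S" for m using that S g * by auto
      show "m \<in> S" if "s m = s g" "K f g m \<noteq> 0" for m using that g by (auto simp: S_def)
    qed (use assms S fib_fin_sec in auto)
    then have "(\<Sum>k\<in>T. K (conv f f') g k * \<xi> k) = (\<Sum>k\<in>T. \<Sum>m\<in>S. K f g m * K f' m k * \<xi> k)"
      by (simp add: sum_distrib_right)
    also have "\<dots> = (\<Sum>m\<in>S. \<Sum>k\<in>T. K f g m * K f' m k * \<xi> k)"
      by (rule sum.swap)
    finally show ?thesis by (simp add: \<eta>_def sum_distrib_left mult.assoc)
  qed
  then have "L2_set (\<lambda>g. cmod (\<Sum>m\<in>T. K (conv f f') g m * \<xi> m)) F
     = L2_set (\<lambda>g. cmod (\<Sum>m\<in>S. K f g m * \<eta> m)) F"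
    by (intro L2_set_cong) auto
  also have "\<dots> \<le> C * L2_set (\<lambda>m. cmod (\<eta> m)) S"
    by (intro op_bddD[OF assms(1)] * S)
  also have "\<dots> \<le> C * (C' * L2_set (\<lambda>m. cmod (\<xi> m)) T)"
    unfolding \<eta>_def by (intro mult_left_mono op_bddD[OF assms(2)] * S assms(5))
  finally show "L2_set (\<lambda>g. cmod (\<Sum>m\<in>T. K (conv f f') g m * \<xi> m)) F \<le> C * C' * L2_set (\<lambda>m. cmod (\<xi> m)) T"
    by simp
qed

text \<open>With finitely many columns \<open>T\<close> only finitely many rows matter. For \<open>\<eta> = K f \<xi>\<close> one has
  \<open>\<parallel>\<eta>\<parallel>\<^sup>2 = \<langle>\<xi>, (K f)* K f \<xi>\<rangle>\<close>, which Cauchy-Schwarz bounds by \<open>D \<parallel>\<xi>\<parallel>\<^sup>2\<close>.\<close>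

lemma op_bdd_star_conv:
  assumes "op_bdd (conv (star_sec f) f) x D" "fib_fin f" "fib_fin (star_sec f)" "0 \<le> D"
  shows "op_bdd f x (sqrt D)"
proof (rule op_bddI)
  fix \<xi> F0 T assume *: "finite F0" "finite T" "F0 \<subseteq> s -` {x}" "T \<subseteq> s -` {x}"
  \<comment> \<open>All rows in which one of the columns in \<open>T\<close> has a non-zero entry are added.\<close>
  define F where "F = F0 \<union> (\<Union>k\<in>T. {g. s g = s k \<and> K f g k \<noteq> 0})"
  have F: "finite F" "F \<subseteq> s -` {x}" "F0 \<subseteq> F"
    using * fib_fin_cols[OF assms(2)] by (auto simp: F_def)
  define \<eta> where "\<eta> g = (\<Sum>k\<in>T. K f g k * \<xi> k)" for g
  define \<zeta> where "\<zeta> k = (\<Sum>l\<in>T. K (conv (star_sec f) f) k l * \<xi> l)" for k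
  have sf: "sec f" using assms(2) fib_fin_sec by blast
  have \<zeta>: "\<zeta> k = (\<Sum>g\<in>F. cnj (K f g k) * \<eta> g)" if k: "k \<in> T" for k
  proof -
    have "K (conv (star_sec f) f) k l = (\<Sum>g\<in>F. cnj (K f g k) * K f g l)" if "l \<in> T" for l
    proof -
      have "K (conv (star_sec f) f) k l = (\<Sum>g\<in>F. K (star_sec f) k g * K f g l)"
      proof (rule K_conv)
        show "s k = s l" using k \<open>l \<in> T\<close> * by auto
        show "s m = s k" if "m \<in> F" for m using that F k * by auto
        show "m \<in> F" if "s m = s k" "K (star_sec f) k m \<noteq> 0" for m 
          using that k K_star[of f m k] sf by (auto simp: F_def)
      qed (use sf F in auto)
      also have "\<dots> = (\<Sum>g\<in>F. cnj (K f g k) * K f g l)"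
      proof (intro sum.cong refl)
        fix g assume "g \<in> F"
        then have "s g = s k" using F k * by auto
        then show "K (star_sec f) k g * K f g l = cnj (K f g k) * K f g l"
          using sf by (simp add: K_star)
      qed
      finally show ?thesis .
    qed
    then have "\<zeta> k = (\<Sum>l\<in>T. \<Sum>g\<in>F. cnj (K f g k) * K f g l * \<xi> l)"
      by (simp add: \<zeta>_def sum_distrib_right)
    also have "\<dots> = (\<Sum>g\<in>F. \<Sum>l\<in>T. cnj (K f g k) * K f g l * \<xi> l)"
      by (rule sum.swap)
    finally show ?thesis by (simp add: \<eta>_def sum_distrib_left mult.assoc)
  qed
  have "of_real ((L2_set (\<lambda>g. cmod (\<eta> g)) F)\<^sup>2) = (\<Sum>g\<in>F. cnj (\<eta> g) * \<eta> g)"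
    by (simp add: L2_set_sq cmod_power2 complex_mult_cnj mult.commute flip: of_real_power)
  also have "\<dots> = (\<Sum>g\<in>F. \<Sum>k\<in>T. cnj (K f g k) * cnj (\<xi> k) * \<eta> g)"
    by (subst \<eta>_def) (simp add: sum_distrib_right)
  also have "\<dots> = (\<Sum>k\<in>T. \<Sum>g\<in>F. cnj (K f g k) * cnj (\<xi> k) * \<eta> g)"
    by (rule sum.swap)
  also have "\<dots> = (\<Sum>k\<in>T. cnj (\<xi> k) * \<zeta> k)"
    by (intro sum.cong refl) (simp add: \<zeta> sum_distrib_left mult_ac)
  finally have "(L2_set (\<lambda>g. cmod (\<eta> g)) F)\<^sup>2 = cmod (\<Sum>k\<in>T. cnj (\<xi> k) * \<zeta> k)"
    by (metis norm_of_real abs_power2 abs_of_nonneg zero_le_power2)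
  also have "\<dots> \<le> (\<Sum>k\<in>T. \<bar>cmod (\<xi> k)\<bar> * \<bar>cmod (\<zeta> k)\<bar>)"
    by (rule order_trans[OF norm_sum]) (simp add: norm_mult)
  also have "\<dots> \<le> L2_set (\<lambda>k. cmod (\<xi> k)) T * L2_set (\<lambda>k. cmod (\<zeta> k)) T"
    by (rule L2_set_mult_ineq)
  also have "\<dots> \<le> L2_set (\<lambda>k. cmod (\<xi> k)) T * (D * L2_set (\<lambda>k. cmod (\<xi> k)) T)"
    unfolding \<zeta>_def by (intro mult_left_mono op_bddD[OF assms(1)] * L2_set_nonneg)
  also have "\<dots> = (sqrt D * L2_set (\<lambda>k. cmod (\<xi> k)) T)\<^sup>2"
    using assms(4) by (simp add: power_mult_distrib power2_eq_square)
  finally have "L2_set (\<lambda>g. cmod (\<eta> g)) F \<le> sqrt D * L2_set (\<lambda>k. cmod (\<xi> k)) T"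
    by (rule power2_le_imp_le) (use assms(4) in \<open>simp add: L2_set_nonneg\<close>)
  moreover have "L2_set (\<lambda>g. cmod (\<eta> g)) F0 \<le> L2_set (\<lambda>g. cmod (\<eta> g)) F"
    unfolding L2_set_def using F by (intro real_sqrt_le_mono sum_mono2) auto
  ultimately show "L2_set (\<lambda>g. cmod (\<Sum>m\<in>T. K f g m * \<xi> m)) F0 \<le> sqrt D * L2_set (\<lambda>m. cmod (\<xi> m)) T"
    unfolding \<eta>_def by simp
qed

text \<open>The matrix has at most one non-zero entry in each row, since the range is injective on \<open>U\<close>, and
  in each column, since the source is. All entries are bounded by \<open>C\<close>.\<close>

lemma op_bdd_bisection:
  assumes U: "open_bisection L U" and f: "supp_in U f" and C: "\<And>g. nm (f g) \<le> C"
  shows "op_bdd f x C"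
proof (rule op_bddI)
  fix \<xi> F T assume *: "finite F" "finite T" "F \<subseteq> s -` {x}" "T \<subseteq> s -` {x}"
  have sf: "sec f" and out: "\<And>g. f g \<noteq> Z g \<Longrightarrow> g \<in> U" using f by (auto simp: supp_in_def)
  have C0: "0 \<le> C" using C nm_nonneg order_trans by blast
  have inU: "g \<cdot> gi m \<in> U" if "g \<in> s -` {x}" "m \<in> s -` {x}" "K f g m \<noteq> 0" for g m
  proof -
    have "s g = s m" using that by simp
    then show ?thesis using that(3) K_eq_0_iff[OF sf, of g m] out by blast
  qed
  have row: "m = m'" if "g \<in> s -` {x}" "m \<in> s -` {x}" "m' \<in> s -` {x}" "K f g m \<noteq> 0" "K f g m' \<noteq> 0" for g m m'
  proof -
    have ss: "s g = s m" "s g = s m'" using that(1-3) by simp_all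
    have "g \<cdot> gi m = g \<cdot> gi m'"
      by (rule r_bisection_eq[OF U inU[OF that(1,2,4)] inU[OF that(1,3,5)]]) (use ss in simp)
    then have "gi g \<cdot> (g \<cdot> gi m) = gi g \<cdot> (g \<cdot> gi m')" by simp
    moreover have "gi g \<cdot> (g \<cdot> gi m) = gi m" "gi g \<cdot> (g \<cdot> gi m') = gi m'"
      by (rule cancel_l'; use ss in simp)+
    ultimately have "gi m = gi m'" by simp
    then show ?thesis by (metis inv_inv)
  qed
  have col: "g = g'" if "m \<in> s -` {x}" "g \<in> s -` {x}" "g' \<in> s -` {x}" "K f g m \<noteq> 0" "K f g' m \<noteq> 0" for g g' m
  proof -
    have ss: "s g = s m" "s g' = s m" using that(1-3) by simp_all
    have "g \<cdot> gi m = g' \<cdot> gi m"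
      by (rule s_bisection_eq[OF U inU[OF that(2,1,4)] inU[OF that(3,1,5)]]) (simp add: ss)
    then have "g \<cdot> gi m \<cdot> m = g' \<cdot> gi m \<cdot> m" by simp
    then show ?thesis using ss by simp
  qed
  have "(L2_set (\<lambda>g. cmod (\<Sum>m\<in>T. K f g m * \<xi> m)) F)\<^sup>2 = (\<Sum>g\<in>F. \<Sum>m\<in>T. (cmod (K f g m * \<xi> m))\<^sup>2)"
    unfolding L2_set_sq
  proof (intro sum.cong refl norm_sum_single *)
    fix g m m' assume "g \<in> F" "m \<in> T" "m' \<in> T" and nz: "K f g m * \<xi> m \<noteq> 0" "K f g m' * \<xi> m' \<noteq> 0"
    then have "g \<in> s -` {x}" "m \<in> s -` {x}" "m' \<in> s -` {x}" using * by blast+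
    moreover have "K f g m \<noteq> 0" "K f g m' \<noteq> 0" using nz by auto
    ultimately show "m = m'" by (rule row)
  qed
  also have "\<dots> = (\<Sum>m\<in>T. (\<Sum>g\<in>F. (cmod (K f g m))\<^sup>2) * (cmod (\<xi> m))\<^sup>2)"
    by (subst sum.swap) (simp add: norm_mult power_mult_distrib sum_distrib_right)
  also have "\<dots> \<le> (\<Sum>m\<in>T. C\<^sup>2 * (cmod (\<xi> m))\<^sup>2)"
  proof (intro sum_mono mult_right_mono)
    fix m assume m: "m \<in> T"
    have col': "g = g'" if "g \<in> F" "g' \<in> F" "K f g m \<noteq> 0" "K f g' m \<noteq> 0" for g g'
      using that m * by (intro col[of m g g']) blast+
    have eq: "(\<Sum>g\<in>F. (cmod (K f g m))\<^sup>2) = (cmod (\<Sum>g\<in>F. K f g m))\<^sup>2"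
      using *(1) col' by (intro norm_sum_single[symmetric])
    have "cmod (\<Sum>g\<in>F. K f g m) \<le> C"
    proof (cases "\<exists>g\<in>F. K f g m \<noteq> 0")
      case True
      then obtain g where g: "g \<in> F" "K f g m \<noteq> 0" by blast
      have "(\<Sum>g\<in>F. K f g m) = K f g m"
        using g col' by (subst sum.remove[OF *(1) g(1)]) (auto intro!: sum.neutral)
      moreover have "s g = s m" using g m * by auto
      ultimately show ?thesis using C sf by simp
    next
      case False
      then show ?thesis using C0 by simp
    qed
    then show "(\<Sum>g\<in>F. (cmod (K f g m))\<^sup>2) \<le> C\<^sup>2"
      unfolding eq by (simp add: power_mono)
  qed simp
  also have "\<dots> = (C * L2_set (\<lambda>m. cmod (\<xi> m)) T)\<^sup>2"
    by (simp add: power_mult_distrib L2_set_sq sum_distrib_left)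
  finally show "L2_set (\<lambda>g. cmod (\<Sum>m\<in>T. K f g m * \<xi> m)) F \<le> C * L2_set (\<lambda>m. cmod (\<xi> m)) T"
    by (rule power2_le_imp_le) (use C0 in \<open>simp add: L2_set_nonneg\<close>)
qed

section \<open>The reduced norm\<close>

lemma rep_apply:
  assumes "fib_fin f" "sec \<xi>" "s g = x" "finite S" "S \<subseteq> s -` {x}" "\<And>m. s m = x \<Longrightarrow> K f g m \<noteq> 0 \<Longrightarrow> m \<in> S"
  shows "coef (conv f \<xi> g) = (\<Sum>m\<in>S. K f g m * coef (\<xi> m))"
proof -
  have x: "x \<in> X" using assms(3) by auto
  have "coef (conv f \<xi> g) = K (conv f \<xi>) g x"
    using assms x fib_fin_sec by (subst K_unit) (auto intro: sec_conv)
  also have "\<dots> = (\<Sum>m\<in>S. K f g m * K \<xi> m x)"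
    using assms x fib_fin_sec by (intro K_conv) auto
  also have "\<dots> = (\<Sum>m\<in>S. K f g m * coef (\<xi> m))"
    using assms x by (intro sum.cong refl) (auto simp: K_unit)
  finally show ?thesis .
qed

lemma l2_sections_iff: "\<xi> \<in> l2_sections L x \<longleftrightarrow> sec \<xi> \<and> (\<forall>g. s g \<noteq> x \<longrightarrow> \<xi> g = Z g) \<and> 
    (\<lambda>g. (nm (\<xi> g))\<^sup>2) summable_on (s -` {x})"
  by (simp add: l2_sections_def bundle_sections_eq vimage_def)

lemma l2_norm_sq: "(l2_norm L x \<xi>)\<^sup>2 = (\<Sum>\<^sub>\<infinity>g\<in>s -` {x}. (nm (\<xi> g))\<^sup>2)"
  by (simp add: l2_norm_def vimage_def infsum_nonneg)

lemma l2_norm_nonneg: "0 \<le> l2_norm L x \<xi>"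
  by (simp add: l2_norm_def infsum_nonneg)

text \<open>Finitely many coordinates of \<open>f * \<xi>\<close> involve only finitely many coordinates of \<open>\<xi>\<close>, so the bound on
  finitely supported vectors passes to all square-summable sections.\<close>

lemma op_bdd_l2:
  assumes f: "fib_fin f" "op_bdd f x C" and x: "x \<in> X" and \<xi>: "\<xi> \<in> l2_sections L x"
  shows "(\<lambda>g. (nm (conv f \<xi> g))\<^sup>2) summable_on (s -` {x})"
    "l2_norm L x (conv f \<xi>) \<le> C * l2_norm L x \<xi>"
proof -
  have s\<xi>: "sec \<xi>" and sum: "(\<lambda>g. (nm (\<xi> g))\<^sup>2) summable_on (s -` {x})" 
    using \<xi> by (auto simp: l2_sections_iff)
  have C0: "0 \<le> C" using op_bdd_nonneg f x fib_fin_sec by blast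
  have fin: "(\<Sum>g\<in>F. (nm (conv f \<xi> g))\<^sup>2) \<le> (C * l2_norm L x \<xi>)\<^sup>2" if F: "finite F" "F \<subseteq> s -` {x}" for F
  proof -
    define S where "S = (\<Union>g\<in>F. {m. s m = s g \<and> K f g m \<noteq> 0})"
    have S: "finite S" "S \<subseteq> s -` {x}"
      using F fib_fin_rows[OF f(1)] by (auto simp: S_def)
    have eq: "coef (conv f \<xi> g) = (\<Sum>m\<in>S. K f g m * coef (\<xi> m))" if "g \<in> F" for g
    proof (rule rep_apply[OF f(1) s\<xi> _ S])
      show "s g = x" using that F by auto
      then show "m \<in> S" if "s m = x" "K f g m \<noteq> 0" for m
        using that \<open>g \<in> F\<close> by (auto simp: S_def)
    qed
    have "(\<Sum>g\<in>F. (nm (conv f \<xi> g))\<^sup>2) = (L2_set (\<lambda>g. cmod (\<Sum>m\<in>S. K f g m * coef (\<xi> m))) F)\<^sup>2"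
      unfolding L2_set_sq by (intro sum.cong refl) (metis eq cmod_coef)
    also have "\<dots> \<le> (C * L2_set (\<lambda>m. cmod (coef (\<xi> m))) S)\<^sup>2"
      by (intro power_mono op_bddD[OF f(2)] F S L2_set_nonneg)
    also have "\<dots> = C\<^sup>2 * (\<Sum>m\<in>S. (nm (\<xi> m))\<^sup>2)"
      by (simp add: power_mult_distrib L2_set_sq)
    also have "\<dots> \<le> C\<^sup>2 * (\<Sum>\<^sub>\<infinity>g\<in>s -` {x}. (nm (\<xi> g))\<^sup>2)"
      using S sum by (intro mult_left_mono finite_sum_le_infsum) auto
    finally show ?thesis by (simp add: power_mult_distrib l2_norm_sq)
  qed
  show *: "(\<lambda>g. (nm (conv f \<xi> g))\<^sup>2) summable_on (s -` {x})"
    by (rule nonneg_bdd_above_summable_on) (use fin in \<open>auto simp: bdd_above_def\<close>)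
  have "(l2_norm L x (conv f \<xi>))\<^sup>2 \<le> (C * l2_norm L x \<xi>)\<^sup>2"
    unfolding l2_norm_sq[of x "conv f \<xi>"] by (rule infsum_le_finite_sums[OF * fin])
  then show "l2_norm L x (conv f \<xi>) \<le> C * l2_norm L x \<xi>"
    by (rule power2_le_imp_le) (simp add: C0 l2_norm_nonneg)
qed

text \<open>The converse: a finitely supported vector is rescaled to a unit vector of the space of
  square-summable sections.\<close>

lemma l2_op_bdd:
  assumes f: "fib_fin f" "op_bdd f x B" and x: "x \<in> X" and D: "0 \<le> D"
    "\<And>\<xi>. \<xi> \<in> l2_sections L x \<Longrightarrow> l2_norm L x \<xi> \<le> 1 \<Longrightarrow> l2_norm L x (conv f \<xi>) \<le> D"
  shows "op_bdd f x D"
proof (rule op_bddI)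
  fix \<xi> F T assume *: "finite F" "finite T" "F \<subseteq> s -` {x}" "T \<subseteq> s -` {x}"
  define N where "N = L2_set (\<lambda>m. cmod (\<xi> m)) T"
  show "L2_set (\<lambda>g. cmod (\<Sum>m\<in>T. K f g m * \<xi> m)) F \<le> D * L2_set (\<lambda>m. cmod (\<xi> m)) T"
  proof (cases "N = 0")
    case True
    then have "\<And>m. m \<in> T \<Longrightarrow> \<xi> m = 0" using * by (auto simp: N_def L2_set_eq_0_iff)
    then show ?thesis using L2_set_nonneg D by (simp add: L2_set_def)
  next
    case False
    then have N: "0 < N" unfolding N_def using L2_set_nonneg[of "\<lambda>m. cmod (\<xi> m)" T] by linarith
    define \<eta> where "\<eta> g = (if g \<in> T then sc (\<xi> g / of_real N) (e g) else Z g)" for g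
    have s\<eta>: "sec \<eta>" by (simp add: sec_def \<eta>_def)
    have coef\<eta>: "coef (\<eta> m) = (if m \<in> T then \<xi> m / of_real N else 0)" for m
      by (simp add: \<eta>_def del: coef_sc)
    have hs: "((\<lambda>g. (nm (\<eta> g))\<^sup>2) has_sum (\<Sum>g\<in>T. (nm (\<eta> g))\<^sup>2)) (s -` {x})"
      by (rule has_sum_finite_neutralI[of T]) (use * in \<open>auto simp: \<eta>_def\<close>)
    have "(\<Sum>g\<in>T. (nm (\<eta> g))\<^sup>2) = (\<Sum>g\<in>T. (cmod (\<xi> g))\<^sup>2) / N\<^sup>2"
      unfolding sum_divide_distrib by (intro sum.cong refl) (use N in \<open>simp add: \<eta>_def norm_divide power_divide\<close>)
    also have "\<dots> = 1" using N unfolding N_def L2_set_sq[symmetric] by simp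
    finally have n1: "(l2_norm L x \<eta>)\<^sup>2 = 1"
      unfolding l2_norm_sq using hs infsumI by metis
    have \<eta>in: "\<eta> \<in> l2_sections L x"
      using s\<eta> hs * by (auto simp: l2_sections_iff summable_on_def) (auto simp: \<eta>_def)
    have "l2_norm L x \<eta> \<le> 1" using n1 by (auto simp: power2_eq_1_iff) 
    then have le: "l2_norm L x (conv f \<eta>) \<le> D" using D \<eta>in by blast
    have eq: "coef (conv f \<eta> g) * of_real N = (\<Sum>m\<in>T. K f g m * \<xi> m)" if "g \<in> F" for g
    proof -
      define S where "S = T \<union> {m. s m = s g \<and> K f g m \<noteq> 0}"
      have "s g = x" using that * by auto
      then have S: "finite S" "S \<subseteq> s -` {x}"
        using * fib_fin_rows[OF f(1)] by (auto simp: S_def)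
      have "coef (conv f \<eta> g) = (\<Sum>m\<in>S. K f g m * coef (\<eta> m))"
        by (rule rep_apply[OF f(1) s\<eta> \<open>s g = x\<close> S]) (use \<open>s g = x\<close> in \<open>auto simp: S_def\<close>)
      also have "\<dots> = (\<Sum>m\<in>T. K f g m * coef (\<eta> m))"
        using S by (intro sum.mono_neutral_right) (auto simp: S_def coef\<eta>)
      finally show ?thesis
        using N by (simp add: coef\<eta> sum_distrib_right)
    qed
    have "(L2_set (\<lambda>g. cmod (\<Sum>m\<in>T. K f g m * \<xi> m)) F)\<^sup>2 = (\<Sum>g\<in>F. (nm (conv f \<eta> g))\<^sup>2) * N\<^sup>2"
      unfolding L2_set_sq sum_distrib_right
    proof (intro sum.cong refl)
      fix g assume "g \<in> F"
      show "(cmod (\<Sum>m\<in>T. K f g m * \<xi> m))\<^sup>2 = (nm (conv f \<eta> g))\<^sup>2 * N\<^sup>2"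
        unfolding eq[OF \<open>g \<in> F\<close>, symmetric] norm_mult using N by (simp add: power_mult_distrib)
    qed
    also have "\<dots> \<le> (l2_norm L x (conv f \<eta>))\<^sup>2 * N\<^sup>2"
      unfolding l2_norm_sq using op_bdd_l2(1)[OF f x \<eta>in] * 
      by (intro mult_right_mono finite_sum_le_infsum) auto
    also have "\<dots> \<le> (D * N)\<^sup>2"
      unfolding power_mult_distrib[symmetric] using le N
      by (intro power_mono mult_right_mono mult_nonneg_nonneg) (auto simp: l2_norm_nonneg)
    finally show ?thesis
      unfolding N_def[symmetric] by (rule power2_le_imp_le) (use D N in simp)
  qed
qed

lemma l2_Z: "Z \<in> l2_sections L x" "l2_norm L x Z = 0"
  by (simp_all add: l2_sections_iff l2_norm_def)

lemma conv_Z_r: "fib_fin f \<Longrightarrow> conv f Z = Z"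
  using conv_sc_r[of f Z 0] fib_fin_sec by (auto simp: fun_eq_iff)

lemma rep_norm_bdd:
  assumes f: "fib_fin f" "op_bdd f x B" and x: "x \<in> X"
  shows "bdd_above {l2_norm L x (conv f \<xi>) |\<xi>. \<xi> \<in> l2_sections L x \<and> l2_norm L x \<xi> \<le> 1}"
  unfolding bdd_above_def
proof (intro exI[of _ B] ballI)
  fix y assume "y \<in> {l2_norm L x (conv f \<xi>) |\<xi>. \<xi> \<in> l2_sections L x \<and> l2_norm L x \<xi> \<le> 1}"
  then obtain \<xi> where "\<xi> \<in> l2_sections L x" "l2_norm L x \<xi> \<le> 1" "y = l2_norm L x (conv f \<xi>)" by blast
  then show "y \<le> B"
    using op_bdd_l2(2)[OF f x, of \<xi>] op_bdd_nonneg[OF f(2) fib_fin_sec[OF f(1)] x]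
    by (metis mult_left_mono mult.right_neutral order_trans)
qed

lemma rep_norm_nonneg:
  assumes f: "fib_fin f" "op_bdd f x B" and x: "x \<in> X"
  shows "0 \<le> rep_norm L x f"
  unfolding rep_norm_def
  by (rule cSup_upper2[OF _ _ rep_norm_bdd[OF assms]])
    (use l2_Z conv_Z_r[OF f(1)] in \<open>auto intro!: exI[of _ Z]\<close>)

lemma rep_norm_le_iff:
  assumes f: "fib_fin f" "op_bdd f x B" and x: "x \<in> X"
  shows "rep_norm L x f \<le> C \<longleftrightarrow> op_bdd f x C"
proof
  assume le: "rep_norm L x f \<le> C"
  show "op_bdd f x C"
  proof (rule l2_op_bdd[OF f x])
    show "0 \<le> C" using rep_norm_nonneg[OF assms] le by simp
    fix \<xi> assume "\<xi> \<in> l2_sections L x" "l2_norm L x \<xi> \<le> 1"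
    then have "l2_norm L x (conv f \<xi>) \<le> rep_norm L x f"
      unfolding rep_norm_def by (intro cSup_upper rep_norm_bdd[OF assms]) blast
    then show "l2_norm L x (conv f \<xi>) \<le> C" using le by simp
  qed
next
  assume C: "op_bdd f x C"
  show "rep_norm L x f \<le> C"
    unfolding rep_norm_def
  proof (rule cSup_least)
    show "{l2_norm L x (conv f \<xi>) |\<xi>. \<xi> \<in> l2_sections L x \<and> l2_norm L x \<xi> \<le> 1} \<noteq> {}"
      using l2_Z[of x] by force
    fix y assume "y \<in> {l2_norm L x (conv f \<xi>) |\<xi>. \<xi> \<in> l2_sections L x \<and> l2_norm L x \<xi> \<le> 1}"
    then obtain \<xi> where "\<xi> \<in> l2_sections L x" "l2_norm L x \<xi> \<le> 1" "y = l2_norm L x (conv f \<xi>)" by blast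
    then show "y \<le> C"
      using op_bdd_l2(2)[OF f(1) C x, of \<xi>] op_bdd_nonneg[OF C fib_fin_sec[OF f(1)] x]
      by (metis mult_left_mono mult.right_neutral order_trans)
  qed
qed

text \<open>Among the fibrewise finite sections, those for which the supremum defining the reduced norm is
  finite.\<close>

definition bdd_op :: "('g \<Rightarrow> 'l) \<Rightarrow> bool" where
  "bdd_op f \<longleftrightarrow> fib_fin f \<and> (\<exists>B. \<forall>x\<in>X. op_bdd f x B)"

lemma bdd_op_sec: "bdd_op f \<Longrightarrow> sec f" and bdd_op_fib_fin: "bdd_op f \<Longrightarrow> fib_fin f"
  by (auto simp: bdd_op_def fib_fin_sec)

text \<open>All properties of the reduced norm follow from this description by operator bounds.\<close>

lemma red_le_iff:
  assumes "bdd_op f" 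
  shows "red_norm L f \<le> C \<longleftrightarrow> (\<forall>x\<in>X. op_bdd f x C)"
proof -
  obtain B where f: "fib_fin f" "\<And>x. x \<in> X \<Longrightarrow> op_bdd f x B" using assms by (auto simp: bdd_op_def)
  have "bdd_above ((\<lambda>x. rep_norm L x f) ` X)"
    using rep_norm_le_iff[OF f(1) f(2)] f(2) unfolding bdd_above_def by blast
  then have "red_norm L f \<le> C \<longleftrightarrow> (\<forall>x\<in>X. rep_norm L x f \<le> C)"
    unfolding red_norm_def using r_in by (subst cSUP_le_iff) blast+
  then show ?thesis using rep_norm_le_iff[OF f(1) f(2)] by auto
qed

lemma red_op_bdd: "bdd_op f \<Longrightarrow> x \<in> X \<Longrightarrow> op_bdd f x (red_norm L f)"
  using red_le_iff[of f "red_norm L f"] by blast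

lemma nm_le_red: "bdd_op f \<Longrightarrow> nm (f g) \<le> red_norm L f"
  using op_bdd_point[OF red_op_bdd, of f "s g" g] bdd_op_sec by auto

lemma red_nonneg: "bdd_op f \<Longrightarrow> 0 \<le> red_norm L f"
  using nm_le_red nm_nonneg order_trans by blast

lemma bdd_opI: "fib_fin f \<Longrightarrow> (\<And>x. x \<in> X \<Longrightarrow> op_bdd f x B) \<Longrightarrow> bdd_op f"
  by (auto simp: bdd_op_def)

lemma bdd_op_plus: 
  assumes "bdd_op f" "bdd_op f'"
  shows "bdd_op (plus_sec f f')"
  using bdd_opI[OF fib_fin_plus op_bdd_plus[OF red_op_bdd red_op_bdd]] assms bdd_op_fib_fin bdd_op_sec by blast

lemma bdd_op_sc: 
  assumes "bdd_op f"
  shows "bdd_op (sc_sec c f)"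
  using bdd_opI[OF fib_fin_sc op_bdd_sc[OF red_op_bdd]] assms bdd_op_fib_fin bdd_op_sec by blast

lemma bdd_op_bisection:
  assumes U: "open_bisection L U" and f: "supp_in U f" and C: "\<And>g. nm (f g) \<le> C"
  shows "bdd_op f" "red_norm L f \<le> C"
proof -
  show "bdd_op f" using op_bdd_bisection[OF assms] fib_fin_bisection[OF U f] by (auto simp: bdd_op_def)
  then show "red_norm L f \<le> C" using op_bdd_bisection[OF assms] red_le_iff by blast
qed

lemma red_triangle: "bdd_op f \<Longrightarrow> bdd_op f' \<Longrightarrow> red_norm L (plus_sec f f') \<le> red_norm L f + red_norm L f'"
  using red_le_iff[OF bdd_op_plus] op_bdd_plus[OF red_op_bdd red_op_bdd] bdd_op_sec by blast

lemma red_sc_le: "bdd_op f \<Longrightarrow> red_norm L (sc_sec c f) \<le> cmod c * red_norm L f"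
  using red_le_iff[OF bdd_op_sc] op_bdd_sc[OF red_op_bdd] bdd_op_sec by blast

lemma red_sc: 
  assumes "bdd_op f"
  shows "red_norm L (sc_sec c f) = cmod c * red_norm L f"
proof (cases "c = 0")
  case True
  then show ?thesis using red_sc_le[OF assms, of 0] red_nonneg[OF bdd_op_sc[OF assms, of 0]] by simp
next
  case False
  have "red_norm L (sc_sec (1/c) (sc_sec c f)) \<le> cmod (1/c) * red_norm L (sc_sec c f)"
    by (intro red_sc_le bdd_op_sc assms)
  then have "cmod c * red_norm L f \<le> red_norm L (sc_sec c f)"
    using False by (simp add: norm_divide field_simps)
  then show ?thesis using red_sc_le[OF assms, of c] by simp
qed

lemma red_conv: "bdd_op f \<Longrightarrow> bdd_op f' \<Longrightarrow> bdd_op (conv f f') \<Longrightarrow> red_norm L (conv f f') \<le> red_norm L f * red_norm L f'"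
  using red_le_iff[of "conv f f'"] op_bdd_conv[OF red_op_bdd red_op_bdd] bdd_op_sec bdd_op_fib_fin red_nonneg by blast

lemma red_star_conv: 
  assumes "bdd_op f" "bdd_op (star_sec f)" "bdd_op (conv (star_sec f) f)"
  shows "(red_norm L f)\<^sup>2 \<le> red_norm L (conv (star_sec f) f)"
proof -
  have "red_norm L f \<le> sqrt (red_norm L (conv (star_sec f) f))"
    using red_le_iff[OF assms(1)] op_bdd_star_conv[OF red_op_bdd[OF assms(3)]] red_nonneg[OF assms(3)] bdd_op_fib_fin assms
    by blast
  then have "(red_norm L f)\<^sup>2 \<le> (sqrt (red_norm L (conv (star_sec f) f)))\<^sup>2"
    using red_nonneg[OF assms(1)] by (rule power_mono)
  then show ?thesis using red_nonneg[OF assms(3)] by simp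
qed

lemma red_star_le:
  assumes "bdd_op f" "bdd_op (star_sec f)" "bdd_op (conv (star_sec f) f)"
  shows "red_norm L f \<le> red_norm L (star_sec f)"
proof (cases "red_norm L f = 0")
  case True
  then show ?thesis using red_nonneg assms by simp
next
  case False
  have "red_norm L f * red_norm L f \<le> red_norm L (star_sec f) * red_norm L f"
    using red_star_conv[OF assms] red_conv[OF assms(2,1,3)] by (simp add: power2_eq_square)
  then show ?thesis using False red_nonneg[OF assms(1)] by simp
qed

text \<open>The inequality \<open>\<parallel>f\<parallel>\<^sup>2 \<le> \<parallel>f* f\<parallel>\<close> forces \<open>\<parallel>f\<parallel> \<le> \<parallel>f*\<parallel>\<close>; applied to \<open>f*\<close> this gives the reverse.\<close>

lemma red_cstar:
  assumes "bdd_op f" "bdd_op (star_sec f)" "bdd_op (conv (star_sec f) f)" "bdd_op (conv f (star_sec f))"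
  shows "red_norm L (conv (star_sec f) f) = (red_norm L f)\<^sup>2"
proof -
  have "red_norm L (star_sec f) \<le> red_norm L f"
    using red_star_le[of "star_sec f"] assms by simp
  then have "red_norm L (conv (star_sec f) f) \<le> red_norm L f * red_norm L f"
    using red_conv[OF assms(2,1,3)] mult_right_mono[of _ _ "red_norm L f"] red_nonneg[OF assms(1)] by fastforce
  then show ?thesis using red_star_conv[OF assms(1-3)] by (simp add: power2_eq_square)
qed

lemma red_eq_0_iff: "bdd_op f \<Longrightarrow> red_norm L f = 0 \<longleftrightarrow> f = Z"
proof
  assume f: "bdd_op f" "red_norm L f = 0"
  have "f g = Z g" for g
    using nm_le_red[OF f(1), of g] f(2) nm_eq_0_iff[of "f g"] bdd_op_sec[OF f(1)] by (simp add: order_antisym)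
  then show "f = Z" by blast
next
  assume "bdd_op f" "f = Z"
  then show "red_norm L f = 0" using red_sc[of f 0] by simp
qed


section \<open>Topology of the bundle\<close>

lemma banach_bundle: "open_bisection L U \<Longrightarrow> continuous_banach_bundle_on L U"
  and cont_p: "continuous_on UNIV p"
  using fell by (auto simp: fell_line_bundle_def)

lemma bundleD:
  assumes "open_bisection L U"
  shows "openin (top_of_set (p -` U)) W \<Longrightarrow> openin (top_of_set U) (p ` W)"
    "continuous_on {(\<xi>, \<eta>). p \<xi> \<in> U \<and> p \<eta> = p \<xi>} (\<lambda>(\<xi>, \<eta>). add \<xi> \<eta>)"
    "continuous_on (p -` U) (sc c)"
    "continuous_on (p -` U) nm"
    "g \<in> U \<Longrightarrow> (nm \<longlongrightarrow> 0) F \<Longrightarrow> (p \<longlongrightarrow> g) F \<Longrightarrow> ((\<lambda>\<xi>. \<xi>) \<longlongrightarrow> Z g) F"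
  using banach_bundle[OF assms] unfolding continuous_banach_bundle_on_def by blast+

text \<open>The axiom about zero vectors, for maps into the bundle instead of filters on it.\<close>

lemma tendsto_zero:
  assumes "open_bisection L U" "g \<in> U" "((\<lambda>a. nm (f a)) \<longlongrightarrow> 0) F" "((\<lambda>a. p (f a)) \<longlongrightarrow> g) F"
  shows "(f \<longlongrightarrow> Z g) F"
proof -
  have "((\<lambda>\<xi>. \<xi>) \<longlongrightarrow> Z g) (filtermap f F)"
    by (rule bundleD(5)[OF assms(1,2)]) (use assms in \<open>simp_all add: filterlim_filtermap\<close>)
  then show ?thesis by (simp add: filterlim_filtermap)
qed

lemma tendsto_fadd:
  assumes U: "open_bisection L U" and lim: "(f \<longlongrightarrow> \<xi>) F" "(f' \<longlongrightarrow> \<eta>) F"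
    and p: "p \<xi> \<in> U" "p \<eta> = p \<xi>" "\<forall>\<^sub>F a in F. p (f a) \<in> U \<and> p (f' a) = p (f a)"
  shows "((\<lambda>a. add (f a) (f' a)) \<longlongrightarrow> add \<xi> \<eta>) F"
  using continuous_on_tendsto_compose[OF bundleD(2)[OF U], OF tendsto_Pair[OF lim]] p by simp

lemma cont_add:
  assumes U: "open_bisection L U" and c: "continuous_on S f" "continuous_on S f'"
    and p: "\<And>a. a \<in> S \<Longrightarrow> p (f a) \<in> U" "\<And>a. a \<in> S \<Longrightarrow> p (f' a) = p (f a)"
  shows "continuous_on S (\<lambda>a. add (f a) (f' a))"
  using continuous_on_compose2[OF bundleD(2)[OF U] continuous_on_Pair[OF c]] p by auto

lemma cont_nm:
  assumes U: "open_bisection L U" and c: "continuous_on S f" 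
    and p: "\<And>a. a \<in> S \<Longrightarrow> p (f a) \<in> U"
  shows "continuous_on S (\<lambda>a. nm (f a))"
  using continuous_on_compose2[OF bundleD(4)[OF U] c] p by auto

lemma cont_p': "continuous_on S f \<Longrightarrow> continuous_on S (\<lambda>a. p (f a))"
  using continuous_on_compose2[OF cont_p] by auto

lemma cont_Z: "open_bisection L U \<Longrightarrow> continuous_on U Z"
  unfolding continuous_on_def by (auto intro!: tendsto_zero)

text \<open>Only multiplication by a fixed scalar is continuous by axiom. Near \<open>a0\<close> the vector
  \<open>c(a) f(a)\<close> is \<open>c(a0) f(a)\<close> plus \<open>(c(a) - c(a0)) f(a)\<close>, whose norm tends to zero.\<close>

lemma cont_sc:
  assumes U: "open_bisection L U" and c: "continuous_on S c" "continuous_on S f"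
    and p: "\<And>a. a \<in> S \<Longrightarrow> p (f a) \<in> U" 
  shows "continuous_on S (\<lambda>a. sc (c a) (f a))"
  unfolding continuous_on_def
proof
  fix a0 assume a0: "a0 \<in> S"
  let ?F = "at a0 within S"
  have ev: "\<forall>\<^sub>F a in ?F. a \<in> S" by (simp add: eventually_at_filter)
  have 1: "((\<lambda>a. sc (c a0) (f a)) \<longlongrightarrow> sc (c a0) (f a0)) ?F"
    using continuous_on_compose2[OF bundleD(3)[OF U, of "c a0"] c(2)] p a0 by (auto simp: continuous_on_def)
  have "((\<lambda>a. cmod (c a - c a0) * nm (f a)) \<longlongrightarrow> cmod (c a0 - c a0) * nm (f a0)) ?F"
    using c(1) cont_nm[OF U c(2) p] a0 by (intro tendsto_intros) (auto simp: continuous_on_def)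
  moreover have "((\<lambda>a. p (f a)) \<longlongrightarrow> p (f a0)) ?F"
    using cont_p'[OF c(2)] a0 by (auto simp: continuous_on_def)
  ultimately have 2: "((\<lambda>a. sc (c a - c a0) (f a)) \<longlongrightarrow> Z (p (f a0))) ?F"
    using a0 p by (intro tendsto_zero[OF U]) auto
  have "((\<lambda>a. add (sc (c a0) (f a)) (sc (c a - c a0) (f a))) \<longlongrightarrow> add (sc (c a0) (f a0)) (Z (p (f a0)))) ?F"
    using p a0 by (intro tendsto_fadd[OF U 1 2]) (auto intro: eventually_mono[OF ev])
  then show "((\<lambda>a. sc (c a) (f a)) \<longlongrightarrow> sc (c a0) (f a0)) ?F"
    by (simp flip: sc_plus)
qed

lemma cont_mul:
  assumes "continuous_on S f" "continuous_on S f'" "\<And>a. a \<in> S \<Longrightarrow> s (p (f a)) = r (p (f' a))"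
  shows "continuous_on S (\<lambda>a. f a \<star> f' a)"
proof -
  have "continuous_on {(\<xi>, \<eta>). composable L \<xi> \<eta>} (\<lambda>(\<xi>, \<eta>). \<xi> \<star> \<eta>)"
    using fmult_axioms by (simp add: fell_multiplication_def)
  from continuous_on_compose2[OF this continuous_on_Pair[OF assms(1,2)]] show ?thesis
    using assms(3) by (auto simp: composable_def)
qed

lemma cont_adj: "continuous_on S f \<Longrightarrow> continuous_on S (\<lambda>a. adj (f a))"
proof -
  have "continuous_on UNIV adj" using fadj_axioms by (simp add: fell_adjoint_def)
  then show "continuous_on S f \<Longrightarrow> continuous_on S (\<lambda>a. adj (f a))"
    using continuous_on_compose2 by blast
qed

text \<open>At \<open>\<xi>0\<close> with coefficient \<open>c \<noteq> 0\<close>, the continuous expression \<open>\<xi> \<xi> - c \<xi>\<close> has norm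
  \<open>\<bar>coef \<xi> - c\<bar> \<parallel>\<xi>\<parallel>\<close> and vanishes at \<open>\<xi>0\<close>. Dividing by the norm of \<open>\<xi>\<close> shows that the coefficient is
  continuous there; where it vanishes, continuity of the norm suffices.\<close>

lemma cont_coef: "continuous_on (p -` X) coef"
  unfolding continuous_on_def
proof
  fix \<xi>0 assume \<xi>0: "\<xi>0 \<in> p -` X"
  let ?F = "at \<xi>0 within (p -` X)"
  have ev: "\<forall>\<^sub>F a in ?F. p a \<in> X" by (simp add: eventually_at_filter)
  have nm: "(nm \<longlongrightarrow> nm \<xi>0) ?F"
    using bundleD(4)[OF bisection_units] \<xi>0 by (auto simp: continuous_on_def)
  show "(coef \<longlongrightarrow> coef \<xi>0) ?F"
  proof (cases "coef \<xi>0 = 0")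
    case True
    then have "\<xi>0 = Z (p \<xi>0)" by (simp add: coef_eq_0_iff)
    then have "nm \<xi>0 = 0" by (simp only: nm_eq_0_iff)
    then have "((\<lambda>\<xi>. cmod (coef \<xi>)) \<longlongrightarrow> 0) ?F" using nm by (simp only: cmod_coef)
    then have "(coef \<longlongrightarrow> 0) ?F" by (rule tendsto_norm_zero_cancel)
    then show ?thesis using True by simp
  next
    case False
    define c where "c = coef \<xi>0"
    define D where "D \<xi> = add (\<xi> \<star> \<xi>) (sc (- c) \<xi>)" for \<xi>
    have "continuous_on (p -` X) D"
      unfolding D_def
      by (intro cont_add[OF bisection_units] cont_mul bundleD(3)[OF bisection_units] continuous_on_id) auto
    then have "continuous_on (p -` X) (\<lambda>\<xi>. nm (D \<xi>))"
      by (rule cont_nm[OF bisection_units]) (auto simp: D_def)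
    then have "((\<lambda>\<xi>. nm (D \<xi>)) \<longlongrightarrow> nm (D \<xi>0)) ?F"
      using \<xi>0 by (auto simp: continuous_on_def)
    moreover have nmD: "nm (D \<xi>) = cmod (coef \<xi> - c) * nm \<xi>" if "p \<xi> \<in> X" for \<xi>
    proof -
      have "coef (D \<xi>) = (coef \<xi> - c) * coef \<xi>"
        using that by (simp add: D_def coef_mul_unit algebra_simps)
      then show ?thesis by (metis cmod_coef norm_mult)
    qed
    ultimately have "((\<lambda>\<xi>. nm (D \<xi>)) \<longlongrightarrow> 0) ?F" using \<xi>0 by (simp add: c_def)
    moreover have "nm \<xi>0 \<noteq> 0" using False by (metis cmod_coef norm_eq_zero)
    ultimately have "((\<lambda>\<xi>. nm (D \<xi>) / nm \<xi>) \<longlongrightarrow> 0 / nm \<xi>0) ?F"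
      using nm by (intro tendsto_divide)
    moreover have "\<forall>\<^sub>F \<xi> in ?F. nm (D \<xi>) / nm \<xi> = cmod (coef \<xi> - c)"
      using ev tendsto_imp_eventually_ne[OF nm \<open>nm \<xi>0 \<noteq> 0\<close>]
      by eventually_elim (simp add: nmD)
    ultimately have "((\<lambda>\<xi>. cmod (coef \<xi> - c)) \<longlongrightarrow> 0) ?F"
      using tendsto_cong by fastforce
    then show ?thesis unfolding c_def using tendsto_norm_zero_iff LIM_zero_iff by blast
  qed
qed

text \<open>Multiplication by the inverse of the coefficient sends every non-zero vector over a unit to the
  identity of its fibre and is continuous. As the projection is open, the vectors near one identity
  that this map keeps near it project onto a neighbourhood of the base point.\<close>

lemma cont_un: "continuous_on X un"
  unfolding continuous_on_topological
proof (intro ballI allI impI)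
  fix x0 W0 assume x0: "x0 \<in> X" and W0: "open W0" "un x0 \<in> W0"
  define D where "D = (p -` X) \<inter> coef -` (- {0})"
  define \<Phi> where "\<Phi> \<xi> = sc (1 / coef \<xi>) \<xi>" for \<xi>
  have D: "openin (top_of_set (p -` X)) D"
    unfolding D_def by (intro continuous_openin_preimage_gen cont_coef) auto
  have "continuous_on D coef" by (rule continuous_on_subset[OF cont_coef]) (auto simp: D_def)
  then have "continuous_on D \<Phi>"
    unfolding \<Phi>_def
    by (intro cont_sc[OF bisection_units] continuous_intros) (auto simp: D_def)
  then have W: "openin (top_of_set (p -` X)) (D \<inter> \<Phi> -` W0)"
    using D W0(1) by (meson continuous_openin_preimage_gen openin_trans)
  have \<Phi>: "\<Phi> \<xi> = un (p \<xi>)" if "\<xi> \<in> D" for \<xi>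
    using that by (subst eq_iff_coef) (auto simp: D_def \<Phi>_def)
  have "openin (top_of_set X) (p ` (D \<inter> \<Phi> -` W0))"
    using bundleD(1)[OF bisection_units] W by blast
  then have "open (p ` (D \<inter> \<Phi> -` W0))" using open_units openin_open_trans by blast
  moreover have "x0 \<in> p ` (D \<inter> \<Phi> -` W0)"
  proof (rule image_eqI[of _ _ "un x0"])
    have "un x0 \<in> D" using x0 by (simp add: D_def)
    then show "un x0 \<in> D \<inter> \<Phi> -` W0" using W0 \<Phi>[of "un x0"] x0 by simp
  qed (use x0 in simp)
  moreover have "un y \<in> W0" if "y \<in> p ` (D \<inter> \<Phi> -` W0)" for y
    using that \<Phi> by force
  ultimately show "\<exists>A. open A \<and> x0 \<in> A \<and> (\<forall>y\<in>X. y \<in> A \<longrightarrow> un y \<in> W0)"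
    by blast
qed

text \<open>The axiom about zero vectors, applied to the coarsest filter along which the norm tends to zero
  and the projection tends to \<open>g\<close>, says that every neighbourhood of a zero vector contains a tube.\<close>

lemma tube:
  assumes U: "open_bisection L U" "g \<in> U" and B: "open B" "Z g \<in> B"
  obtains \<epsilon> V where "\<epsilon> > 0" "open V" "g \<in> V" "\<And>\<eta>. nm \<eta> < \<epsilon> \<Longrightarrow> p \<eta> \<in> V \<Longrightarrow> \<eta> \<in> B"
proof -
  define F where "F = inf (filtercomap nm (nhds 0)) (filtercomap p (nhds g))"
  have "(nm \<longlongrightarrow> 0) F" "(p \<longlongrightarrow> g) F"
    unfolding F_def
    by (rule filterlim_mono[OF filterlim_filtercomap order_refl inf_le1]
        filterlim_mono[OF filterlim_filtercomap order_refl inf_le2])+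
  then have "((\<lambda>\<xi>. \<xi>) \<longlongrightarrow> Z g) F" using bundleD(5)[OF U] by blast
  then have "\<forall>\<^sub>F \<xi> in F. \<xi> \<in> B" using B by (simp add: tendsto_def)
  then obtain P Q where PQ: "eventually P (filtercomap nm (nhds 0))" "eventually Q (filtercomap p (nhds g))"
    "\<And>\<xi>. P \<xi> \<Longrightarrow> Q \<xi> \<Longrightarrow> \<xi> \<in> B"
    unfolding F_def eventually_inf by blast
  obtain P' where P': "eventually P' (nhds (0::real))" "\<And>\<xi>. P' (nm \<xi>) \<Longrightarrow> P \<xi>"
    using PQ(1) unfolding eventually_filtercomap by blast
  obtain Q' where Q': "eventually Q' (nhds g)" "\<And>\<xi>. Q' (p \<xi>) \<Longrightarrow> Q \<xi>"
    using PQ(2) unfolding eventually_filtercomap by blast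
  obtain \<epsilon> where \<epsilon>: "\<epsilon> > 0" "\<And>y. dist y 0 < \<epsilon> \<Longrightarrow> P' y"
    using P'(1) unfolding eventually_nhds_metric by blast
  obtain V where V: "open V" "g \<in> V" "\<And>y. y \<in> V \<Longrightarrow> Q' y"
    using Q'(1) unfolding eventually_nhds by blast
  show ?thesis
    by (rule that[OF \<epsilon>(1) V(1,2)]) (use PQ P' Q' \<epsilon> V in simp)
qed

text \<open>The bundle is not assumed to be locally trivial, so the limit is compared with an approximating
  section by addition: \<open>f = F n + (f - F n)\<close>, where the second summand lies in a tube around the zero
  section.\<close>

lemma uniform_limit_continuous:
  assumes U: "open_bisection L U"
    and F: "\<And>n. continuous_on U (F n)" "\<And>n. sec (F n)" and f: "sec f"
    and lim: "\<And>\<epsilon>. \<epsilon> > 0 \<Longrightarrow> \<forall>\<^sub>F n in sequentially. \<forall>g. nm (fdiff L (F n g) (f g)) < \<epsilon>"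
  shows "continuous_on U f"
  unfolding continuous_on_topological
proof (intro ballI allI impI)
  fix g0 W assume g0: "g0 \<in> U" and W: "open W" "f g0 \<in> W"
  let ?D = "{(\<xi>, \<eta>). p \<xi> \<in> U \<and> p \<eta> = p \<xi>}"
  have "add (f g0) (Z g0) \<in> W" using W f by simp
  then obtain T where T: "open T" "(f g0, Z g0) \<in> T" "\<And>\<xi> \<eta>. (\<xi>, \<eta>) \<in> ?D \<Longrightarrow> (\<xi>, \<eta>) \<in> T \<Longrightarrow> add \<xi> \<eta> \<in> W"
    using bundleD(2)[OF U, unfolded continuous_on_topological, rule_format, of "(f g0, Z g0)" W] W(1) g0 f
    by (auto simp del: add_zero)
  obtain A B where AB: "open A" "open B" "f g0 \<in> A" "Z g0 \<in> B" "A \<times> B \<subseteq> T"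
    using open_prod_elim[OF T(1,2)] by (metis mem_Sigma_iff)
  obtain \<epsilon> V where V: "\<epsilon> > 0" "open V" "g0 \<in> V" "\<And>\<eta>. nm \<eta> < \<epsilon> \<Longrightarrow> p \<eta> \<in> V \<Longrightarrow> \<eta> \<in> B"
    using tube[OF U g0 AB(2,4)] by metis
  have eqn: "F n g = add (f g) (fdiff L (F n g) (f g))" for n g
    using F f by (subst eq_iff_coef) auto
  have eqn': "f g = add (F n g) (fdiff L (f g) (F n g))" for n g
    using F f by (subst eq_iff_coef) auto
  have "((\<lambda>n. fdiff L (F n g0) (f g0)) \<longlongrightarrow> Z g0) sequentially"
  proof (rule tendsto_zero[OF U g0])
    show "(\<lambda>n. nm (fdiff L (F n g0) (f g0))) \<longlonglongrightarrow> 0"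
    proof (rule tendstoI)
      fix \<epsilon> :: real assume "\<epsilon> > 0"
      from lim[OF this] show "\<forall>\<^sub>F n in sequentially. dist (nm (fdiff L (F n g0) (f g0))) 0 < \<epsilon>"
        by eventually_elim (use F f in \<open>auto simp: dist_real_def\<close>)
    qed
  qed (use F f in simp)
  then have "((\<lambda>n. add (f g0) (fdiff L (F n g0) (f g0))) \<longlongrightarrow> add (f g0) (Z g0)) sequentially"
    using F f g0 by (intro tendsto_fadd[OF U]) auto
  then have "((\<lambda>n. F n g0) \<longlongrightarrow> f g0) sequentially"
    using f by (simp flip: eqn)
  then have "\<forall>\<^sub>F n in sequentially. F n g0 \<in> A"
    using AB by (simp add: tendsto_def)
  then have "\<forall>\<^sub>F n in sequentially. F n g0 \<in> A \<and> (\<forall>g. nm (fdiff L (F n g) (f g)) < \<epsilon>)"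
    using lim[OF V(1)] by eventually_elim blast
  then obtain n where n: "F n g0 \<in> A" "\<And>g. nm (fdiff L (F n g) (f g)) < \<epsilon>"
    using eventually_happens by fastforce
  obtain N where N: "open N" "g0 \<in> N" "\<And>y. y \<in> U \<Longrightarrow> y \<in> N \<Longrightarrow> F n y \<in> A"
    using F(1)[of n] AB(1) n(1) g0 unfolding continuous_on_topological by meson
  have "f y \<in> W" if y: "y \<in> U" "y \<in> N \<inter> V" for y
  proof -
    have "nm (fdiff L (f y) (F n y)) < \<epsilon>" "p (fdiff L (f y) (F n y)) \<in> V"
      using n(2)[of y] F f y by (simp_all add: nm_fdiff norm_minus_commute)
    then have "fdiff L (f y) (F n y) \<in> B" by (rule V(4))
    then have "(F n y, fdiff L (f y) (F n y)) \<in> T" using N y AB(5) by blast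
    then have "add (F n y) (fdiff L (f y) (F n y)) \<in> W" using T(3) F f y by simp
    then show ?thesis using eqn' by simp
  qed
  then show "\<exists>A. open A \<and> g0 \<in> A \<and> (\<forall>y\<in>U. y \<in> A \<longrightarrow> f y \<in> W)"
    using N V by (intro exI[of _ "N \<inter> V"]) auto
qed

section \<open>Compactly supported sections on bisections\<close>

text \<open>A section supported in a compact subset of a bisection has compact support there, although
  compact sets may fail to be closed: the complement in the bisection is open.\<close>

lemma Cc_iff:
  assumes U: "open_bisection L U"
  shows "f \<in> Cc_on L U \<longleftrightarrow> sec f \<and> continuous_on U f \<and> (\<exists>Q. compact Q \<and> Q \<subseteq> U \<and> (\<forall>g. g \<notin> Q \<longrightarrow> f g = Z g))"
proof
  assume f: "f \<in> Cc_on L U"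
  let ?Q = "U \<inter> closure {g \<in> U. f g \<noteq> Z g}"
  have "f g = Z g" if "g \<notin> ?Q" for g
    using that f closure_subset[of "{g \<in> U. f g \<noteq> Z g}"] by (auto simp: Cc_on_def)
  then show "sec f \<and> continuous_on U f \<and> (\<exists>Q. compact Q \<and> Q \<subseteq> U \<and> (\<forall>g. g \<notin> Q \<longrightarrow> f g = Z g))"
    using f unfolding Cc_on_def bundle_sections_eq by blast
next
  assume *: "sec f \<and> continuous_on U f \<and> (\<exists>Q. compact Q \<and> Q \<subseteq> U \<and> (\<forall>g. g \<notin> Q \<longrightarrow> f g = Z g))"
  then obtain Q where Q: "compact Q" "Q \<subseteq> U" "\<And>g. g \<notin> Q \<Longrightarrow> f g = Z g" by blast
  let ?A = "{g \<in> U. f g \<noteq> Z g}"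
  have "open (U - Q)" using open_bisection_minus_compact[OF U Q(1,2)] .
  moreover have "(U - Q) \<inter> ?A = {}" using Q by auto
  ultimately have "(U - Q) \<inter> closure ?A = {}" by (simp add: open_Int_closure_eq_empty)
  then have "U \<inter> closure ?A = Q \<inter> closure ?A" using Q by blast
  moreover have "compact (Q \<inter> closure ?A)" using Q by (intro compact_Int_closed) auto
  ultimately show "f \<in> Cc_on L U"
    using * Q by (auto simp: Cc_on_def bundle_sections_eq)
qed

lemma CcE:
  assumes "open_bisection L U" "f \<in> Cc_on L U"
  obtains Q where "compact Q" "Q \<subseteq> U" "\<And>g. g \<notin> Q \<Longrightarrow> f g = Z g"
  using assms Cc_iff by metis

lemma Cc_sec: "f \<in> Cc_on L U \<Longrightarrow> sec f" and Cc_cont: "f \<in> Cc_on L U \<Longrightarrow> continuous_on U f"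
  and Cc_supp: "f \<in> Cc_on L U \<Longrightarrow> supp_in U f"
  by (auto simp: Cc_on_def bundle_sections_eq supp_in_def)

lemma CcI:
  assumes "open_bisection L U" "sec f" "continuous_on U f" "compact Q" "Q \<subseteq> U" "\<And>g. g \<notin> Q \<Longrightarrow> f g = Z g"
  shows "f \<in> Cc_on L U"
  using assms Cc_iff by blast

lemma Cc_plus:
  assumes U: "open_bisection L U" and f: "f \<in> Cc_on L U" "f' \<in> Cc_on L U"
  shows "plus_sec f f' \<in> Cc_on L U"
proof -
  obtain Q Q' where Q: "compact Q" "Q \<subseteq> U" "\<And>g. g \<notin> Q \<Longrightarrow> f g = Z g"
    "compact Q'" "Q' \<subseteq> U" "\<And>g. g \<notin> Q' \<Longrightarrow> f' g = Z g"
    using CcE[OF U f(1)] CcE[OF U f(2)] by metis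
  note s = Cc_sec[OF f(1)] Cc_sec[OF f(2)]
  show ?thesis
  proof (rule CcI[OF U])
    show "continuous_on U (plus_sec f f')"
      by (intro cont_add[OF U] Cc_cont f) (use s in auto)
    show "compact (Q \<union> Q')" using Q by blast
  qed (use Q s in auto)
qed

lemma Cc_scale:
  assumes U: "open_bisection L U" and f: "f \<in> Cc_on L U" and c: "continuous_on U c"
  shows "(\<lambda>g. sc (c g) (f g)) \<in> Cc_on L U"
proof -
  obtain Q where Q: "compact Q" "Q \<subseteq> U" "\<And>g. g \<notin> Q \<Longrightarrow> f g = Z g"
    using CcE[OF U f] by metis
  show ?thesis
  proof (rule CcI[OF U _ _ Q(1,2)])
    show "continuous_on U (\<lambda>g. sc (c g) (f g))"
      by (intro cont_sc[OF U] Cc_cont f c) (use Cc_sec[OF f] in auto)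
  qed (use Q Cc_sec[OF f] in \<open>auto simp: sec_def\<close>)
qed

lemma Cc_sc: "open_bisection L U \<Longrightarrow> f \<in> Cc_on L U \<Longrightarrow> sc_sec c f \<in> Cc_on L U"
  by (rule Cc_scale) auto

text \<open>Extension by zero to a larger bisection stays continuous, since the larger bisection is covered
  by the smaller one and the open complement of the compact support.\<close>

lemma Cc_mono:
  assumes U: "open_bisection L U" and V: "open V" "V \<subseteq> U" and f: "f \<in> Cc_on L V"
  shows "f \<in> Cc_on L U"
proof -
  have bV: "open_bisection L V" using bisection_open_subset[OF U V] .
  obtain Q where Q: "compact Q" "Q \<subseteq> V" "\<And>g. g \<notin> Q \<Longrightarrow> f g = Z g"
    using CcE[OF bV f] by metis
  have KU: "Q \<subseteq> U" using Q V by blast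
  have "continuous_on (U - Q) f"
    using continuous_on_subset[OF cont_Z[OF U], of "U - Q"] Q(3)
    by (subst continuous_on_cong[of _ "U - Q" f Z]) auto
  then have "continuous_on (V \<union> (U - Q)) f"
    using V(1) open_bisection_minus_compact[OF U Q(1) KU] Cc_cont[OF f] by (intro continuous_on_open_Un)
  moreover have "V \<union> (U - Q) = U" using V Q by blast
  ultimately show ?thesis
    using CcI[OF U Cc_sec[OF f] _ Q(1) KU Q(3)] by simp
qed

lemma Cc_star:
  assumes U: "open_bisection L U" and f: "f \<in> Cc_on L U"
  shows "star_sec f \<in> Cc_on L (gi ` U)"
proof -
  obtain Q where Q: "compact Q" "Q \<subseteq> U" "\<And>g. g \<notin> Q \<Longrightarrow> f g = Z g"
    using CcE[OF U f] by metis
  show ?thesis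
  proof (rule CcI[OF bisection_inv[OF U]])
    show "continuous_on (gi ` U) (star_sec f)"
      unfolding star_sec_def
      by (intro cont_adj continuous_on_compose2[OF Cc_cont[OF f]] cont_inv' continuous_on_id) auto
    show "compact (gi ` Q)"
      using Q(1) cont_inv by (meson compact_continuous_image continuous_on_subset subset_UNIV)
    show "star_sec f g = Z g" if "g \<notin> gi ` Q" for g
    proof -
      have "gi g \<notin> Q" using that by (metis image_eqI inv_inv)
      then show ?thesis using Q(3) by (simp add: star_sec_def)
    qed
  qed (use Q Cc_sec[OF f] in auto)
qed

text \<open>On the product of the bisections the convolution is the product of the values at the two
  factors, which depend continuously on the arrow.\<close>

lemma Cc_conv:
  assumes U: "open_bisection L U" and V: "open_bisection L V" and f: "f \<in> Cc_on L U" "f' \<in> Cc_on L V"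
  shows "conv f f' \<in> Cc_on L (set_mult U V)"
proof -
  obtain Q Q' where Q: "compact Q" "Q \<subseteq> U" "\<And>g. g \<notin> Q \<Longrightarrow> f g = Z g"
    "compact Q'" "Q' \<subseteq> V" "\<And>g. g \<notin> Q' \<Longrightarrow> f' g = Z g"
    using CcE[OF U f(1)] CcE[OF V f(2)] by metis
  note s = Cc_sec[OF f(1)] Cc_sec[OF f(2)]
  note formula = conv_bisection[OF U Cc_supp[OF f(1)] s(2)]
  show ?thesis
  proof (rule CcI[OF bisection_mult[OF U V]])
    show "sec (conv f f')" using s by (rule sec_conv)
    have sub: "set_mult U V \<subseteq> r -` r ` U" "\<And>k. k \<in> set_mult U V \<Longrightarrow> gi (lift_r U (r k)) \<cdot> k \<in> V"
      using set_mult_eq[OF U] by auto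
    have "continuous_on (set_mult U V) (\<lambda>k. f (lift_r U (r k)) \<star> f' (gi (lift_r U (r k)) \<cdot> k))"
    proof (rule cont_mul)
      show "continuous_on (set_mult U V) (\<lambda>k. f (lift_r U (r k)))"
        using sub lift_r[OF U]
        by (intro continuous_on_compose2[OF Cc_cont[OF f(1)] continuous_on_subset[OF cont_factors(1)[OF U] sub(1)]]) auto
      show "continuous_on (set_mult U V) (\<lambda>k. f' (gi (lift_r U (r k)) \<cdot> k))"
        using sub
        by (intro continuous_on_compose2[OF Cc_cont[OF f(2)] continuous_on_subset[OF cont_factors(2)[OF U] sub(1)]]) auto
      fix k assume "k \<in> set_mult U V"
      then have "r (lift_r U (r k)) = r k" using sub(1) lift_r(2)[OF U, of "r k"] by blast
      then show "s (p (f (lift_r U (r k)))) = r (p (f' (gi (lift_r U (r k)) \<cdot> k)))"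
        using s by simp
    qed
    then show "continuous_on (set_mult U V) (conv f f')"
      using sub(1) by (subst continuous_on_cong[OF refl formula]) (auto cong: continuous_on_cong_simp simp: subset_iff vimage_def)
    show "compact (set_mult Q Q')" using Q by (intro compact_set_mult)
    show "set_mult Q Q' \<subseteq> set_mult U V" using Q unfolding set_mult_def by blast
    fix g assume g: "g \<notin> set_mult Q Q'"
    show "conv f f' g = Z g"
    proof (rule ccontr)
      assume nz: "conv f f' g \<noteq> Z g"
      then have rU: "r g \<in> r ` U" using formula by metis
      define h where "h = lift_r U (r g)"
      have h: "h \<in> U" "r h = r g" using lift_r[OF U rU] by (auto simp: h_def)
      have "f h \<star> f' (gi h \<cdot> g) \<noteq> Z g" using nz formula rU by (simp add: h_def)
      then have "f h \<noteq> Z h" "f' (gi h \<cdot> g) \<noteq> Z (gi h \<cdot> g)"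
        using h s by auto
      then have "h \<in> Q" "gi h \<cdot> g \<in> Q'" using Q by blast+
      moreover have "g = h \<cdot> (gi h \<cdot> g)" "s h = r (gi h \<cdot> g)" using h by simp_all
      ultimately show False using g unfolding set_mult_def by blast
    qed
  qed
qed

lemma Cc_bounded:
  assumes U: "open_bisection L U" and f: "f \<in> Cc_on L U"
  obtains C where "\<And>g. nm (f g) \<le> C"
proof -
  obtain Q where Q: "compact Q" "Q \<subseteq> U" "\<And>g. g \<notin> Q \<Longrightarrow> f g = Z g"
    using CcE[OF U f] by metis
  have "continuous_on Q (\<lambda>g. nm (f g))"
    using Q(2) Cc_sec[OF f] by (intro cont_nm[OF U] continuous_on_subset[OF Cc_cont[OF f]]) auto
  then have "compact ((\<lambda>g. nm (f g)) ` Q)" using Q(1) by (rule compact_continuous_image)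
  then obtain C where C: "\<And>g. g \<in> Q \<Longrightarrow> \<bar>nm (f g)\<bar> \<le> C"
    using compact_imp_bounded bounded_real by (metis (no_types, lifting) imageI)
  have "nm (f g) \<le> max C 0" for g
    using C[of g] Q(3)[of g] by (cases "g \<in> Q") auto
  then show ?thesis by (rule that)
qed


section \<open>The convolution algebra\<close>

abbreviation "S \<equiv> conv_alg L"
abbreviation "C \<equiv> carrier S"

lemma alg_simps:
  "aplus S f f' = plus_sec f f'" "azero S = Z" "ascale S c f = sc_sec c f"
  "atimes S f f' = conv f f'" "astar S f = star_sec f"
  by (simp_all add: conv_alg_def section_alg_def star_sec_def fun_eq_iff)

lemma aminus_eq: "aminus S f f' g = fdiff L (f g) (f' g)"
  by (simp add: aminus_def alg_simps fdiff_def)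

lemma C_eq: "C = lin_span (section_alg L) (\<Union>U\<in>{U. open_bisection L U}. Cc_on L U)"
  by (simp add: conv_alg_def)

lemma section_alg_simps:
  "aplus (section_alg L) f f' = plus_sec f f'" "azero (section_alg L) = Z" "ascale (section_alg L) c f = sc_sec c f"
  by (simp_all add: section_alg_def)

lemma Cc_in_C: "open_bisection L U \<Longrightarrow> f \<in> Cc_on L U \<Longrightarrow> f \<in> C"
  unfolding C_eq by (rule lin_span.base) blast

lemma Z_in_C: "Z \<in> C"
  unfolding C_eq using lin_span.zero[of "section_alg L"] by (simp add: section_alg_simps)

lemma plus_in_C: "f \<in> C \<Longrightarrow> f' \<in> C \<Longrightarrow> plus_sec f f' \<in> C"
  unfolding C_eq using lin_span.plus[of f "section_alg L" _ f'] by (simp add: section_alg_simps)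

lemma sc_in_C: "f \<in> C \<Longrightarrow> sc_sec c f \<in> C"
  unfolding C_eq using lin_span.scale[of f "section_alg L" _ c] by (simp add: section_alg_simps)

lemma C_induct [consumes 1, case_names zero base plus scale]:
  assumes "f \<in> C" "P Z" "\<And>U f. open_bisection L U \<Longrightarrow> f \<in> Cc_on L U \<Longrightarrow> P f"
    "\<And>f f'. f \<in> C \<Longrightarrow> f' \<in> C \<Longrightarrow> P f \<Longrightarrow> P f' \<Longrightarrow> P (plus_sec f f')"
    "\<And>c f. f \<in> C \<Longrightarrow> P f \<Longrightarrow> P (sc_sec c f)"
  shows "P f"
  using assms(1) unfolding C_eq
proof (induction rule: lin_span.induct)
  case zero
  then show ?case using assms(2) by (simp add: section_alg_simps)
next
  case (base a)
  then show ?case using assms(3) by blast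
next
  case (plus a b)
  then show ?case using assms(4)[of a b] by (simp add: section_alg_simps C_eq)
next
  case (scale a c)
  then show ?case using assms(5)[of a c] by (simp add: section_alg_simps C_eq)
qed

lemma C_bdd_op: "f \<in> C \<Longrightarrow> bdd_op f"
proof (induction rule: C_induct)
  case zero
  have "supp_in X Z" by (simp add: supp_in_def)
  then show ?case using bdd_op_bisection(1)[OF bisection_units, of Z 0] by simp
next
  case (base U f)
  then show ?case using Cc_bounded bdd_op_bisection(1) Cc_supp by metis
qed (auto intro: bdd_op_plus bdd_op_sc)

lemma C_sec: "f \<in> C \<Longrightarrow> sec f" and C_fib_fin: "f \<in> C \<Longrightarrow> fib_fin f"
  using C_bdd_op bdd_op_sec bdd_op_fib_fin by auto

lemma conv_Z_l: "sec f \<Longrightarrow> conv Z f = Z"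
  using conv_sc_l[of Z f 0] fib_fin_Z by (auto simp: fun_eq_iff)

lemma C_conv: 
  assumes "f \<in> C" "f' \<in> C"
  shows "conv f f' \<in> C"
  using assms(1)
proof (induction rule: C_induct)
  case zero
  then show ?case using conv_Z_l C_sec assms(2) Z_in_C by simp
next
  case (base U f)
  show ?case
    using assms(2)
  proof (induction rule: C_induct)
    case zero
    then show ?case using conv_Z_r C_fib_fin Cc_in_C base Z_in_C by simp
  next
    case (base V f')
    then show ?case using \<open>f \<in> _\<close> Cc_conv bisection_mult Cc_in_C \<open>open_bisection L U\<close> by blast
  next
    case (plus f1 f2)
    then show ?case using conv_plus_r[of f f1 f2] C_fib_fin C_sec Cc_in_C base plus_in_C by simp
  next
    case (scale c f1)
    then show ?case using conv_sc_r[of f f1 c] C_fib_fin C_sec Cc_in_C base sc_in_C by simp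
  qed
next
  case (plus f1 f2)
  then show ?case using conv_plus_l[of f1 f2 f'] C_fib_fin C_sec assms(2) plus_in_C by simp
next
  case (scale c f1)
  then show ?case using conv_sc_l[of f1 f' c] C_fib_fin C_sec assms(2) sc_in_C by simp
qed

lemma star_plus: "sec f \<Longrightarrow> sec f' \<Longrightarrow> star_sec (plus_sec f f') = plus_sec (star_sec f) (star_sec f')"
  by (simp add: star_sec_def adj_add fun_eq_iff)

lemma star_sc: "star_sec (sc_sec c f) = sc_sec (cnj c) (star_sec f)"
  by (simp add: star_sec_def fun_eq_iff)

lemma star_Z [simp]: "star_sec Z = Z"
  by (simp add: star_sec_def fun_eq_iff)

lemma C_star: "f \<in> C \<Longrightarrow> star_sec f \<in> C"
proof (induction rule: C_induct)
  case zero
  then show ?case using Z_in_C by simp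
next
  case (base U f)
  then show ?case using Cc_star bisection_inv Cc_in_C by blast
next
  case (plus f f')
  then show ?case using star_plus[of f f'] C_sec plus_in_C by simp
next
  case (scale c f)
  then show ?case using star_sc sc_in_C by simp
qed

lemma cstar_normI:
  assumes "\<And>f. f \<in> C \<Longrightarrow> 0 \<le> \<nu> f" "\<And>f. f \<in> C \<Longrightarrow> \<nu> f = 0 \<longleftrightarrow> f = Z"
    "\<And>f f'. f \<in> C \<Longrightarrow> f' \<in> C \<Longrightarrow> \<nu> (plus_sec f f') \<le> \<nu> f + \<nu> f'"
    "\<And>c f. f \<in> C \<Longrightarrow> \<nu> (sc_sec c f) = cmod c * \<nu> f"
    "\<And>f f'. f \<in> C \<Longrightarrow> f' \<in> C \<Longrightarrow> \<nu> (conv f f') \<le> \<nu> f * \<nu> f'"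
    "\<And>f. f \<in> C \<Longrightarrow> \<nu> (conv (star_sec f) f) = (\<nu> f)\<^sup>2"
  shows "cstar_norm S \<nu>"
  unfolding cstar_norm_def alg_simps using assms by blast

lemma cstar_normD:
  assumes "cstar_norm S \<nu>"
  shows "f \<in> C \<Longrightarrow> 0 \<le> \<nu> f" "f \<in> C \<Longrightarrow> \<nu> f = 0 \<longleftrightarrow> f = Z"
    "f \<in> C \<Longrightarrow> f' \<in> C \<Longrightarrow> \<nu> (plus_sec f f') \<le> \<nu> f + \<nu> f'"
    "f \<in> C \<Longrightarrow> \<nu> (sc_sec c f) = cmod c * \<nu> f"
    "f \<in> C \<Longrightarrow> f' \<in> C \<Longrightarrow> \<nu> (conv f f') \<le> \<nu> f * \<nu> f'"
    "f \<in> C \<Longrightarrow> \<nu> (conv (star_sec f) f) = (\<nu> f)\<^sup>2"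
  using assms unfolding cstar_norm_def alg_simps by blast+

theorem red_cstar_norm: "cstar_norm S (red_norm L)"
proof (rule cstar_normI)
  show "red_norm L f = 0 \<longleftrightarrow> f = Z" if "f \<in> C" for f
    by (rule red_eq_0_iff[OF C_bdd_op[OF that]])
qed (intro red_nonneg red_triangle red_sc red_conv red_cstar C_bdd_op C_conv C_star; assumption)+

section \<open>C*-norms are dominated by the uniform norm on bisections\<close>

text \<open>Functions on the unit space act by multiplication: on the left through the range, and on the
  right through the source (\<open>conv_unit_r\<close>).\<close>

lemma conv_unit_l:
  assumes "supp_in X k" "sec f"
  shows "conv k f g = sc (coef (k (r g))) (f g)"
proof -
  have sk: "sec k" using assms by (simp add: supp_in_def)
  have "r g \<in> r ` X" by (metis image_eqI r_in r_r)
  moreover have "lift_r X (r g) = r g" using lift_r_eq[OF bisection_units, of "r g"] by simp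
  ultimately have "conv k f g = k (r g) \<star> f g"
    using conv_bisection[OF bisection_units assms, of g] by simp
  then show ?thesis using sk assms(2) by (simp add: mul_unit_l)
qed

lemma conv_unit_r:
  assumes U: "open_bisection L U" "supp_in U f" and a: "supp_in X a"
  shows "conv f a g = sc (coef (a (s g))) (f g)"
proof (cases "r g \<in> r ` U")
  case True
  have sf: "sec f" "sec a" using assms by (auto simp: supp_in_def)
  define h where "h = lift_r U (r g)"
  have h: "h \<in> U" "r h = r g" using lift_r[OF U(1) True] by (auto simp: h_def)
  have c: "conv f a g = f h \<star> a (gi h \<cdot> g)"
    using True by (simp add: conv_bisection[OF U sf(2)] h_def)
  show ?thesis
  proof (cases "g \<in> U")
    case True
    then have "h = g" using h r_bisection_eq[OF U(1)] by blast
    then show ?thesis using c sf by (simp add: mul_unit_r)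
  next
    case False
    have "gi h \<cdot> g \<notin> X"
    proof
      assume "gi h \<cdot> g \<in> X"
      then have "gi h \<cdot> g = s h" using h by (metis r_inv r_mult r_unit s_inv)
      then have "g = h" using h cancel_l[of g h] by simp
      then show False using False h by simp
    qed
    then show ?thesis using a False U c h sf by (simp add: supp_in_def)
  qed
next
  case False
  then have "g \<notin> U" by blast
  then show ?thesis using False U a conv_bisection[OF U, of a g] by (simp add: supp_in_def)
qed

lemma inv_image_units [simp]: "gi ` X = X"
  by (auto simp: image_iff)

lemma Cc_star_units: "k \<in> Cc_on L X \<Longrightarrow> star_sec k \<in> Cc_on L X"
  using Cc_star[OF bisection_units] by simp

lemma Cc_off: "f \<in> Cc_on L U \<Longrightarrow> g \<notin> U \<Longrightarrow> f g = Z g"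
  using Cc_supp by (auto simp: supp_in_def)

lemma conv_star_units:
  assumes k: "k \<in> Cc_on L X"
  shows "conv (star_sec k) k g = sc (cnj (coef (k (r g)))) (k g)"
proof -
  have "coef (star_sec k (r g)) = cnj (coef (k (r g)))"
    using Cc_sec[OF k] by (simp add: star_sec_def coef_adj_unit)
  then show ?thesis
    using conv_unit_l[OF Cc_supp[OF Cc_star_units[OF k]] Cc_sec[OF k]] by simp
qed

text \<open>For the function \<open>t = \<parallel>k\<parallel>\<close> on the unit space take \<open>w = t + i \<surd>(1 - t\<^sup>2)\<close>, of modulus one. The
  \<open>C*\<close>-identity shows that \<open>w k\<close> has the norm of \<open>k\<close>, because \<open>(w k)* (w k) = k* k\<close>, and so has \<open>k\<close>
  multiplied by the conjugate of \<open>w\<close>. Their mean is \<open>t k = k* k\<close>, so \<open>\<nu>(k)\<^sup>2 = \<nu>(t k) \<le> \<nu>(k)\<close>.\<close>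

lemma cstar_le_aux:
  assumes \<nu>: "cstar_norm S \<nu>" and k: "k \<in> Cc_on L X"
    and pos: "\<And>x. x \<in> X \<Longrightarrow> k x = sc (of_real (nm (k x))) (un x)" and le: "\<And>x. nm (k x) \<le> 1"
  shows "\<nu> k \<le> 1"
proof -
  note bX = bisection_units
  define t where "t x = nm (k x)" for x
  have ct: "continuous_on X t"
    unfolding t_def using Cc_sec[OF k] by (intro cont_nm[OF bX] Cc_cont k) auto
  define w where "w x = Complex (t x) (sqrt (1 - (t x)\<^sup>2))" for x
  have cw: "continuous_on X w"
    unfolding w_def Complex_eq by (intro continuous_intros ct)
  have w1: "cnj (w x) * w x = 1" for x
  proof -
    have "(t x)\<^sup>2 \<le> 1" using le by (simp add: t_def power_le_one)
    then show ?thesis by (simp add: w_def complex_eq_iff power2_eq_square)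
  qed
  have unitary: "\<nu> (\<lambda>g. sc (u g) (k g)) = \<nu> k" if u: "continuous_on X u" "\<And>x. cnj (u x) * u x = 1" for u
  proof -
    let ?k = "\<lambda>g. sc (u g) (k g)"
    have k': "?k \<in> Cc_on L X" by (rule Cc_scale[OF bX k u(1)])
    have "conv (star_sec ?k) ?k = conv (star_sec k) k"
    proof
      fix g
      show "conv (star_sec ?k) ?k g = conv (star_sec k) k g"
      proof (cases "g \<in> X")
        case True
        have "cnj (u g) * cnj (coef (k g)) * u g = cnj (coef (k g)) * (cnj (u g) * u g)" by (simp only: mult_ac)
        also have "\<dots> = cnj (coef (k g))" by (simp add: u(2))
        finally show ?thesis
          unfolding conv_star_units[OF k] conv_star_units[OF k']
          by (simp only: r_unit[OF True] coef_sc complex_cnj_mult sc_sc)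
      next
        case False
        then show ?thesis
          unfolding conv_star_units[OF k] conv_star_units[OF k'] using Cc_off[OF k] by simp
      qed
    qed
    then have "(\<nu> ?k)\<^sup>2 = (\<nu> k)\<^sup>2"
      using cstar_normD(6)[OF \<nu>] Cc_in_C[OF bX] k k' by metis
    then show ?thesis
      using cstar_normD(1)[OF \<nu>] Cc_in_C[OF bX] k k' by (simp add: power2_eq_iff_nonneg)
  qed
  let ?tk = "\<lambda>g. sc (of_real (t g)) (k g)"
  have tk: "?tk \<in> Cc_on L X"
    by (rule Cc_scale[OF bX k]) (intro continuous_intros ct)
  let ?w1 = "\<lambda>g. sc (w g) (k g)" and ?w2 = "\<lambda>g. sc (cnj (w g)) (k g)"
  have cw2: "continuous_on X (\<lambda>g. cnj (w g))" by (intro continuous_intros cw)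
  have w12: "?w1 \<in> C" "?w2 \<in> C"
    by (intro Cc_in_C[OF bX] Cc_scale[OF bX k] cw cw2)+
  have "plus_sec ?w1 ?w2 = sc_sec 2 ?tk"
  proof
    fix g
    have "w g + cnj (w g) = 2 * of_real (t g)"
      by (simp add: complex_eq_iff w_def)
    then show "plus_sec ?w1 ?w2 g = sc_sec 2 ?tk g" by (simp flip: sc_plus)
  qed
  then have "2 * \<nu> ?tk \<le> \<nu> ?w1 + \<nu> ?w2"
    using cstar_normD(3)[OF \<nu> w12] cstar_normD(4)[OF \<nu> Cc_in_C[OF bX tk], of 2] by simp
  also have "\<dots> = 2 * \<nu> k"
    using unitary[OF cw w1] unitary[OF cw2] w1 by (simp add: mult.commute)
  finally have le1: "\<nu> ?tk \<le> \<nu> k" by simp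
  have "conv (star_sec k) k = ?tk"
  proof
    fix g
    show "conv (star_sec k) k g = ?tk g"
    proof (cases "g \<in> X")
      case True
      then have "coef (k g) = of_real (t g)" using pos[OF True] by (metis coef_sc_e e_unit t_def)
      then show ?thesis unfolding conv_star_units[OF k] using True by simp
    next
      case False
      then show ?thesis unfolding conv_star_units[OF k] using Cc_off[OF k] by simp
    qed
  qed
  then have "\<nu> k * \<nu> k \<le> 1 * \<nu> k"
    using le1 cstar_normD(6)[OF \<nu> Cc_in_C[OF bX k]] by (simp add: power2_eq_square)
  then show ?thesis
    using cstar_normD(1)[OF \<nu> Cc_in_C[OF bX k]] by (cases "\<nu> k = 0") auto
qed

lemma set_mult_inv: 
  assumes "open_bisection L U"
  shows "set_mult (gi ` U) U = s ` U"
proof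
  show "set_mult (gi ` U) U \<subseteq> s ` U"
    unfolding set_mult_def using r_bisection_eq[OF assms] by (auto) (metis image_eqI inv_l)
  show "s ` U \<subseteq> set_mult (gi ` U) U"
    unfolding set_mult_def by (auto intro!: exI) 
qed

text \<open>Over a source \<open>s h\<close> with \<open>h\<close> in the bisection only the factorization through \<open>h\<close> contributes.\<close>

lemma star_conv_apply:
  assumes U: "open_bisection L U" and f: "supp_in U f" and h: "h \<in> U"
  shows "conv (star_sec f) f (s h) = sc (of_real ((nm (f h))\<^sup>2)) (un (s h))"
proof -
  have sf: "sec f" using f by (simp add: supp_in_def)
  have supp: "supp_in (gi ` U) (star_sec f)"
    unfolding supp_in_def
  proof (intro conjI allI impI)
    fix g assume "g \<notin> gi ` U"
    then have "gi g \<notin> U" by (metis image_eqI inv_inv)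
    then show "star_sec f g = Z g" using f by (simp add: star_sec_def supp_in_def)
  qed (use sf in simp)
  have "conv (star_sec f) f (gi h \<cdot> h) = star_sec f (gi h) \<star> f h"
    using conv_bisection_apply[OF bisection_inv[OF U] supp sf, of "gi h" h] h by simp
  then show ?thesis using sf by (simp add: star_sec_def adj_mul_self)
qed

lemma star_conv_Cc:
  assumes U: "open_bisection L U" and f: "f \<in> Cc_on L U"
  shows "conv (star_sec f) f \<in> Cc_on L X" "conv (star_sec f) f \<in> Cc_on L (s ` U)"
proof -
  have "conv (star_sec f) f \<in> Cc_on L (set_mult (gi ` U) U)"
    by (intro Cc_conv bisection_inv Cc_star U f)
  then show 1: "conv (star_sec f) f \<in> Cc_on L (s ` U)" by (simp add: set_mult_inv[OF U])
  show "conv (star_sec f) f \<in> Cc_on L X"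
    by (rule Cc_mono[OF bisection_units _ _ 1]) (auto intro: open_s_image bisectionD[OF U])
qed

text \<open>By the \<open>C*\<close>-identity it suffices to bound \<open>f* f\<close>, a non-negative function on the unit space.\<close>

lemma cstar_le_1:
  assumes \<nu>: "cstar_norm S \<nu>" and U: "open_bisection L U" and f: "f \<in> Cc_on L U"
    and le: "\<And>g. nm (f g) \<le> 1"
  shows "\<nu> f \<le> 1"
proof -
  let ?k = "conv (star_sec f) f"
  note k = star_conv_Cc[OF U f]
  have *: "?k x = sc (of_real (nm (?k x))) (un x) \<and> nm (?k x) \<le> 1" if x: "x \<in> X" for x
  proof (cases "x \<in> s ` U")
    case True
    then obtain h where h: "h \<in> U" "x = s h" by blast
    show ?thesis using star_conv_apply[OF U Cc_supp[OF f] h(1)] h le[of h] by (simp add: power_le_one norm_power)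
  next
    case False
    then show ?thesis using Cc_off[OF k(2)] x by simp
  qed
  have "nm (?k g) \<le> 1" for g using *[of g] Cc_off[OF k(1), of g] by (cases "g \<in> X") auto
  then have "\<nu> ?k \<le> 1" using * by (intro cstar_le_aux[OF \<nu> k(1)]) auto
  then have "(\<nu> f)\<^sup>2 \<le> 1" using cstar_normD(6)[OF \<nu> Cc_in_C[OF U f]] by simp
  then show ?thesis using abs_le_square_iff[of "\<nu> f" 1] by simp
qed

theorem cstar_le:
  assumes \<nu>: "cstar_norm S \<nu>" and U: "open_bisection L U" and f: "f \<in> Cc_on L U"
    and le: "\<And>g. nm (f g) \<le> c"
  shows "\<nu> f \<le> c"
proof (cases "c = 0")
  case True
  then have "f g = Z g" for g
    using le[of g] nm_nonneg[of "f g"] nm_eq_0_iff[of "f g"] Cc_sec[OF f] by (simp add: order_antisym)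
  then have "f = Z" by blast
  then show ?thesis using cstar_normD(2)[OF \<nu> Cc_in_C[OF U f]] True by simp
next
  case False
  then have c: "c > 0" using le nm_nonneg order_trans by (metis less_eq_real_def)
  have "\<nu> (sc_sec (of_real (1 / c)) f) \<le> 1"
  proof (rule cstar_le_1[OF \<nu> U Cc_sc[OF U f]])
    fix g show "nm (sc (of_real (1 / c)) (f g)) \<le> 1"
      using le[of g] c by (simp add: norm_divide)
  qed
  then have "1 / c * \<nu> f \<le> 1"
    using cstar_normD(4)[OF \<nu> Cc_in_C[OF U f], of "of_real (1/c)"] c by (simp add: norm_divide)
  then show ?thesis using c by (simp add: field_simps)
qed

section \<open>The full norm\<close>

lemma full_bdd: 
  assumes "f \<in> C"
  shows "\<exists>B. \<forall>\<nu>. cstar_norm S \<nu> \<longrightarrow> \<nu> f \<le> B"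
  using assms
proof (induction rule: C_induct)
  case zero
  then show ?case using cstar_normD(2) Z_in_C by (metis order_refl)
next
  case (base U f)
  obtain B where "\<And>g. nm (f g) \<le> B" using Cc_bounded[OF base] by metis
  then show ?case using cstar_le base by blast
next
  case (plus f f')
  then obtain B B' where B: "\<And>\<nu>. cstar_norm S \<nu> \<Longrightarrow> \<nu> f \<le> B" "\<And>\<nu>. cstar_norm S \<nu> \<Longrightarrow> \<nu> f' \<le> B'" by blast
  have "\<nu> (plus_sec f f') \<le> B + B'" if "cstar_norm S \<nu>" for \<nu>
    using cstar_normD(3)[OF that plus(1,2)] B[OF that] by linarith
  then show ?case by blast
next
  case (scale c f)
  then obtain B where B: "\<And>\<nu>. cstar_norm S \<nu> \<Longrightarrow> \<nu> f \<le> B" by blast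
  have "\<nu> (sc_sec c f) \<le> cmod c * B" if "cstar_norm S \<nu>" for \<nu>
    using cstar_normD(4)[OF that scale(1)] B[OF that] by (simp add: mult_left_mono)
  then show ?case by blast
qed

lemma full_ge: 
  assumes "cstar_norm S \<nu>" "f \<in> C"
  shows "\<nu> f \<le> full_norm L f"
  unfolding full_norm_def largest_cstar_norm_def
proof (rule cSup_upper)
  show "bdd_above {\<nu> f |\<nu>. cstar_norm S \<nu>}" using full_bdd[OF assms(2)] by (auto simp: bdd_above_def)
qed (use assms in blast)

lemma full_le: "(\<And>\<nu>. cstar_norm S \<nu> \<Longrightarrow> \<nu> f \<le> B) \<Longrightarrow> full_norm L f \<le> B"
  unfolding full_norm_def largest_cstar_norm_def
  by (rule cSup_least) (use red_cstar_norm in blast)+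

lemma red_le_full: "f \<in> C \<Longrightarrow> red_norm L f \<le> full_norm L f"
  using full_ge red_cstar_norm by blast

lemma full_nonneg: "f \<in> C \<Longrightarrow> 0 \<le> full_norm L f"
  using red_le_full cstar_normD(1)[OF red_cstar_norm] order_trans by blast

text \<open>A pointwise supremum of \<open>C*\<close>-norms inherits all axioms once it is finite; it is definite because
  the reduced norm is one of them.\<close>

theorem full_cstar_norm: "cstar_norm S (full_norm L)"
proof (rule cstar_normI)
  fix f assume f: "f \<in> C"
  show "0 \<le> full_norm L f" using full_nonneg[OF f] .
  have "full_norm L Z \<le> 0" by (rule full_le) (use cstar_normD(2) Z_in_C in fastforce)
  then show "full_norm L f = 0 \<longleftrightarrow> f = Z"
    using cstar_normD(1,2)[OF red_cstar_norm f] red_le_full[OF f] full_nonneg[OF f] by force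
  have le: "full_norm L (sc_sec c f) \<le> cmod c * full_norm L f" if "f \<in> C" for c f
  proof (rule full_le)
    fix \<nu> assume "cstar_norm S \<nu>"
    then show "\<nu> (sc_sec c f) \<le> cmod c * full_norm L f"
      using cstar_normD(4)[of \<nu> f] full_ge[of \<nu> f] that by (simp add: mult_left_mono)
  qed
  show "full_norm L (sc_sec c f) = cmod c * full_norm L f" for c
  proof (cases "c = 0")
    case True
    then show ?thesis using le[OF f, of c] full_nonneg[OF sc_in_C[OF f, of c]] by simp
  next
    case False
    then have "full_norm L f \<le> cmod (1 / c) * full_norm L (sc_sec c f)"
      using le[OF sc_in_C[OF f, of c], of "1 / c"] by simp
    then show ?thesis using le[OF f, of c] False by (simp add: norm_divide field_simps)
  qed
  show "full_norm L (conv (star_sec f) f) = (full_norm L f)\<^sup>2"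
  proof (rule antisym)
    show "full_norm L (conv (star_sec f) f) \<le> (full_norm L f)\<^sup>2"
    proof (rule full_le)
      fix \<nu> assume \<nu>: "cstar_norm S \<nu>"
      show "\<nu> (conv (star_sec f) f) \<le> (full_norm L f)\<^sup>2"
        unfolding cstar_normD(6)[OF \<nu> f] using full_ge[OF \<nu> f] cstar_normD(1)[OF \<nu> f] by (rule power_mono)
    qed
    have "full_norm L f \<le> sqrt (full_norm L (conv (star_sec f) f))"
    proof (rule full_le)
      fix \<nu> assume \<nu>: "cstar_norm S \<nu>"
      have "(\<nu> f)\<^sup>2 \<le> full_norm L (conv (star_sec f) f)"
        using full_ge[OF \<nu> C_conv[OF C_star[OF f] f]] cstar_normD(6)[OF \<nu> f] by simp
      then show "\<nu> f \<le> sqrt (full_norm L (conv (star_sec f) f))" by (rule real_le_rsqrt)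
    qed
    then have "(full_norm L f)\<^sup>2 \<le> (sqrt (full_norm L (conv (star_sec f) f)))\<^sup>2"
      using full_nonneg[OF f] by (rule power_mono)
    then show "(full_norm L f)\<^sup>2 \<le> full_norm L (conv (star_sec f) f)"
      using full_nonneg[OF C_conv[OF C_star[OF f] f]] by simp
  qed
next
  fix f f' assume f: "f \<in> C" "f' \<in> C"
  show "full_norm L (plus_sec f f') \<le> full_norm L f + full_norm L f'"
  proof (rule full_le)
    fix \<nu> assume \<nu>: "cstar_norm S \<nu>"
    show "\<nu> (plus_sec f f') \<le> full_norm L f + full_norm L f'"
      using cstar_normD(3)[OF \<nu> f] full_ge[OF \<nu> f(1)] full_ge[OF \<nu> f(2)] by linarith
  qed
  show "full_norm L (conv f f') \<le> full_norm L f * full_norm L f'"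
  proof (rule full_le)
    fix \<nu> assume \<nu>: "cstar_norm S \<nu>"
    have "\<nu> (conv f f') \<le> \<nu> f * \<nu> f'" using cstar_normD(5)[OF \<nu> f] .
    also have "\<dots> \<le> full_norm L f * full_norm L f'"
      by (intro mult_mono full_ge \<nu> f full_nonneg cstar_normD(1)[OF \<nu>])
    finally show "\<nu> (conv f f') \<le> full_norm L f * full_norm L f'" .
  qed
qed

end

section \<open>Completion in a C*-norm\<close>

context fell
begin

definition ev :: "'g \<Rightarrow> (nat \<Rightarrow> 'g \<Rightarrow> 'l) \<Rightarrow> complex" where
  "ev g F = lim (\<lambda>n. coef (F n g))"

end

text \<open>The two completions differ only in the norm. What their treatment uses is that the norm
  dominates the values of a section, which holds for every \<open>C*\<close>-norm above the reduced one.\<close>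

locale fell_norm = fell L
  for L :: "('g::topological_space, 'l::topological_space) fell_bundle" +
  fixes \<nu> :: "('g \<Rightarrow> 'l) \<Rightarrow> real"
  assumes cstar: "cstar_norm (conv_alg L) \<nu>"
    and dominates: "f \<in> carrier (conv_alg L) \<Longrightarrow> fnorm L (f g) \<le> \<nu> f"
begin

lemmas \<nu>D = cstar_normD[OF cstar]

abbreviation "minus_sec f f' \<equiv> (\<lambda>g. fdiff L (f g) (f' g))"

lemma aminus_S: "aminus S f f' = minus_sec f f'"
  by (rule ext) (rule aminus_eq)

lemma minus_eq: "minus_sec f f' = plus_sec f (sc_sec (- 1) f')"
  by (simp add: fdiff_def)

lemma minus_in_C: "f \<in> C \<Longrightarrow> f' \<in> C \<Longrightarrow> minus_sec f f' \<in> C"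
  unfolding minus_eq by (intro plus_in_C sc_in_C)

lemma sec_eqI: "sec f \<Longrightarrow> sec f' \<Longrightarrow> (\<And>g. coef (f g) = coef (f' g)) \<Longrightarrow> f = f'"
  by (rule ext) (simp add: eq_iff_coef)

lemma sec_minus [simp]: "sec f \<Longrightarrow> sec f' \<Longrightarrow> sec (minus_sec f f')"
  by (simp add: sec_def)

definition d :: "('g \<Rightarrow> 'l) \<Rightarrow> ('g \<Rightarrow> 'l) \<Rightarrow> real" where
  "d f f' = \<nu> (minus_sec f f')"

lemma d_nonneg: "f \<in> C \<Longrightarrow> f' \<in> C \<Longrightarrow> 0 \<le> d f f'"
  unfolding d_def by (intro \<nu>D minus_in_C)

lemma \<nu>_plus: "f \<in> C \<Longrightarrow> f' \<in> C \<Longrightarrow> \<nu> (plus_sec f f') \<le> \<nu> f + \<nu> f'"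
  by (rule \<nu>D)

lemma d_self: "f \<in> C \<Longrightarrow> d f f = 0"
proof -
  assume f: "f \<in> C"
  then have "minus_sec f f = Z" by (intro sec_eqI) (auto simp: C_sec)
  then show ?thesis using \<nu>D(2)[OF Z_in_C] by (simp add: d_def)
qed

lemma d_sym: "f \<in> C \<Longrightarrow> f' \<in> C \<Longrightarrow> d f f' = d f' f"
proof -
  assume f: "f \<in> C" "f' \<in> C"
  then have "minus_sec f f' = sc_sec (- 1) (minus_sec f' f)"
    by (intro sec_eqI) (auto simp: C_sec)
  then show ?thesis using \<nu>D(4)[OF minus_in_C[OF f(2,1)], of "-1"] by (simp add: d_def)
qed

lemma d_triangle: "f \<in> C \<Longrightarrow> f' \<in> C \<Longrightarrow> f'' \<in> C \<Longrightarrow> d f f'' \<le> d f f' + d f' f''"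
proof -
  assume f: "f \<in> C" "f' \<in> C" "f'' \<in> C"
  then have "minus_sec f f'' = plus_sec (minus_sec f f') (minus_sec f' f'')"
    by (intro sec_eqI) (auto simp: C_sec)
  then show ?thesis using \<nu>_plus[OF minus_in_C[OF f(1,2)] minus_in_C[OF f(2,3)]] by (simp add: d_def)
qed

lemma d_plus: 
  assumes "f \<in> C" "f' \<in> C" "h \<in> C" "h' \<in> C"
  shows "d (plus_sec f h) (plus_sec f' h') \<le> d f f' + d h h'"
proof -
  have "minus_sec (plus_sec f h) (plus_sec f' h') = plus_sec (minus_sec f f') (minus_sec h h')"
    using assms by (intro sec_eqI) (auto simp: C_sec)
  then show ?thesis using \<nu>_plus[OF minus_in_C[OF assms(1,2)] minus_in_C[OF assms(3,4)]] by (simp add: d_def)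
qed

lemma d_sc: 
  assumes "f \<in> C" "f' \<in> C"
  shows "d (sc_sec c f) (sc_sec c f') = cmod c * d f f'"
proof -
  have "minus_sec (sc_sec c f) (sc_sec c f') = sc_sec c (minus_sec f f')"
    using assms by (intro sec_eqI) (auto simp: C_sec algebra_simps)
  then show ?thesis using \<nu>D(4)[OF minus_in_C[OF assms]] by (simp add: d_def)
qed

lemma \<nu>_le_star: "f \<in> C \<Longrightarrow> \<nu> f \<le> \<nu> (star_sec f)"
proof -
  assume f: "f \<in> C"
  have "\<nu> f * \<nu> f \<le> \<nu> (star_sec f) * \<nu> f"
    using \<nu>D(6)[OF f] \<nu>D(5)[OF C_star[OF f] f] by (simp add: power2_eq_square)
  then show ?thesis using \<nu>D(1)[OF f] \<nu>D(1)[OF C_star[OF f]] by (cases "\<nu> f = 0") auto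
qed

lemma \<nu>_star: "f \<in> C \<Longrightarrow> \<nu> (star_sec f) = \<nu> f"
  using \<nu>_le_star[of f] \<nu>_le_star[OF C_star, of f] by simp

lemma d_star: 
  assumes "f \<in> C" "f' \<in> C"
  shows "d (star_sec f) (star_sec f') = d f f'"
proof -
  have "minus_sec (star_sec f) (star_sec f') = star_sec (minus_sec f f')"
    unfolding minus_eq using assms by (simp add: star_plus star_sc C_sec)
  then show ?thesis using \<nu>_star[OF minus_in_C[OF assms]] by (simp add: d_def)
qed

lemma d_conv:
  assumes "f \<in> C" "f' \<in> C" "h \<in> C" "h' \<in> C"
  shows "d (conv f h) (conv f' h') \<le> \<nu> f * d h h' + d f f' * \<nu> h'"
proof -
  have "conv f (minus_sec h h') = minus_sec (conv f h) (conv f h')"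
    unfolding minus_eq using assms by (simp add: conv_plus_r conv_sc_r C_sec C_fib_fin)
  moreover have "conv (minus_sec f f') h' = minus_sec (conv f h') (conv f' h')"
    unfolding minus_eq using assms by (simp add: conv_plus_l conv_sc_l C_sec C_fib_fin fib_fin_sc)
  ultimately have "d (conv f h) (conv f h') \<le> \<nu> f * d h h'" "d (conv f h') (conv f' h') \<le> d f f' * \<nu> h'"
    using \<nu>D(5)[OF assms(1) minus_in_C[OF assms(3,4)]] \<nu>D(5)[OF minus_in_C[OF assms(1,2)] assms(4)]
    by (simp_all add: d_def)
  then show ?thesis
    using d_triangle[OF C_conv[OF assms(1,3)] C_conv[OF assms(1,4)] C_conv[OF assms(2,4)]] by linarith
qed

lemma \<nu>_diff: 
  assumes "f \<in> C" "f' \<in> C"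
  shows "\<bar>\<nu> f - \<nu> f'\<bar> \<le> d f f'"
proof -
  have *: "\<nu> f \<le> \<nu> f' + d f f'" if "f \<in> C" "f' \<in> C" for f f'
  proof -
    have "f = plus_sec f' (minus_sec f f')" using that by (intro sec_eqI) (auto simp: C_sec)
    then show ?thesis using \<nu>_plus[OF that(2) minus_in_C[OF that]] by (simp add: d_def)
  qed
  show ?thesis using *[OF assms] *[OF assms(2,1)] d_sym[OF assms] by simp
qed

abbreviation "CS \<equiv> cauchy_seqs S \<nu>"
definition "cls F = cauchy_rel S \<nu> `` {F}"

lemma CS_iff: "F \<in> CS \<longleftrightarrow> (\<forall>n. F n \<in> C) \<and> (\<forall>\<epsilon>>0. \<exists>N. \<forall>m\<ge>N. \<forall>n\<ge>N. d (F m) (F n) < \<epsilon>)"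
  by (simp add: cauchy_seqs_def aminus_S d_def)

lemma CS_C: "F \<in> CS \<Longrightarrow> F n \<in> C"
  by (simp add: CS_iff)

lemma CS_const: "f \<in> C \<Longrightarrow> (\<lambda>_. f) \<in> CS"
  by (simp add: CS_iff d_self)

lemma CS_bounded:
  assumes "F \<in> CS"
  obtains M where "\<And>n. \<nu> (F n) \<le> M" "M > 0"
proof -
  obtain N where N: "\<And>m n. m \<ge> N \<Longrightarrow> n \<ge> N \<Longrightarrow> d (F m) (F n) < 1"
    using assms unfolding CS_iff by (metis zero_less_one)
  define M where "M = Max ((\<lambda>n. \<nu> (F n)) ` {..N}) + 1"
  have le: "\<nu> (F n) \<le> M - 1" if "n \<le> N" for n
    using that by (auto simp: M_def)
  have "\<nu> (F n) \<le> M" for n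
  proof (cases "n \<le> N")
    case True
    then show ?thesis using le by fastforce
  next
    case False
    then have "d (F n) (F N) < 1" using N by simp
    then show ?thesis using \<nu>_diff[OF CS_C[OF assms] CS_C[OF assms], of n N] le[of N] by simp
  qed
  moreover have "M > 0" using le[of 0] \<nu>D(1)[OF CS_C[OF assms, of 0]] by simp
  ultimately show ?thesis using that by blast
qed

text \<open>Sums and products are Lipschitz on bounded sets. This lemma turns that into the Cauchy property,
  and \<open>cls_controlled\<close> turns it into well-definedness on the completion.\<close>

lemma CS_controlled:
  assumes "F \<in> CS" "H \<in> CS" "M > 0" and G: "\<And>n. G n \<in> C"
    and le: "\<And>m n. d (G m) (G n) \<le> M * (d (F m) (F n) + d (H m) (H n))"
  shows "G \<in> CS"
  unfolding CS_iff
proof (intro conjI allI impI G)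
  fix \<epsilon> :: real assume "\<epsilon> > 0"
  then have "\<epsilon> / (2 * M) > 0" using assms(3) by simp
  then obtain N N' where N: "\<And>m n. m \<ge> N \<Longrightarrow> n \<ge> N \<Longrightarrow> d (F m) (F n) < \<epsilon> / (2 * M)"
    "\<And>m n. m \<ge> N' \<Longrightarrow> n \<ge> N' \<Longrightarrow> d (H m) (H n) < \<epsilon> / (2 * M)"
    using assms(1,2) unfolding CS_iff by meson
  show "\<exists>N. \<forall>m\<ge>N. \<forall>n\<ge>N. d (G m) (G n) < \<epsilon>"
  proof (intro exI[of _ "max N N'"] allI impI)
    fix m n assume "m \<ge> max N N'" "n \<ge> max N N'"
    then have "d (F m) (F n) + d (H m) (H n) < \<epsilon> / (2 * M) + \<epsilon> / (2 * M)"
      using N by (intro add_strict_mono) auto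
    also have "\<dots> = \<epsilon> / M" by (simp add: field_simps)
    finally have "M * (d (F m) (F n) + d (H m) (H n)) < \<epsilon>" using assms(3) by (simp add: field_simps)
    then show "d (G m) (G n) < \<epsilon>" using le[of m n] by linarith
  qed
qed

lemma CS_plus:
  assumes "F \<in> CS" "H \<in> CS"
  shows "(\<lambda>n. plus_sec (F n) (H n)) \<in> CS"
  by (rule CS_controlled[OF assms, of 1]) (use assms CS_C in \<open>auto intro!: d_plus plus_in_C\<close>)

lemma CS_sc:
  assumes "F \<in> CS"
  shows "(\<lambda>n. sc_sec c (F n)) \<in> CS"
proof (rule CS_controlled[OF assms assms, of "cmod c + 1"])
  note c = CS_C[OF assms]
  show "sc_sec c (F n) \<in> C" for n by (rule sc_in_C[OF c])
  show "d (sc_sec c (F m)) (sc_sec c (F n)) \<le> (cmod c + 1) * (d (F m) (F n) + d (F m) (F n))" for m n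
    unfolding d_sc[OF c c] using d_nonneg[OF c c, of m n] by (intro mult_mono) auto
qed (simp add: add_nonneg_pos)

lemma CS_star: "F \<in> CS \<Longrightarrow> (\<lambda>n. star_sec (F n)) \<in> CS"
  unfolding CS_iff by (simp add: C_star d_star)

lemma d_conv_le:
  assumes "f \<in> C" "f' \<in> C" "h \<in> C" "h' \<in> C" "\<nu> f \<le> M" "\<nu> h' \<le> M"
  shows "d (conv f h) (conv f' h') \<le> M * (d f f' + d h h')"
proof -
  have "\<nu> f * d h h' \<le> M * d h h'" "d f f' * \<nu> h' \<le> d f f' * M"
    using assms d_nonneg by (auto intro: mult_right_mono mult_left_mono)
  then show ?thesis using d_conv[OF assms(1-4)] by (simp add: algebra_simps)
qed

lemma CS_bounded2:
  assumes "F \<in> CS" "H \<in> CS"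
  obtains M where "M > 0" "\<And>n. \<nu> (F n) \<le> M" "\<And>n. \<nu> (H n) \<le> M"
proof -
  obtain M M' where "\<And>n. \<nu> (F n) \<le> M" "M > 0" "\<And>n. \<nu> (H n) \<le> M'"
    using CS_bounded[OF assms(1)] CS_bounded[OF assms(2)] by metis
  then show ?thesis by (intro that[of "max M M'"]) (auto intro: max.coboundedI1 max.coboundedI2)
qed

lemma CS_conv:
  assumes "F \<in> CS" "H \<in> CS"
  shows "(\<lambda>n. conv (F n) (H n)) \<in> CS"
proof -
  obtain M where "M > 0" "\<And>n. \<nu> (F n) \<le> M" "\<And>n. \<nu> (H n) \<le> M" using CS_bounded2[OF assms] by metis
  note M = this
  note c = CS_C[OF assms(1)] CS_C[OF assms(2)]
  show ?thesis
    by (rule CS_controlled[OF assms M(1) C_conv[OF c] d_conv_le[OF c(1) c(1) c(2) c(2) M(2,3)]])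
qed

lemma rel_iff: "(F, H) \<in> cauchy_rel S \<nu> \<longleftrightarrow> F \<in> CS \<and> H \<in> CS \<and> (\<lambda>n. d (F n) (H n)) \<longlonglongrightarrow> 0"
  by (simp add: cauchy_rel_def aminus_S d_def)

lemma d_lim0_trans:
  assumes "F \<in> CS" "H \<in> CS" "J \<in> CS" "(\<lambda>n. d (F n) (H n)) \<longlonglongrightarrow> 0" "(\<lambda>n. d (H n) (J n)) \<longlonglongrightarrow> 0"
  shows "(\<lambda>n. d (F n) (J n)) \<longlonglongrightarrow> 0"
proof (rule real_tendsto_sandwich[OF _ _ tendsto_const])
  show "(\<lambda>n. d (F n) (H n) + d (H n) (J n)) \<longlonglongrightarrow> 0"
    using tendsto_add_zero[OF assms(4,5)] .
qed (use assms CS_C in \<open>auto intro!: always_eventually d_nonneg d_triangle\<close>)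

lemma equiv_rel: "equiv CS (cauchy_rel S \<nu>)"
proof (rule equivI)
  show "refl_on CS (cauchy_rel S \<nu>)"
    by (rule refl_onI) (auto simp: rel_iff d_self CS_C)
  show "sym (cauchy_rel S \<nu>)"
    by (rule symI) (auto simp: rel_iff d_sym CS_C)
  show "trans (cauchy_rel S \<nu>)"
    by (rule transI) (auto simp: rel_iff intro: d_lim0_trans)
qed (auto simp: rel_iff)

lemma cls_iff: "H \<in> cls F \<longleftrightarrow> F \<in> CS \<and> H \<in> CS \<and> (\<lambda>n. d (F n) (H n)) \<longlonglongrightarrow> 0"
  by (simp add: cls_def rel_iff)

lemma cls_self: "F \<in> CS \<Longrightarrow> F \<in> cls F"
  by (simp add: cls_iff d_self CS_C)

lemma cls_eqI: "F \<in> CS \<Longrightarrow> H \<in> CS \<Longrightarrow> (\<lambda>n. d (F n) (H n)) \<longlonglongrightarrow> 0 \<Longrightarrow> cls F = cls H"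
  unfolding cls_def by (rule equiv_class_eq[OF equiv_rel]) (simp add: rel_iff)

abbreviation "B \<equiv> completion S \<nu>"

lemma carrier_B: "b \<in> carrier B \<longleftrightarrow> (\<exists>F\<in>CS. b = cls F)"
  by (auto simp: completion_def quotient_def cls_def)

lemma cls_in_B: "F \<in> CS \<Longrightarrow> cls F \<in> carrier B"
  using carrier_B by blast

lemma UN_constant: "F \<in> A \<Longrightarrow> (\<And>H. H \<in> A \<Longrightarrow> \<phi> H = c) \<Longrightarrow> (\<Union>H\<in>A. \<phi> H) = c"
  by blast

lemma B_zero: "azero B = cls (\<lambda>_. Z)"
  by (simp add: completion_def cls_def alg_simps)

lemma cls_controlled:
  assumes "F' \<in> cls F" "H' \<in> cls H" "G \<in> CS" "G' \<in> CS"
    and le: "\<And>n. d (G n) (G' n) \<le> M * (d (F n) (F' n) + d (H n) (H' n))"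
  shows "cls G' = cls G"
proof (rule cls_eqI[symmetric, OF assms(3,4)], rule real_tendsto_sandwich[OF _ _ tendsto_const])
  have "(\<lambda>n. d (F n) (F' n) + d (H n) (H' n)) \<longlonglongrightarrow> 0"
    using assms(1,2) by (intro tendsto_add_zero) (auto simp: cls_iff)
  then show "(\<lambda>n. M * (d (F n) (F' n) + d (H n) (H' n))) \<longlonglongrightarrow> 0" by (rule tendsto_mult_right_zero)
  show "\<forall>\<^sub>F n in sequentially. 0 \<le> d (G n) (G' n)"
    by (intro always_eventually allI d_nonneg CS_C assms)
qed (use le in simp)

lemma cls_CS: "F' \<in> cls F \<Longrightarrow> F' \<in> CS"
  by (simp add: cls_iff)

lemma B_plus:
  assumes "F \<in> CS" "H \<in> CS"
  shows "aplus B (cls F) (cls H) = cls (\<lambda>n. plus_sec (F n) (H n))"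
proof -
  have "aplus B (cls F) (cls H) = (\<Union>F'\<in>cls F. \<Union>H'\<in>cls H. cls (\<lambda>n. plus_sec (F' n) (H' n)))"
    by (simp add: completion_def alg_simps flip: cls_def)
  also have "\<dots> = cls (\<lambda>n. plus_sec (F n) (H n))"
  proof (rule UN_constant[OF cls_self[OF assms(1)]], rule UN_constant[OF cls_self[OF assms(2)]])
    fix F' H' assume *: "F' \<in> cls F" "H' \<in> cls H"
    show "cls (\<lambda>n. plus_sec (F' n) (H' n)) = cls (\<lambda>n. plus_sec (F n) (H n))"
      by (rule cls_controlled[OF *, of _ _ 1])
        (use assms *[THEN cls_CS] CS_C in \<open>auto intro!: CS_plus d_plus\<close>)
  qed
  finally show ?thesis .
qed

lemma B_times:
  assumes "F \<in> CS" "H \<in> CS"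
  shows "atimes B (cls F) (cls H) = cls (\<lambda>n. conv (F n) (H n))"
proof -
  have "atimes B (cls F) (cls H) = (\<Union>F'\<in>cls F. \<Union>H'\<in>cls H. cls (\<lambda>n. conv (F' n) (H' n)))"
    by (simp add: completion_def alg_simps flip: cls_def)
  also have "\<dots> = cls (\<lambda>n. conv (F n) (H n))"
  proof (rule UN_constant[OF cls_self[OF assms(1)]], rule UN_constant[OF cls_self[OF assms(2)]])
    fix F' H' assume *: "F' \<in> cls F" "H' \<in> cls H"
    note CS = *[THEN cls_CS]
    obtain M where M: "\<And>n. \<nu> (F n) \<le> M" "\<And>n. \<nu> (H' n) \<le> M" using CS_bounded2[OF assms(1) CS(2)] by metis
    show "cls (\<lambda>n. conv (F' n) (H' n)) = cls (\<lambda>n. conv (F n) (H n))"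
      by (rule cls_controlled[OF * CS_conv[OF assms] CS_conv[OF CS]])
        (rule d_conv_le[OF CS_C[OF assms(1)] CS_C[OF CS(1)] CS_C[OF assms(2)] CS_C[OF CS(2)] M])
  qed
  finally show ?thesis .
qed

lemma B_scale:
  assumes "F \<in> CS"
  shows "ascale B c (cls F) = cls (\<lambda>n. sc_sec c (F n))"
proof -
  have "ascale B c (cls F) = (\<Union>F'\<in>cls F. cls (\<lambda>n. sc_sec c (F' n)))"
    by (simp add: completion_def alg_simps flip: cls_def)
  also have "\<dots> = cls (\<lambda>n. sc_sec c (F n))"
  proof (rule UN_constant[OF cls_self[OF assms]])
    fix F' assume *: "F' \<in> cls F"
    then have lim: "(\<lambda>n. d (F n) (F' n)) \<longlonglongrightarrow> 0" by (simp add: cls_iff)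
    have "(\<lambda>n. d (sc_sec c (F n)) (sc_sec c (F' n))) \<longlonglongrightarrow> 0"
      using tendsto_mult_right_zero[OF lim, of "cmod c"] assms cls_CS[OF *] by (simp add: d_sc CS_C)
    then show "cls (\<lambda>n. sc_sec c (F' n)) = cls (\<lambda>n. sc_sec c (F n))"
      by (intro cls_eqI[symmetric] CS_sc assms cls_CS[OF *])
  qed
  finally show ?thesis .
qed

lemma B_star:
  assumes "F \<in> CS"
  shows "astar B (cls F) = cls (\<lambda>n. star_sec (F n))"
proof -
  have "astar B (cls F) = (\<Union>F'\<in>cls F. cls (\<lambda>n. star_sec (F' n)))"
    by (simp add: completion_def alg_simps flip: cls_def)
  also have "\<dots> = cls (\<lambda>n. star_sec (F n))"
  proof (rule UN_constant[OF cls_self[OF assms]])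
    fix F' assume *: "F' \<in> cls F"
    then have "(\<lambda>n. d (star_sec (F n)) (star_sec (F' n))) \<longlonglongrightarrow> 0"
      using assms cls_CS[OF *] by (simp add: cls_iff d_star CS_C)
    then show "cls (\<lambda>n. star_sec (F' n)) = cls (\<lambda>n. star_sec (F n))"
      by (intro cls_eqI[symmetric] CS_star assms cls_CS[OF *])
  qed
  finally show ?thesis .
qed

lemma \<nu>_convergent:
  assumes "F \<in> CS"
  shows "convergent (\<lambda>n. \<nu> (F n))"
proof (rule Cauchy_convergent, rule CauchyI)
  fix \<epsilon> :: real assume "\<epsilon> > 0"
  then obtain N where "\<And>m n. m \<ge> N \<Longrightarrow> n \<ge> N \<Longrightarrow> d (F m) (F n) < \<epsilon>"
    using assms unfolding CS_iff by meson
  then show "\<exists>N. \<forall>m\<ge>N. \<forall>n\<ge>N. norm (\<nu> (F m) - \<nu> (F n)) < \<epsilon>"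
    using \<nu>_diff[OF CS_C[OF assms] CS_C[OF assms]] 
    by (intro exI[of _ N]) (metis le_less_trans real_norm_def)
qed

lemma B_norm:
  assumes F: "F \<in> CS"
  shows "(\<lambda>n. \<nu> (F n)) \<longlonglongrightarrow> anorm B (cls F)"
proof -
  have "lim (\<lambda>n. \<nu> (H n)) = lim (\<lambda>n. \<nu> (F n))" if "H \<in> cls F" for H
  proof -
    from that have H: "H \<in> CS" "(\<lambda>n. d (F n) (H n)) \<longlonglongrightarrow> 0" by (auto simp: cls_iff)
    have "(\<lambda>n. \<nu> (F n) - \<nu> (H n)) \<longlonglongrightarrow> 0"
      by (rule Lim_null_comparison[OF _ H(2)]) (use \<nu>_diff CS_C F H(1) in \<open>auto intro!: always_eventually\<close>)
    then have "(\<lambda>n. \<nu> (F n) - (\<nu> (F n) - \<nu> (H n))) \<longlonglongrightarrow> lim (\<lambda>n. \<nu> (F n)) - 0"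
      using \<nu>_convergent[OF F] by (intro tendsto_diff) (auto simp: convergent_LIMSEQ_iff)
    then show ?thesis by (simp add: limI)
  qed
  then have "(\<lambda>H. lim (\<lambda>n. \<nu> (H n))) ` cls F = (\<lambda>_. lim (\<lambda>n. \<nu> (F n))) ` cls F"
    by (rule image_cong[OF refl])
  also have "\<dots> = {lim (\<lambda>n. \<nu> (F n))}"
    unfolding image_constant_conv using cls_self[OF F] by (simp only: empty_iff if_False split: if_splits) blast
  finally have "anorm B (cls F) = lim (\<lambda>n. \<nu> (F n))"
    by (simp add: completion_def)
  then show ?thesis using \<nu>_convergent[OF F] by (simp add: convergent_LIMSEQ_iff)
qed

lemma B_minus:
  assumes "F \<in> CS" "H \<in> CS"
  shows "aminus B (cls F) (cls H) = cls (\<lambda>n. minus_sec (F n) (H n))"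
  unfolding aminus_def minus_eq using assms by (simp add: B_plus B_scale CS_sc)

lemma CS_minus: "F \<in> CS \<Longrightarrow> H \<in> CS \<Longrightarrow> (\<lambda>n. minus_sec (F n) (H n)) \<in> CS"
  unfolding minus_eq by (intro CS_plus CS_sc)

section \<open>Evaluation of elements of the completion\<close>

lemma coef_diff_le: "f \<in> C \<Longrightarrow> f' \<in> C \<Longrightarrow> cmod (coef (f g) - coef (f' g)) \<le> d f f'"
  using dominates[OF minus_in_C, of f f' g] unfolding d_def by (simp add: nm_fdiff C_sec)

lemma ev_tendsto:
  assumes "F \<in> CS"
  shows "(\<lambda>n. coef (F n g)) \<longlonglongrightarrow> ev g F"
proof -
  have "Cauchy (\<lambda>n. coef (F n g))"
  proof (rule CauchyI)
    fix \<epsilon> :: real assume "\<epsilon> > 0"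
    then obtain N where "\<And>m n. m \<ge> N \<Longrightarrow> n \<ge> N \<Longrightarrow> d (F m) (F n) < \<epsilon>"
      using assms unfolding CS_iff by meson
    then show "\<exists>N. \<forall>m\<ge>N. \<forall>n\<ge>N. norm (coef (F m g) - coef (F n g)) < \<epsilon>"
      using coef_diff_le[OF CS_C[OF assms] CS_C[OF assms]] 
      by (intro exI[of _ N]) (metis le_less_trans)
  qed
  then show ?thesis unfolding ev_def by (simp add: Cauchy_convergent convergent_LIMSEQ_iff[symmetric])
qed

lemma evI: "(\<lambda>n. coef (F n g)) \<longlonglongrightarrow> l \<Longrightarrow> ev g F = l"
  unfolding ev_def by (rule limI)

lemma ev_cong: 
  assumes "H \<in> cls F"
  shows "ev g H = ev g F"
proof -
  have *: "F \<in> CS" "H \<in> CS" "(\<lambda>n. d (F n) (H n)) \<longlonglongrightarrow> 0" using assms by (auto simp: cls_iff)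
  have "(\<lambda>n. coef (F n g) - coef (H n g)) \<longlonglongrightarrow> 0"
    by (rule Lim_null_comparison[OF _ *(3)]) (use coef_diff_le CS_C * in \<open>auto intro!: always_eventually\<close>)
  then have "(\<lambda>n. coef (F n g) - (coef (F n g) - coef (H n g))) \<longlonglongrightarrow> ev g F - 0"
    by (intro tendsto_diff ev_tendsto *)
  then show ?thesis by (intro evI) simp
qed

text \<open>The values of a Cauchy sequence converge, since the norm dominates them, and the limit does not
  depend on the representative.\<close>

lemma psi_red_cls:
  assumes F: "F \<in> CS" and x: "x \<in> X"
  shows "psi_red L x (cls F) = ev x F"
proof -
  have eq: "nm (fdiff L (H n x) \<xi>) = cmod (coef (H n x) - coef \<xi>)" if "H \<in> cls F" "p \<xi> = x" for H n \<xi>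
    using that C_sec[OF CS_C, of H n] by (simp add: nm_fdiff cls_iff)
  have "red_eval L x (cls F) = sc (ev x F) (e x)"
    unfolding red_eval_def
  proof (rule the_equality)
    have "(\<lambda>n. nm (fdiff L (H n x) (sc (ev x F) (e x)))) \<longlonglongrightarrow> 0" if H: "H \<in> cls F" for H
    proof -
      have "(\<lambda>n. coef (H n x)) \<longlonglongrightarrow> ev x F" using ev_tendsto[of H] ev_cong[OF H] H by (auto simp: cls_iff)
      then have "(\<lambda>n. cmod (coef (H n x) - ev x F)) \<longlonglongrightarrow> 0"
        using LIM_zero tendsto_norm_zero by blast
      then show ?thesis using eq[OF H, of "sc (ev x F) (e x)"] by (simp del: e_unit coef_sc)
    qed
    then show "sc (ev x F) (e x) \<in> fibre L x \<and> (\<forall>H\<in>cls F. (\<lambda>n. nm (fdiff L (H n x) (sc (ev x F) (e x)))) \<longlonglongrightarrow> 0)"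
      by (simp del: e_unit)
    fix \<xi> assume "\<xi> \<in> fibre L x \<and> (\<forall>H\<in>cls F. (\<lambda>n. nm (fdiff L (H n x) \<xi>)) \<longlonglongrightarrow> 0)"
    then have \<xi>: "p \<xi> = x" "(\<lambda>n. nm (fdiff L (F n x) \<xi>)) \<longlonglongrightarrow> 0" using cls_self[OF F] by auto
    then have "(\<lambda>n. cmod (coef (F n x) - coef \<xi>)) \<longlonglongrightarrow> 0" using eq[OF cls_self[OF F] \<xi>(1)] by simp
    then have "(\<lambda>n. coef (F n x)) \<longlonglongrightarrow> coef \<xi>" by (simp add: tendsto_norm_zero_iff LIM_zero_iff)
    then have "coef \<xi> = ev x F" using ev_tendsto[OF F] LIMSEQ_unique by blast
    then show "\<xi> = sc (ev x F) (e x)" using \<xi>(1) sc_coef[of \<xi>] by metis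
  qed
  then show ?thesis using x by (simp add: psi_red_def fscalar_coef)
qed


section \<open>Sections vanishing at infinity\<close>

definition unif :: "(nat \<Rightarrow> 'g \<Rightarrow> 'l) \<Rightarrow> ('g \<Rightarrow> 'l) \<Rightarrow> bool" where
  "unif F f \<longleftrightarrow> (\<forall>\<epsilon>>0. \<forall>\<^sub>F n in sequentially. \<forall>g. nm (fdiff L (F n g) (f g)) < \<epsilon>)"

lemma unif_iff: "uniform_limit UNIV (\<lambda>n g. nm (fdiff L (F n g) (f g))) (\<lambda>g. 0) sequentially \<longleftrightarrow> unif F f"
  by (simp add: uniform_limit_iff unif_def)

lemma C0_sec: "f \<in> C0_on L U \<Longrightarrow> sec f"
  by (simp add: C0_on_def bundle_sections_eq)

text \<open>The approximants multiply \<open>f\<close> by a function of its norm that replaces \<open>\<parallel>f\<parallel>\<close> by \<open>max 0 (\<parallel>f\<parallel> - \<delta>)\<close>.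
  They vanish where the norm of \<open>f\<close> is below \<open>\<delta>\<close>, hence outside a compact set, and differ from \<open>f\<close> by
  at most \<open>\<delta>\<close>.\<close>

lemma C0_approx:
  assumes U: "open_bisection L U" and f: "f \<in> C0_on L U"
  obtains F where "\<And>n. F n \<in> Cc_on L U" "unif F f"
proof -
  have sf: "sec f" and off: "\<And>g. g \<notin> U \<Longrightarrow> f g = Z g" and cf: "continuous_on U f"
    and cpt: "\<And>\<epsilon>. \<epsilon> > 0 \<Longrightarrow> compact {g \<in> U. \<epsilon> \<le> nm (f g)}"
    using f by (auto simp: C0_on_def bundle_sections_eq)
  define \<delta> where "\<delta> n = inverse (real (Suc n))" for n
  have \<delta>: "\<delta> n > 0" for n by (simp add: \<delta>_def)
  \<comment> \<open>The denominator is the norm wherever the numerator is non-zero, and never vanishes.\<close>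
  define \<phi> where "\<phi> n t = max 0 (t - \<delta> n) / max t (\<delta> n)" for n t
  define F where "F n g = sc (of_real (\<phi> n (nm (f g)))) (f g)" for n g
  have pos: "max t (\<delta> n) \<noteq> 0" for t n using \<delta>[of n] by linarith
  have \<phi>0: "\<phi> n t = 0" if "t < \<delta> n" for n t using that by (simp add: \<phi>_def)
  have \<phi>1: "cmod (of_real (\<phi> n t) * c - c) \<le> \<delta> n" if "cmod c = t" for n t c
  proof -
    have "cmod (of_real (\<phi> n t) * c - c) = \<bar>\<phi> n t - 1\<bar> * t"
      by (metis left_diff_distrib mult_1 norm_mult norm_of_real of_real_1 of_real_diff that)
    also have "\<dots> \<le> \<delta> n"
    proof (cases "t < \<delta> n")
      case True
      then show ?thesis using that \<phi>0 norm_ge_zero[of c] by simp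
    next
      case False
      then have "t > 0" using \<delta>[of n] by linarith
      have "\<phi> n t = (t - \<delta> n) / t" using False by (simp add: \<phi>_def max_def)
      moreover have "(t - \<delta> n) / t - 1 = - (\<delta> n / t)" using \<open>t > 0\<close> by (simp add: field_simps)
      ultimately have "\<bar>\<phi> n t - 1\<bar> * t = \<delta> n" using \<open>t > 0\<close> \<delta>[of n] by simp
      then show ?thesis by simp
    qed
    finally show ?thesis .
  qed
  have "F n \<in> Cc_on L U" for n
  proof (rule CcI[OF U _ _ cpt[OF \<delta>[of n]]])
    show "sec (F n)" using sf by (simp add: F_def sec_def)
    have "continuous_on U (\<lambda>g. nm (f g))" using sf by (intro cont_nm[OF U cf]) simp
    then show "continuous_on U (F n)"
      unfolding F_def \<phi>_def using sf pos
      by (intro cont_sc[OF U] cf continuous_intros) auto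
    show "F n g = Z g" if "g \<notin> {g \<in> U. \<delta> n \<le> nm (f g)}" for g
    proof (cases "g \<in> U")
      case True
      then show ?thesis using that \<phi>0 sf by (simp add: F_def)
    next
      case False
      then show ?thesis using off by (simp add: F_def)
    qed
  qed auto
  moreover have "unif F f"
    unfolding unif_def
  proof (intro allI impI)
    fix \<epsilon> :: real assume "\<epsilon> > 0"
    have "\<delta> \<longlonglongrightarrow> 0" unfolding \<delta>_def by (rule LIMSEQ_inverse_real_of_nat)
    then have "\<forall>\<^sub>F n in sequentially. \<delta> n < \<epsilon>" using \<open>\<epsilon> > 0\<close> by (rule order_tendstoD)
    then show "\<forall>\<^sub>F n in sequentially. \<forall>g. nm (fdiff L (F n g) (f g)) < \<epsilon>"
    proof eventually_elim
      case (elim n)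
      have "nm (fdiff L (F n g) (f g)) \<le> \<delta> n" for g
        using \<phi>1[of "coef (f g)" "nm (f g)" n] by (simp add: nm_fdiff F_def)
      then show ?case using elim le_less_trans by blast
    qed
  qed
  ultimately show ?thesis by (rule that)
qed

text \<open>Where the limit has norm at least \<open>\<epsilon>\<close>, a uniformly close approximant is non-zero, so that set is
  relatively closed in the compact support of the approximant.\<close>

lemma C0_limit:
  assumes U: "open_bisection L U" and F: "\<And>n. F n \<in> Cc_on L U" and f: "sec f" "unif F f"
  shows "f \<in> C0_on L U"
proof -
  have cf: "continuous_on U f"
    by (rule uniform_limit_continuous[where F = F, OF U Cc_cont[OF F] Cc_sec[OF F] f(1)])
      (use f(2) in \<open>simp add: unif_def\<close>)
  have sF: "sec (F n)" for n using Cc_sec F by blast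
  have small: "\<exists>n. \<forall>g. nm (fdiff L (F n g) (f g)) < \<epsilon>" if "\<epsilon> > 0" for \<epsilon>
    using f(2) that unfolding unif_def eventually_sequentially by blast
  have off: "f g = Z g" if "g \<notin> U" for g
  proof (rule ccontr)
    assume "f g \<noteq> Z g"
    then have "nm (f g) \<noteq> 0" using nm_eq_0_iff[of "f g"] f(1) by simp
    then have "nm (f g) > 0" using nm_nonneg[of "f g"] by linarith
    then obtain n where "nm (fdiff L (F n g) (f g)) < nm (f g)" using small by blast
    then show False using Cc_off[OF F that, of n] f(1) by (simp add: nm_fdiff)
  qed
  have "compact {g \<in> U. \<epsilon> \<le> nm (f g)}" if \<epsilon>: "\<epsilon> > 0" for \<epsilon>
  proof -
    obtain n where n: "\<And>g. nm (fdiff L (F n g) (f g)) < \<epsilon>" using small[OF \<epsilon>] by blast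
    obtain Q where Q: "compact Q" "Q \<subseteq> U" "\<And>g. g \<notin> Q \<Longrightarrow> F n g = Z g" using CcE[OF U F] by metis
    have "g \<in> Q" if "\<epsilon> \<le> nm (f g)" for g
    proof (rule ccontr)
      assume "g \<notin> Q"
      then show False using n[of g] Q(3) f(1) that by (simp add: nm_fdiff)
    qed
    then have eq: "{g \<in> U. \<epsilon> \<le> nm (f g)} = Q \<inter> (\<lambda>g. nm (f g)) -` {\<epsilon>..}" using Q(2) by auto
    have "continuous_on Q (\<lambda>g. nm (f g))"
      using Q(2) f(1) by (intro cont_nm[OF U] continuous_on_subset[OF cf]) auto
    then have "closedin (top_of_set Q) (Q \<inter> (\<lambda>g. nm (f g)) -` {\<epsilon>..})"
      by (intro continuous_closedin_preimage) auto
    then show ?thesis unfolding eq using Q(1) closedin_compact by blast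
  qed
  then show ?thesis using f(1) off cf by (simp add: C0_on_def bundle_sections_eq)
qed

lemma scalar_section_C0:
  assumes "h \<in> C0_functions X"
  shows "scalar_section L h \<in> C0_on L X" "x \<in> X \<Longrightarrow> coef (scalar_section L h x) = h x"
proof -
  have h: "continuous_on X h" "\<And>\<epsilon>. \<epsilon> > 0 \<Longrightarrow> compact {x \<in> X. \<epsilon> \<le> cmod (h x)}"
    using assms by (auto simp: C0_functions_def)
  have "continuous_on X (\<lambda>g. sc (h g) (un g))"
    by (intro cont_sc[OF bisection_units h(1) cont_un]) simp
  then have "continuous_on X (scalar_section L h)"
    by (subst continuous_on_cong[OF refl, of _ _ "\<lambda>g. sc (h g) (un g)"]) (simp_all add: scalar_section_def)
  moreover have "{g \<in> X. \<epsilon> \<le> nm (scalar_section L h g)} = {x \<in> X. \<epsilon> \<le> cmod (h x)}" for \<epsilon>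
    by (auto simp: scalar_section_def)
  ultimately show "scalar_section L h \<in> C0_on L X"
    using h(2) by (simp add: C0_on_def bundle_sections_eq sec_def scalar_section_def)
  show "x \<in> X \<Longrightarrow> coef (scalar_section L h x) = h x" by (simp add: scalar_section_def)
qed

lemma C0_scalar_section:
  assumes f: "f \<in> C0_on L X"
  obtains h where "h \<in> C0_functions X" "scalar_section L h = f"
proof -
  have sf: "sec f" and off: "\<And>g. g \<notin> X \<Longrightarrow> f g = Z g" and cf: "continuous_on X f"
    and cpt: "\<And>\<epsilon>. \<epsilon> > 0 \<Longrightarrow> compact {g \<in> X. \<epsilon> \<le> nm (f g)}"
    using f by (auto simp: C0_on_def bundle_sections_eq)
  have "continuous_on X (\<lambda>g. coef (f g))"
    using sf by (intro continuous_on_compose2[OF cont_coef cf]) auto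
  then have "(\<lambda>g. coef (f g)) \<in> C0_functions X" using cpt by (simp add: C0_functions_def)
  moreover have "scalar_section L (\<lambda>g. coef (f g)) = f"
  proof
    fix g show "scalar_section L (\<lambda>g. coef (f g)) g = f g"
      using sc_coef[of "f g"] sf off by (cases "g \<in> X") (simp_all add: scalar_section_def)
  qed
  ultimately show ?thesis by (rule that)
qed

lemma bump:
  assumes "open W" "W \<subseteq> X" "x \<in> W"
  obtains V Q where "V \<in> Cc_on L X" "\<And>g. nm (V g) \<le> 1" "coef (V x) = 1" "compact Q" "Q \<subseteq> W"
    "\<And>g. g \<notin> Q \<Longrightarrow> V g = Z g"
proof -
  obtain v :: "'g \<Rightarrow> real" and Q where v: "continuous_on X v" "compact Q" "Q \<subseteq> W" "v x = 1"
    "\<And>y. y \<in> X - Q \<Longrightarrow> v y = 0" "\<And>y. y \<in> X \<Longrightarrow> 0 \<le> v y \<and> v y \<le> 1"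
    using units_bump[OF assms(1,3,2)] by metis
  define V where "V = scalar_section L (\<lambda>y. of_real (v y))"
  have V: "V g = (if g \<in> X then sc (of_real (v g)) (un g) else Z g)" for g
    by (simp add: V_def scalar_section_def)
  have off: "V g = Z g" if "g \<notin> Q" for g using that v(5)[of g] by (simp add: V)
  have "continuous_on X (\<lambda>g. sc (of_real (v g)) (un g))"
    by (intro cont_sc[OF bisection_units _ cont_un] continuous_intros v) simp
  then have "continuous_on X V"
    by (subst continuous_on_cong[OF refl, of _ _ "\<lambda>g. sc (of_real (v g)) (un g)"]) (simp_all add: V)
  then have "V \<in> Cc_on L X"
    using v assms by (intro CcI[OF bisection_units _ _ v(2) _ off]) (auto simp: sec_def V)
  moreover have "nm (V g) \<le> 1" for g using v(6)[of g] by (simp add: V)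
  moreover have "coef (V x) = 1" using assms v(4) by (auto simp: V)
  ultimately show ?thesis using that v(2,3) off by blast
qed

text \<open>If \<open>g\<close> and \<open>h\<close> in a bisection have the same source then \<open>g = h\<close>, and \<open>g h\<^sup>-\<^sup>1\<close> is a unit.\<close>

lemma set_mult_sub_units:
  assumes U: "open_bisection L U"
  shows "set_mult (set_mult U X) (gi ` U) \<subseteq> X" "set_mult (set_mult (gi ` U) X) U \<subseteq> X"
proof -
  have 1: "set_mult V X \<subseteq> V" for V by (auto simp: set_mult_def)
  have "g \<cdot> gi h \<in> X" if "g \<in> U" "h \<in> U" "s g = s h" for g h
    using s_bisection_eq[OF U that] by simp
  then show "set_mult (set_mult U X) (gi ` U) \<subseteq> X" using 1[of U] unfolding set_mult_def by auto
  have "gi g \<cdot> h \<in> X" if "g \<in> U" "h \<in> U" "r g = r h" for g h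
    using r_bisection_eq[OF U that] by simp
  then show "set_mult (set_mult (gi ` U) X) U \<subseteq> X" using 1[of "gi ` U"] unfolding set_mult_def by auto
qed

text \<open>The diagonal entry at \<open>x\<close> of \<open>(K f)* K f\<close> is a sum of squares of moduli.\<close>

lemma star_conv_unit_nonneg:
  assumes f: "f \<in> C" and x: "x \<in> X"
  shows "coef (conv (star_sec f) f x) \<in> \<real>\<^sub>\<ge>\<^sub>0"
proof -
  note fs = C_sec[OF f] C_fib_fin[OF C_star[OF f]]
  define T where "T = {m. s m = s x \<and> K (star_sec f) x m \<noteq> 0}"
  have "coef (conv (star_sec f) f x) = K (conv (star_sec f) f) x x"
    using x fs by (subst K_unit) (auto intro: sec_conv)
  also have "\<dots> = (\<Sum>m\<in>T. K (star_sec f) x m * K f m x)"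
    by (rule K_conv) (use fs fib_fin_rows[OF fs(2), of x] in \<open>auto simp: T_def\<close>)
  also have "\<dots> = (\<Sum>m\<in>T. of_real ((cmod (K f m x))\<^sup>2))"
  proof (rule sum.cong[OF refl])
    fix m assume "m \<in> T"
    then have "K (star_sec f) x m = cnj (K f m x)" using fs by (intro K_star) (auto simp: T_def)
    then show "K (star_sec f) x m * K f m x = of_real ((cmod (K f m x))\<^sup>2)"
      unfolding complex_norm_square by (simp only: mult.commute)
  qed
  finally show ?thesis by (simp add: sum_nonneg flip: of_real_sum of_real_power)
qed

end

context fell_norm
begin

section \<open>The normalizers and the diagonal in the completion\<close>

text \<open>On a single bisection the uniform norm dominates \<open>\<nu>\<close>, so uniformly convergent sequences are Cauchy
  and those with the same limit are equivalent.\<close>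

lemma unif_lim:
  assumes U: "open_bisection L U" and F: "\<And>n. F n \<in> Cc_on L U" and f: "sec f" "unif F f"
  shows "F \<in> CS" "C0_embed L \<nu> U f = cls F" "ev g F = coef (f g)"
proof -
  have d_le: "d h h' \<le> c + c'" if "h \<in> Cc_on L U" "h' \<in> Cc_on L U" 
    "\<And>g. nm (fdiff L (h g) (f g)) < c" "\<And>g. nm (fdiff L (h' g) (f g)) < c'" for h h' c c'
    unfolding d_def
  proof (rule cstar_le[OF cstar U])
    show "minus_sec h h' \<in> Cc_on L U" unfolding minus_eq by (intro Cc_plus Cc_sc U that)
    fix g
    have "cmod (coef (h g) - coef (h' g)) \<le> cmod (coef (h g) - coef (f g)) + cmod (coef (h' g) - coef (f g))"
      by (metis norm_triangle_ineq4 diff_diff_eq2 diff_add_cancel add_diff_cancel_right' diff_add_eq)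
    then show "nm (fdiff L (h g) (h' g)) \<le> c + c'"
      using that(3,4)[of g] Cc_sec[OF that(1)] Cc_sec[OF that(2)] f(1) by (simp add: nm_fdiff)
  qed
  have cauchy: "F \<in> CS" if F: "\<And>n. F n \<in> Cc_on L U" "unif F f" for F
    unfolding CS_iff
  proof (intro conjI allI impI)
    show "F n \<in> C" for n using Cc_in_C[OF U F(1)] .
    fix \<epsilon> :: real assume "\<epsilon> > 0"
    then have "\<epsilon> / 3 > 0" by simp
    then obtain N where N: "\<And>n g. n \<ge> N \<Longrightarrow> nm (fdiff L (F n g) (f g)) < \<epsilon> / 3"
      using F(2) unfolding unif_def eventually_sequentially by meson
    show "\<exists>N. \<forall>m\<ge>N. \<forall>n\<ge>N. d (F m) (F n) < \<epsilon>"
    proof (intro exI[of _ N] allI impI)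
      fix m n assume "m \<ge> N" "n \<ge> N"
      then have "d (F m) (F n) \<le> \<epsilon> / 3 + \<epsilon> / 3" using N by (intro d_le F)
      then show "d (F m) (F n) < \<epsilon>" using \<open>\<epsilon> > 0\<close> by simp
    qed
  qed
  show CSF: "F \<in> CS" by (rule cauchy[OF F f(2)])
  have eq: "cls F' = cls F" if F': "\<And>n. F' n \<in> Cc_on L U" "unif F' f" for F'
  proof (rule cls_eqI[OF cauchy[OF F'] CSF], rule tendstoI)
    fix \<epsilon> :: real assume "\<epsilon> > 0"
    then have "\<epsilon> / 3 > 0" by simp
    then have "\<forall>\<^sub>F n in sequentially. (\<forall>g. nm (fdiff L (F n g) (f g)) < \<epsilon> / 3) \<and> (\<forall>g. nm (fdiff L (F' n g) (f g)) < \<epsilon> / 3)"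
      using f(2) F'(2) unfolding unif_def by (intro eventually_conj) blast+
    then show "\<forall>\<^sub>F n in sequentially. dist (d (F' n) (F n)) 0 < \<epsilon>"
    proof eventually_elim
      case (elim n)
      then have "d (F' n) (F n) \<le> \<epsilon> / 3 + \<epsilon> / 3" by (intro d_le F F') auto
      then show ?case using \<open>\<epsilon> > 0\<close> d_nonneg[OF CS_C[OF cauchy[OF F']] CS_C[OF CSF]] by simp
    qed
  qed
  have "C0_embed L \<nu> U f = (\<Union>F'\<in>{F'. (\<forall>n. F' n \<in> Cc_on L U) \<and> unif F' f}. cls F')"
    unfolding C0_embed_def unif_iff cls_def ..
  also have "\<dots> = cls F" by (rule UN_constant[of F]) (use F f(2) eq in blast)+
  finally show "C0_embed L \<nu> U f = cls F" .
  show "ev g F = coef (f g)"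
  proof (rule evI, rule tendstoI)
    fix \<epsilon> :: real assume "\<epsilon> > 0"
    then have "\<forall>\<^sub>F n in sequentially. \<forall>g. nm (fdiff L (F n g) (f g)) < \<epsilon>"
      using f(2) unfolding unif_def by blast
    then show "\<forall>\<^sub>F n in sequentially. dist (coef (F n g)) (coef (f g)) < \<epsilon>"
    proof eventually_elim
      case (elim n)
      then have "nm (fdiff L (F n g) (f g)) < \<epsilon>" by blast
      then show ?case using Cc_sec[OF F] f(1) by (simp add: nm_fdiff dist_norm)
    qed
  qed
qed

lemma Cc_Cauchy_limit:
  assumes U: "open_bisection L U" and F: "\<And>n. F n \<in> Cc_on L U" "F \<in> CS"
  obtains f where "f \<in> C0_on L U" "sec f" "unif F f"
proof -
  define f where "f g = sc (ev g F) (e g)" for g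
  have sf: "sec f" by (simp add: f_def sec_def)
  have "unif F f"
    unfolding unif_def
  proof (intro allI impI)
    fix \<epsilon> :: real assume "\<epsilon> > 0"
    then have "\<epsilon> / 2 > 0" by simp
    then obtain N where N: "\<And>m n. m \<ge> N \<Longrightarrow> n \<ge> N \<Longrightarrow> d (F m) (F n) < \<epsilon> / 2"
      using F(2) unfolding CS_iff by meson
    have "nm (fdiff L (F n g) (f g)) < \<epsilon>" if n: "n \<ge> N" for n g
    proof -
      have "(\<lambda>m. cmod (coef (F n g) - coef (F m g))) \<longlonglongrightarrow> cmod (coef (F n g) - ev g F)"
        by (intro tendsto_intros ev_tendsto F)
      moreover have "cmod (coef (F n g) - coef (F m g)) \<le> \<epsilon> / 2" if "m \<ge> N" for m
        using N[OF n that] coef_diff_le[OF CS_C[OF F(2)] CS_C[OF F(2)], of n g m] by linarith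
      ultimately have "cmod (coef (F n g) - ev g F) \<le> \<epsilon> / 2"
        by (intro LIMSEQ_le_const2) auto
      moreover have "coef (f g) = ev g F" by (simp add: f_def del: coef_sc)
      ultimately show ?thesis using \<open>\<epsilon> > 0\<close> sf Cc_sec[OF F(1)] by (simp add: nm_fdiff)
    qed
    then show "\<forall>\<^sub>F n in sequentially. \<forall>g. nm (fdiff L (F n g) (f g)) < \<epsilon>"
      unfolding eventually_sequentially by blast
  qed
  then show ?thesis using that[OF C0_limit[where F = F, OF U F(1) sf] sf] by blast
qed

abbreviation "N \<equiv> bisection_elements L \<nu>"
abbreviation "j \<equiv> unit_embed L \<nu>"
abbreviation "A \<equiv> j ` C0_functions X"

text \<open>The description by \<open>C\<^sub>0\<close>-sections is replaced by one by Cauchy sequences on a bisection: a sequence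
  that is Cauchy for \<open>\<nu>\<close> is uniformly Cauchy, because \<open>\<nu>\<close> dominates values, and its uniform limit
  vanishes at infinity.\<close>

lemma N_iff: "b \<in> N \<longleftrightarrow> (\<exists>U F. open_bisection L U \<and> (\<forall>n. F n \<in> Cc_on L U) \<and> F \<in> CS \<and> b = cls F)"
proof
  assume "b \<in> N"
  then obtain U f where U: "open_bisection L U" "f \<in> C0_on L U" "b = C0_embed L \<nu> U f"
    unfolding bisection_elements_def by blast
  obtain F where F: "\<And>n. F n \<in> Cc_on L U" "unif F f" using C0_approx[OF U(1,2)] by blast
  show "\<exists>U F. open_bisection L U \<and> (\<forall>n. F n \<in> Cc_on L U) \<and> F \<in> CS \<and> b = cls F"
    using unif_lim(1,2)[OF U(1) F(1) C0_sec[OF U(2)] F(2)] U F by blast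
next
  assume "\<exists>U F. open_bisection L U \<and> (\<forall>n. F n \<in> Cc_on L U) \<and> F \<in> CS \<and> b = cls F"
  then obtain U F where *: "open_bisection L U" "\<And>n. F n \<in> Cc_on L U" "F \<in> CS" "b = cls F" by blast
  obtain f where f: "f \<in> C0_on L U" "sec f" "unif F f" using Cc_Cauchy_limit[OF *(1-3)] by blast
  have "b = C0_embed L \<nu> U f" using unif_lim(2)[OF *(1,2) f(2,3)] * by simp
  then show "b \<in> N" unfolding bisection_elements_def using *(1) f(1) by blast
qed

lemma NI: "open_bisection L U \<Longrightarrow> (\<And>n. F n \<in> Cc_on L U) \<Longrightarrow> F \<in> CS \<Longrightarrow> cls F \<in> N"
  using N_iff by blast

lemma NE:
  assumes "b \<in> N"
  obtains U F where "open_bisection L U" "\<And>n. F n \<in> Cc_on L U" "F \<in> CS" "b = cls F"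
  using assms N_iff by blast

lemma j_cls:
  assumes h: "h \<in> C0_functions X"
  obtains F where "\<And>n. F n \<in> Cc_on L X" "F \<in> CS" "j h = cls F" "\<And>x. x \<in> X \<Longrightarrow> ev x F = h x"
proof -
  note f = scalar_section_C0[OF h]
  obtain F where F: "\<And>n. F n \<in> Cc_on L X" "unif F (scalar_section L h)"
    using C0_approx[OF bisection_units f(1)] by blast
  note u = unif_lim[OF bisection_units F(1) C0_sec[OF f(1)] F(2)]
  show ?thesis
    by (rule that[OF F(1) u(1)]) (use u(2,3) f(2) in \<open>simp_all add: unit_embed_def\<close>)
qed

lemma cls_j:
  assumes F: "\<And>n. F n \<in> Cc_on L X" "F \<in> CS"
  obtains h where "h \<in> C0_functions X" "j h = cls F" "\<And>x. x \<in> X \<Longrightarrow> h x = ev x F"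
proof -
  obtain f where f: "f \<in> C0_on L X" "sec f" "unif F f" using Cc_Cauchy_limit[OF bisection_units F] by blast
  obtain h where h: "h \<in> C0_functions X" "scalar_section L h = f" using C0_scalar_section[OF f(1)] by blast
  note u = unif_lim[OF bisection_units F(1) f(2,3)]
  show ?thesis
    by (rule that[OF h(1)]) (use u(2,3) h(2) scalar_section_C0(2)[OF h(1)] in \<open>simp_all add: unit_embed_def\<close>)
qed

lemma A_I: "(\<And>n. F n \<in> Cc_on L X) \<Longrightarrow> F \<in> CS \<Longrightarrow> cls F \<in> A"
  using cls_j[of F] by (metis image_eqI)

lemma A_E:
  assumes "a \<in> A"
  obtains F where "\<And>n. F n \<in> Cc_on L X" "F \<in> CS" "a = cls F"
  using assms j_cls by (metis imageE)

lemma N_sub: "N \<subseteq> carrier B"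
  using NE cls_in_B by (metis subsetI)

lemma star_semigroup_N: "star_semigroup B N"
  unfolding star_semigroup_def
proof (intro conjI ballI N_sub)
  fix m n assume "m \<in> N" "n \<in> N"
  obtain U F where m: "open_bisection L U" "\<And>n. F n \<in> Cc_on L U" "F \<in> CS" "m = cls F" using NE[OF \<open>m \<in> N\<close>] by blast
  obtain V H where n: "open_bisection L V" "\<And>n. H n \<in> Cc_on L V" "H \<in> CS" "n = cls H" using NE[OF \<open>n \<in> N\<close>] by blast
  show "atimes B m n \<in> N"
    unfolding m(4) n(4) B_times[OF m(3) n(3)]
    by (intro NI[OF bisection_mult[OF m(1) n(1)]] Cc_conv CS_conv m n)
next
  fix n assume "n \<in> N"
  then obtain U F where n: "open_bisection L U" "\<And>n. F n \<in> Cc_on L U" "F \<in> CS" "n = cls F" using NE by metis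
  show "astar B n \<in> N"
    unfolding n(4) B_star[OF n(3)] by (intro NI[OF bisection_inv[OF n(1)]] Cc_star CS_star n)
qed

lemma normalizers: 
  assumes "n \<in> N"
  shows "is_normalizer B A n"
  unfolding is_normalizer_def
proof (intro conjI ballI)
  show "n \<in> carrier B" using assms N_sub by blast
  obtain U F where n: "open_bisection L U" "\<And>n. F n \<in> Cc_on L U" "F \<in> CS" "n = cls F" using NE[OF assms] by metis
  note bi = bisection_inv[OF n(1)]
  fix a assume "a \<in> A"
  then obtain H where a: "\<And>n. H n \<in> Cc_on L X" "H \<in> CS" "a = cls H" using A_E by metis
  show "atimes B (atimes B n a) (astar B n) \<in> A"
    unfolding n(4) a(3) B_star[OF n(3)] B_times[OF n(3) a(2)] B_times[OF CS_conv[OF n(3) a(2)] CS_star[OF n(3)]]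
  proof (intro A_I CS_conv CS_star n a)
    fix k
    have "conv (conv (F k) (H k)) (star_sec (F k)) \<in> Cc_on L (set_mult (set_mult U X) (gi ` U))"
      by (intro Cc_conv Cc_star bisection_mult bisection_units bi n a)
    then show "conv (conv (F k) (H k)) (star_sec (F k)) \<in> Cc_on L X"
      by (rule Cc_mono[OF bisection_units _ set_mult_sub_units(1)[OF n(1)], rotated])
        (intro bisectionD(1) bisection_mult bisection_units bi n)
  qed
  show "atimes B (atimes B (astar B n) a) n \<in> A"
    unfolding n(4) a(3) B_star[OF n(3)] B_times[OF CS_star[OF n(3)] a(2)] B_times[OF CS_conv[OF CS_star[OF n(3)] a(2)] n(3)]
  proof (intro A_I CS_conv CS_star n a)
    fix k
    have "conv (conv (star_sec (F k)) (H k)) (F k) \<in> Cc_on L (set_mult (set_mult (gi ` U) X) U)"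
      by (intro Cc_conv Cc_star bisection_mult bisection_units bi n a)
    then show "conv (conv (star_sec (F k)) (H k)) (F k) \<in> Cc_on L X"
      by (rule Cc_mono[OF bisection_units _ set_mult_sub_units(2)[OF n(1)], rotated])
        (intro bisectionD(1) bisection_mult bisection_units bi n)
  qed
qed

section \<open>Density\<close>

text \<open>With \<open>t = \<parallel>f(g)\<parallel>\<close> the function \<open>a = f* f / max (f* f) \<delta>\<close> takes the value \<open>t\<^sup>2 / max t\<^sup>2 \<delta>\<close> at the
  source of \<open>g\<close>. This is \<open>1\<close> if \<open>t\<^sup>2 \<ge> \<delta>\<close>; otherwise \<open>t\<close> itself is below \<open>\<surd>\<delta> = \<epsilon> / 2\<close>.\<close>

lemma approximate_unit:
  assumes U: "open_bisection L U" and f: "f \<in> Cc_on L U" and \<epsilon>: "\<epsilon> > 0"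
  obtains a where "a \<in> Cc_on L X" "d f (conv f a) < \<epsilon>"
proof -
  let ?k = "conv (star_sec f) f"
  define \<delta> where "\<delta> = (\<epsilon> / 2)\<^sup>2"
  have \<delta>: "\<delta> > 0" using \<epsilon> by (simp add: \<delta>_def)
  define c where "c t = 1 / max t \<delta>" for t
  have pos: "max t \<delta> \<noteq> 0" for t using \<delta> by linarith
  define a where "a g = sc (of_real (c (nm (?k g)))) (?k g)" for g
  note k = star_conv_Cc(1)[OF U f]
  have "continuous_on X (\<lambda>g. nm (?k g))"
    using Cc_sec[OF k] by (intro cont_nm[OF bisection_units Cc_cont[OF k]]) simp
  then have a: "a \<in> Cc_on L X"
    unfolding a_def c_def using pos by (intro Cc_scale[OF bisection_units k] continuous_intros) auto
  have fa: "conv f a g = sc (coef (a (s g))) (f g)" for g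
    by (rule conv_unit_r[OF U Cc_supp[OF f] Cc_supp[OF a]])
  have fa_Cc: "conv f a \<in> Cc_on L U"
  proof -
    have "continuous_on U (\<lambda>g. a (s g))"
      by (rule continuous_on_compose2[OF Cc_cont[OF a] continuous_on_subset[OF cont_s]]) auto
    then have "continuous_on U (\<lambda>g. coef (a (s g)))"
      using Cc_sec[OF a] by (intro continuous_on_compose2[OF cont_coef]) auto
    from Cc_scale[OF U f this] show ?thesis using ext[of "conv f a", OF fa] by simp
  qed
  have small: "nm (fdiff L (f g) (conv f a g)) \<le> \<epsilon> / 2" for g
  proof (cases "g \<in> U")
    case True
    define t where "t = nm (f g)"
    have t0: "0 \<le> t" by (simp add: t_def)
    have kg: "?k (s g) = sc (of_real (t\<^sup>2)) (un (s g))"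
      unfolding t_def by (rule star_conv_apply[OF U Cc_supp[OF f] True])
    then have "coef (a (s g)) = of_real (c (t\<^sup>2) * t\<^sup>2)" by (simp add: a_def norm_power)
    then have "nm (fdiff L (f g) (conv f a g)) = cmod (of_real (1 - c (t\<^sup>2) * t\<^sup>2) * coef (f g))"
      using Cc_sec[OF f] by (simp add: nm_fdiff fa algebra_simps)
    also have "\<dots> = \<bar>1 - c (t\<^sup>2) * t\<^sup>2\<bar> * t"
      unfolding norm_mult norm_of_real by (simp add: t_def)
    also have "\<dots> \<le> \<epsilon> / 2"
    proof (cases "t\<^sup>2 \<ge> \<delta>")
      case True
      then have "c (t\<^sup>2) * t\<^sup>2 = 1" using \<delta> by (auto simp: c_def max_def)
      then show ?thesis using \<epsilon> by simp
    next
      case False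
      then have "t < \<epsilon> / 2" unfolding \<delta>_def using \<epsilon> power_mono[of "\<epsilon> / 2" t 2] by linarith
      moreover have "0 \<le> c (t\<^sup>2) * t\<^sup>2" "c (t\<^sup>2) * t\<^sup>2 \<le> 1" using False \<delta> by (simp_all add: c_def)
      then have "\<bar>1 - c (t\<^sup>2) * t\<^sup>2\<bar> * t \<le> 1 * t" using t0 by (intro mult_right_mono) auto
      ultimately show ?thesis by simp
    qed
    finally show ?thesis .
  next
    case False
    then show ?thesis using Cc_off[OF f] \<epsilon> by (simp add: fa nm_fdiff)
  qed
  have "minus_sec f (conv f a) \<in> Cc_on L U"
    unfolding minus_eq by (intro Cc_plus Cc_sc U f fa_Cc)
  then have "d f (conv f a) \<le> \<epsilon> / 2"
    unfolding d_def using small by (rule cstar_le[OF cstar U])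
  then show ?thesis using that[OF a] \<epsilon> by simp
qed

abbreviation "D \<equiv> lin_span B {atimes B n a |n a. n \<in> N \<and> a \<in> A}"

lemma D_const_plus: "f \<in> C \<Longrightarrow> h \<in> C \<Longrightarrow> cls (\<lambda>_. f) \<in> D \<Longrightarrow> cls (\<lambda>_. h) \<in> D \<Longrightarrow> cls (\<lambda>_. plus_sec f h) \<in> D"
  using lin_span.plus[of "cls (\<lambda>_. f)" B _ "cls (\<lambda>_. h)"] by (simp add: B_plus CS_const)

lemma D_const_sc: "f \<in> C \<Longrightarrow> cls (\<lambda>_. f) \<in> D \<Longrightarrow> cls (\<lambda>_. sc_sec c f) \<in> D"
  using lin_span.scale[of "cls (\<lambda>_. f)" B _ c] by (simp add: B_scale CS_const)

text \<open>The approximants are taken among constant sequences, for which the operations of the completion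
  are those of the convolution algebra.\<close>

lemma D_dense_C:
  assumes "f \<in> C" "\<epsilon> > 0"
  shows "\<exists>f'\<in>C. cls (\<lambda>_. f') \<in> D \<and> d f f' < \<epsilon>"
  using assms
proof (induction arbitrary: \<epsilon> rule: C_induct)
  case zero
  then show ?case using lin_span.zero[of B] by (intro bexI[of _ Z]) (auto simp: B_zero d_self Z_in_C)
next
  case (base U f)
  obtain a where a: "a \<in> Cc_on L X" "d f (conv f a) < \<epsilon>" using approximate_unit[OF base] .
  have C: "f \<in> C" "a \<in> C" using Cc_in_C base a bisection_units by blast+
  have "cls (\<lambda>_. f) \<in> N" "cls (\<lambda>_. a) \<in> A" using base a C CS_const by (auto intro!: NI A_I)
  moreover have "atimes B (cls (\<lambda>_. f)) (cls (\<lambda>_. a)) = cls (\<lambda>_. conv f a)" using C by (simp add: B_times CS_const)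
  ultimately have "cls (\<lambda>_. conv f a) \<in> D" by (intro lin_span.base) force
  then show ?case using a C C_conv by blast
next
  case (plus f h)
  have "\<epsilon> / 2 > 0" using plus by simp
  then obtain f' h' where *: "f' \<in> C" "cls (\<lambda>_. f') \<in> D" "d f f' < \<epsilon> / 2" "h' \<in> C" "cls (\<lambda>_. h') \<in> D" "d h h' < \<epsilon> / 2"
    using plus.IH by meson
  have "d (plus_sec f h) (plus_sec f' h') < \<epsilon>" using d_plus[OF plus(1) *(1) plus(2) *(4)] * by simp
  then show ?case using D_const_plus * plus_in_C by blast
next
  case (scale c f)
  have c: "cmod c + 1 > 0" by (simp add: add_nonneg_pos)
  then have "\<epsilon> / (cmod c + 1) > 0" using scale by simp
  then obtain f' where *: "f' \<in> C" "cls (\<lambda>_. f') \<in> D" "d f f' < \<epsilon> / (cmod c + 1)" using scale.IH by meson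
  have "(cmod c + 1) * d f f' < \<epsilon>" using *(3) c by (simp add: field_simps)
  then have "d (sc_sec c f) (sc_sec c f') < \<epsilon>"
    using d_sc[OF scale(1) *(1)] d_nonneg[OF scale(1) *(1)] by (simp add: algebra_simps)
  then show ?case using D_const_sc * sc_in_C by blast
qed

lemma D_sub: "D \<subseteq> carrier B"
proof
  fix b assume "b \<in> D"
  then show "b \<in> carrier B"
  proof (induction rule: lin_span.induct)
    case zero
    then show ?case using CS_const[OF Z_in_C] by (simp add: B_zero cls_in_B)
  next
    case (base b)
    then obtain n a where na: "b = atimes B n a" "n \<in> N" "a \<in> A" by blast
    obtain U F where "F \<in> CS" "n = cls F" using NE[OF na(2)] by metis
    moreover obtain H where "H \<in> CS" "a = cls H" using A_E[OF na(3)] by metis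
    ultimately show ?case using na(1) by (simp add: B_times cls_in_B CS_conv)
  next
    case (plus a b)
    from plus.IH obtain F H where "F \<in> CS" "a = cls F" "H \<in> CS" "b = cls H"
      unfolding carrier_B by blast
    then show ?case by (simp add: B_plus cls_in_B CS_plus)
  next
    case (scale a c)
    from scale.IH obtain F where "F \<in> CS" "a = cls F" unfolding carrier_B by blast
    then show ?case by (simp add: B_scale cls_in_B CS_sc)
  qed
qed

lemma D_dense: "dense_in B D"
  unfolding dense_in_def
proof (intro conjI D_sub ballI allI impI)
  fix b and \<epsilon> :: real assume "b \<in> carrier B" and \<epsilon>: "\<epsilon> > 0"
  then obtain F where F: "F \<in> CS" "b = cls F" using carrier_B by blast
  have e3: "\<epsilon> / 3 > 0" using \<epsilon> by simp
  then obtain M where M: "\<And>m n. m \<ge> M \<Longrightarrow> n \<ge> M \<Longrightarrow> d (F m) (F n) < \<epsilon> / 3"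
    using F(1) unfolding CS_iff by meson
  obtain f' where f': "f' \<in> C" "cls (\<lambda>_. f') \<in> D" "d (F M) f' < \<epsilon> / 3"
    using D_dense_C[OF CS_C[OF F(1), of M] e3] by blast
  have "anorm B (aminus B b (cls (\<lambda>_. f'))) \<le> \<epsilon> / 3 + \<epsilon> / 3"
  proof (rule LIMSEQ_le_const2)
    show "(\<lambda>n. \<nu> (minus_sec (F n) f')) \<longlonglongrightarrow> anorm B (aminus B b (cls (\<lambda>_. f')))"
      unfolding F(2) B_minus[OF F(1) CS_const[OF f'(1)]]
      by (rule B_norm[OF CS_minus[OF F(1) CS_const[OF f'(1)]]])
    have "\<nu> (minus_sec (F n) f') \<le> \<epsilon> / 3 + \<epsilon> / 3" if "n \<ge> M" for n
      using d_triangle[OF CS_C[OF F(1), of n] CS_C[OF F(1), of M] f'(1)] M[OF that order_refl] f'(3)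
      unfolding d_def by linarith
    then show "\<exists>N. \<forall>n\<ge>N. \<nu> (minus_sec (F n) f') \<le> \<epsilon> / 3 + \<epsilon> / 3" by blast
  qed
  then have "anorm B (aminus B b (cls (\<lambda>_. f'))) < \<epsilon>" using \<epsilon> by linarith
  then show "\<exists>d\<in>D. anorm B (aminus B b d) < \<epsilon>" using f'(2) by blast
qed

theorem generating: "generating_normalizer_semigroup B A N"
  unfolding generating_normalizer_semigroup_def
  using star_semigroup_N normalizers D_dense by blast

section \<open>The canonical state\<close>

context
  fixes x \<psi>
  assumes x: "x \<in> X" and \<psi>: "\<And>F. F \<in> CS \<Longrightarrow> \<psi> (cls F) = ev x F"
begin

lemma cmod_ev_le: "F \<in> CS \<Longrightarrow> cmod (ev x F) \<le> anorm B (cls F)"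
proof -
  assume F: "F \<in> CS"
  show ?thesis
  proof (rule LIMSEQ_le)
    show "(\<lambda>n. cmod (coef (F n x))) \<longlonglongrightarrow> cmod (ev x F)" by (intro tendsto_intros ev_tendsto F)
    show "(\<lambda>n. \<nu> (F n)) \<longlonglongrightarrow> anorm B (cls F)" by (rule B_norm[OF F])
    show "\<exists>N. \<forall>n\<ge>N. cmod (coef (F n x)) \<le> \<nu> (F n)" using dominates[OF CS_C[OF F]] by simp
  qed
qed

lemma state: "is_state B \<psi>"
  unfolding is_state_def
proof (intro conjI ballI allI)
  fix a b assume "a \<in> carrier B" "b \<in> carrier B"
  then obtain F H where FH: "F \<in> CS" "a = cls F" "H \<in> CS" "b = cls H" unfolding carrier_B by blast
  have "(\<lambda>n. coef (plus_sec (F n) (H n) x)) \<longlonglongrightarrow> ev x F + ev x H"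
    using tendsto_add[OF ev_tendsto[OF FH(1), of x] ev_tendsto[OF FH(3), of x]] FH by (simp add: CS_C C_sec)
  then show "\<psi> (aplus B a b) = \<psi> a + \<psi> b"
    using FH by (simp add: B_plus \<psi> CS_plus evI)
next
  fix c b assume "b \<in> carrier B"
  then obtain F where F: "F \<in> CS" "b = cls F" using carrier_B by blast
  have "(\<lambda>n. coef (sc_sec c (F n) x)) \<longlonglongrightarrow> c * ev x F"
    using tendsto_mult_left[OF ev_tendsto[OF F(1), of x], of c] by simp
  then show "\<psi> (ascale B c b) = c * \<psi> b"
    using F by (simp add: B_scale \<psi> CS_sc evI)
next
  fix b assume "b \<in> carrier B"
  then obtain F where F: "F \<in> CS" "b = cls F" using carrier_B by blast
  have CS: "(\<lambda>n. conv (star_sec (F n)) (F n)) \<in> CS" by (intro CS_conv CS_star F)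
  have "ev x (\<lambda>n. conv (star_sec (F n)) (F n)) \<in> \<real>\<^sub>\<ge>\<^sub>0"
    by (rule closed_sequentially[OF closed_nonneg_Reals_complex _ ev_tendsto[OF CS]])
      (use star_conv_unit_nonneg[OF CS_C[OF F(1)] x] in blast)
  then show "\<psi> (atimes B (astar B b) b) \<in> \<real>\<^sub>\<ge>\<^sub>0"
    using F CS by (simp add: B_star B_times CS_star \<psi>)
next
  let ?T = "{cmod (\<psi> b) |b. b \<in> carrier B \<and> anorm B b \<le> 1}"
  have le: "y \<le> 1" if "y \<in> ?T" for y
  proof -
    from that obtain b where b: "b \<in> carrier B" "anorm B b \<le> 1" "y = cmod (\<psi> b)" by blast
    obtain F where F: "F \<in> CS" "b = cls F" using carrier_B b(1) by blast
    show ?thesis using cmod_ev_le[OF F(1)] b F \<psi> by simp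
  qed
  then show "bdd_above ?T" by (auto simp: bdd_above_def)
  obtain V Q where V: "V \<in> Cc_on L X" "\<And>g. nm (V g) \<le> 1" "coef (V x) = 1"
    using bump[OF open_units order_refl x] by metis
  have CS: "(\<lambda>_. V) \<in> CS" using CS_const Cc_in_C[OF bisection_units V(1)] by blast
  have "anorm B (cls (\<lambda>_. V)) = \<nu> V" using B_norm[OF CS] LIMSEQ_unique tendsto_const by blast
  then have "anorm B (cls (\<lambda>_. V)) \<le> 1" using cstar_le[OF cstar bisection_units V(1,2)] by simp
  moreover have "\<psi> (cls (\<lambda>_. V)) = 1" using \<psi>[OF CS] evI[of "\<lambda>_. V" x 1] V(3) by simp
  ultimately have "1 = cmod (\<psi> (cls (\<lambda>_. V))) \<and> cls (\<lambda>_. V) \<in> carrier B \<and> anorm B (cls (\<lambda>_. V)) \<le> 1"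
    using cls_in_B[OF CS] by simp
  then have "1 \<in> ?T" by blast
  then show "Sup ?T = 1" by (rule cSup_eq_maximum) (rule le)
qed

text \<open>The contrapositive of the last condition on canonical states. A non-zero value at \<open>x\<close> puts the unit
  \<open>x\<close> into the bisection \<open>U\<close> on which \<open>n\<close> lives; the bump function is then taken inside \<open>U \<inter> X\<close>.\<close>

lemma vanishes_off_trivial:
  assumes n: "n \<in> N" and "\<psi> n \<noteq> 0"
  shows "x \<in> trivial_points B X j n"
proof -
  obtain U F where U: "open_bisection L U" and F: "\<And>n. F n \<in> Cc_on L U" "F \<in> CS" "n = cls F" using NE[OF n] by metis
  have nz: "ev x F \<noteq> 0" using assms(2) F \<psi> by simp
  have xU: "x \<in> U"
  proof (rule ccontr)
    assume "x \<notin> U"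
    then have "(\<lambda>n. coef (F n x)) = (\<lambda>_. 0)" using Cc_off[OF F(1)] by simp
    then have "ev x F = 0" by (intro evI) simp
    then show False using nz by simp
  qed
  have "x \<in> normalizer_dom B X j n"
  proof -
    let ?H = "\<lambda>n. conv (star_sec (F n)) (F n)"
    have H: "\<And>n. ?H n \<in> Cc_on L X" "?H \<in> CS"
      using star_conv_Cc(1)[OF U F(1)] CS_conv[OF CS_star[OF F(2)] F(2)] by blast+
    obtain h where h: "h \<in> C0_functions X" "j h = cls ?H" "\<And>y. y \<in> X \<Longrightarrow> h y = ev y ?H"
      using cls_j[of ?H, OF H] by blast
    have "coef (?H n x) = coef (F n x) * cnj (coef (F n x))" for n
      using star_conv_apply[OF U Cc_supp[OF F(1)] xU, of n] x 
      by (simp add: complex_norm_square[symmetric] flip: cmod_coef)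
    then have "(\<lambda>n. coef (?H n x)) \<longlonglongrightarrow> ev x F * cnj (ev x F)"
      by (simp add: tendsto_mult tendsto_cnj ev_tendsto F)
    then have "h x = ev x F * cnj (ev x F)" using evI h(3)[OF x] by simp
    then have "h x \<noteq> 0" using nz by simp
    moreover have "atimes B (astar B n) n = cls ?H"
      using F by (simp add: B_star B_times CS_star)
    ultimately show ?thesis using h x unfolding normalizer_dom_def by auto
  qed
  moreover have "\<exists>v\<in>C0_functions X. v x = 1 \<and> atimes B n (j v) \<in> A"
  proof -
    have W: "open (U \<inter> X)" "U \<inter> X \<subseteq> X" "x \<in> U \<inter> X" using U xU x open_units bisectionD(1) by auto
    have bW: "open_bisection L (U \<inter> X)" using bisection_open_subset[OF U W(1)] by blast
    obtain V Q where V: "V \<in> Cc_on L X" "coef (V x) = 1" and Q: "compact Q" "Q \<subseteq> U \<inter> X" "\<And>g. g \<notin> Q \<Longrightarrow> V g = Z g"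
      using bump[OF W] by metis
    have CSV: "(\<lambda>_. V) \<in> CS" using CS_const Cc_in_C[OF bisection_units V(1)] by blast
    obtain v where v: "v \<in> C0_functions X" "j v = cls (\<lambda>_. V)" "\<And>y. y \<in> X \<Longrightarrow> v y = ev y (\<lambda>_. V)"
      using cls_j[of "\<lambda>_. V", OF V(1) CSV] by blast
    have "v x = 1" using v(3)[OF x] evI[of "\<lambda>_. V" x 1] V(2) by simp
    moreover have "atimes B n (j v) \<in> A"
      unfolding F(3) v(2) B_times[OF F(2) CSV]
    proof (rule A_I)
      show "(\<lambda>n. conv (F n) V) \<in> CS" by (rule CS_conv[OF F(2) CSV])
      fix n
      have FV: "conv (F n) V g = sc (coef (V (s g))) (F n g)" for g
        by (rule conv_unit_r[OF U Cc_supp[OF F(1)] Cc_supp[OF V(1)]])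
      have "conv (F n) V \<in> Cc_on L (U \<inter> X)"
      proof (rule CcI[OF bW _ _ Q(1,2)])
        show "sec (conv (F n) V)" using Cc_sec[OF F(1)] Cc_sec[OF V(1)] by (rule sec_conv)
        have "continuous_on (U \<inter> X) (\<lambda>g. V (s g))"
          by (rule continuous_on_compose2[OF Cc_cont[OF V(1)] continuous_on_subset[OF cont_s]]) auto
        then have "continuous_on (U \<inter> X) (\<lambda>g. coef (V (s g)))"
          using Cc_sec[OF V(1)] by (intro continuous_on_compose2[OF cont_coef]) auto
        then have "continuous_on (U \<inter> X) (\<lambda>g. sc (coef (V (s g))) (F n g))"
          using Cc_sec[OF F(1)] continuous_on_subset[OF Cc_cont[OF F(1)]] by (intro cont_sc[OF bW]) auto
        then show "continuous_on (U \<inter> X) (conv (F n) V)" using ext[of "conv (F n) V", OF FV] by simp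
        show "conv (F n) V g = Z g" if "g \<notin> Q" for g
        proof (rule ccontr)
          assume "conv (F n) V g \<noteq> Z g"
          then have nz: "sc (coef (V (s g))) (F n g) \<noteq> Z g" by (simp only: FV not_False_eq_True)
          have "F n g \<noteq> Z g" by (rule notI) (use nz in simp)
          moreover have "V (s g) \<noteq> Z (s g)" by (rule notI) (use nz Cc_sec[OF F(1)] in simp)
          ultimately have "F n g \<noteq> Z g" "V (s g) \<noteq> Z (s g)" .
          then have "g \<in> U" "s g \<in> Q" using Cc_off[OF F(1)] Q(3) by blast+
          \<comment> \<open>Both \<open>g\<close> and \<open>s g\<close> lie in \<open>U\<close>, and they have the same source.\<close>
          moreover from this have "s g \<in> U" using Q(2) by blast
          ultimately have "g = s g" using s_bisection_eq[OF U, of g "s g"] by simp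
          then show False using that \<open>s g \<in> Q\<close> by simp
        qed
      qed
      then show "conv (F n) V \<in> Cc_on L X" by (rule Cc_mono[OF bisection_units W(1,2)])
    qed
    ultimately show ?thesis using v(1) by blast
  qed
  ultimately show ?thesis unfolding trivial_points_def by blast
qed

theorem canonical: "canonical_state B X j N x \<psi>"
  unfolding canonical_state_def
proof (intro conjI ballI impI state)
  fix h assume "h \<in> C0_functions X"
  then obtain F where "F \<in> CS" "j h = cls F" "ev x F = h x" using j_cls x by metis
  then show "\<psi> (j h) = h x" using \<psi> by simp
next
  fix n assume "n \<in> N" "x \<notin> trivial_points B X j n"
  then show "\<psi> n = 0" using vanishes_off_trivial by blast
qed

end

end

section \<open>The two completions\<close>

context fell
begin

lemma fell_norm_red: "fell_norm L (red_norm L)"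
  by unfold_locales (use red_cstar_norm nm_le_red C_bdd_op in auto)

lemma fell_norm_full: "fell_norm L (full_norm L)"
  by unfold_locales (use full_cstar_norm nm_le_red[OF C_bdd_op] red_le_full in \<open>auto intro: order_trans\<close>)

text \<open>The reduced norm is below the full one, so the canonical map sends the class of a sequence to the
  class of the same sequence.\<close>

lemma psi_full_cls:
  assumes F: "F \<in> cauchy_seqs S (full_norm L)" and x: "x \<in> X"
  shows "psi_full L x (fell_norm.cls L (full_norm L) F) = ev x F"
proof -
  interpret full: fell_norm L "full_norm L" by (rule fell_norm_full)
  interpret red: fell_norm L "red_norm L" by (rule fell_norm_red)
  have le: "red.d f h \<le> full.d f h" if "f \<in> C" "h \<in> C" for f h
    unfolding red.d_def full.d_def by (rule red_le_full[OF full.minus_in_C[OF that]])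
  have CS: "H \<in> red.CS" if "H \<in> full.CS" for H
    unfolding red.CS_iff
  proof (intro conjI allI impI)
    show HC: "H n \<in> C" for n using that by (rule full.CS_C)
    fix \<epsilon> :: real assume "\<epsilon> > 0"
    with that obtain N where "\<And>m n. m \<ge> N \<Longrightarrow> n \<ge> N \<Longrightarrow> full.d (H m) (H n) < \<epsilon>"
      unfolding full.CS_iff by meson
    then show "\<exists>N. \<forall>m\<ge>N. \<forall>n\<ge>N. red.d (H m) (H n) < \<epsilon>"
      using le[OF HC HC] le_less_trans by blast
  qed
  have "full_to_red L (full.cls F) = (\<Union>H\<in>full.cls F. red.cls H)"
    by (simp add: full_to_red_def completion_map_def red.cls_def)
  also have "\<dots> = red.cls F"
  proof (rule red.UN_constant[OF full.cls_self[OF F]])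
    fix H assume "H \<in> full.cls F"
    then have H: "H \<in> full.CS" "(\<lambda>n. full.d (F n) (H n)) \<longlonglongrightarrow> 0" by (auto simp: full.cls_iff)
    have "(\<lambda>n. red.d (F n) (H n)) \<longlonglongrightarrow> 0"
    proof (rule real_tendsto_sandwich[OF _ _ tendsto_const H(2)])
      show "\<forall>\<^sub>F n in sequentially. 0 \<le> red.d (F n) (H n)"
        by (intro always_eventually allI red.d_nonneg full.CS_C[OF F] full.CS_C[OF H(1)])
      show "\<forall>\<^sub>F n in sequentially. red.d (F n) (H n) \<le> full.d (F n) (H n)"
        by (intro always_eventually allI le full.CS_C[OF F] full.CS_C[OF H(1)])
    qed
    then show "red.cls H = red.cls F" by (intro red.cls_eqI[symmetric] CS F H)
  qed
  finally show ?thesis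
    unfolding psi_full_def using red.psi_red_cls[OF CS[OF F] x] by simp
qed

end

theorem proposition24p2:
  fixes L :: "('g::topological_space, 'l::topological_space) fell_bundle"
    and x :: 'g
  assumes "fell_line_bundle L"
    and "x \<in> units L"
  shows
    "(generating_normalizer_semigroup (full_cstar L)
        (unit_embed L (full_norm L) ` C0_functions (units L))
        (bisection_elements L (full_norm L)) \<and>
      canonical_state (full_cstar L) (units L) (unit_embed L (full_norm L))
        (bisection_elements L (full_norm L)) x (psi_full L x)) \<and>
     (generating_normalizer_semigroup (red_cstar L)
        (unit_embed L (red_norm L) ` C0_functions (units L))
        (bisection_elements L (red_norm L)) \<and>
      canonical_state (red_cstar L) (units L) (unit_embed L (red_norm L))
        (bisection_elements L (red_norm L)) x (psi_red L x))"
proof -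
  interpret fell L
    by unfold_locales (use assms(1) in \<open>auto simp: fell_line_bundle_def\<close>)
  interpret full: fell_norm L "full_norm L" by (rule fell_norm_full)
  interpret red: fell_norm L "red_norm L" by (rule fell_norm_red)
  show ?thesis
    unfolding full_cstar_def red_cstar_def
    using full.generating red.generating
      full.canonical[OF assms(2) psi_full_cls[OF _ assms(2)]]
      red.canonical[OF assms(2) red.psi_red_cls[OF _ assms(2)]]
    by blast
qed

end
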